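(* Let $\alpha\in[0,1)$. Put $\gamma_0(\alpha)=1$; let $\gamma_1(\alpha)\in(0,1]$ be the only positive root of $$\Phi_{1,\alpha}(x)=(1-\alpha)^2x^2+2\alpha(1-\alpha)x^{\frac32}+\alpha^2x-(1-\alpha)^2,$$ and, for every integer $n\ge 2$, let $\gamma_n(\alpha)\in(0,1)$ be the only positive root of $$\Phi_{n,\alpha}(x)=(1-\alpha)^2x^{n+1}+2\alpha(1-\alpha)\sum_{i=0}^{n-1}x^{n-i+\frac12}+(1-2\alpha+2\alpha^2)\sum_{i=0}^{n-2}x^{i+2}+\alpha^2x-(1-\alpha)^2$$ (these roots exist and are unique as indicated). For every integer $n\ge 0$ let $$\eta_n(\alpha)=2\alpha+(1-\alpha)\gamma_n(\alpha)^{\frac12}+(1-\alpha)\gamma_n(\alpha)^{-\frac12}.$$ Then $2=\eta_0(0)=\eta_1(0)<\eta_2(0)<\cdots$ if $\alpha=0$, and $2=\eta_0(\alpha)<\eta_1(\alpha)<\eta_2(\alpha)<\cdots$ if $\alpha\in(0,1)$. Moreover $\lim_{n\to\infty}\eta_n(\alpha)=\Psi(\alpha)$, and the numbers $\eta_n(\alpha)$, $n\ge0$, are precisely all the limit points of the $A_\alpha$-spectral radius of graphs that are smaller than $\Psi(\alpha)$.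
   Context: Graphs are finite, simple and undirected. For a graph $G$ with adjacency matrix $A(G)$ and diagonal degree matrix $D(G)$, and $\alpha\in[0,1]$, let $A_\alpha(G)=\alpha D(G)+(1-\alpha)A(G)$, and let $\rho_{A_\alpha}(G)$ (the $A_\alpha$-spectral radius) be the largest absolute value of an eigenvalue of $A_\alpha(G)$. A real number $\gamma$ is a limit point of the $A_\alpha$-spectral radius of graphs if there is a sequence of graphs $(G_k)_{k\in\mathbb N}$ with $\rho_{A_\alpha}(G_i)\ne\rho_{A_\alpha}(G_j)$ whenever $i\neq j$ and $\lim_{k\to\infty}\rho_{A_\alpha}(G_k)=\gamma$. $P_n$ is the path on $n$ vertices. $P_2(P_m,P_n)$ is the tree obtained from the disjoint union of $P_2$, $P_m$ and $P_n$ by joining one fixed vertex $u$ of $P_2$ by an edge to an end-vertex of $P_m$ and by an edge to an end-vertex of $P_n$ (so $u$ has degree 3 and is adjacent to a pendant vertex, and removing $u$ leaves $P_1\cup P_m\cup P_n$). Define $\Psi(\alpha)=\lim_{n\to\infty}\rho_{A_\alpha}(P_2(P_n,P_n))$ (this limit exists). *)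

theory Defs
  imports
    "HOL-Analysis.Analysis"
    "Graph_Theory.Pair_Digraph"
    "Jordan_Normal_Form.Spectral_Radius"
begin

text \<open>
  A finite simple undirected graph is a nonempty \<^locale>\<open>pair_graph\<close>: finite, loop-free, with a
  symmetric set of arcs, each edge being represented by its two orientations.  In particular,
  degree = out-degree.  Vertices are natural numbers, which covers all finite graphs up to
  isomorphism.  The empty graph is excluded because its matrix has no eigenvalue.
\<close>

definition simple_graph :: "nat pair_pre_digraph \<Rightarrow> bool" where
  "simple_graph G \<longleftrightarrow> pair_graph G \<and> pverts G \<noteq> {}"

text \<open>
  The library's matrices are indexed by \<open>{0..<n}\<close>, so the vertices are enumerated in
  increasing order; the spectrum does not depend on the enumeration.
\<close>

definition vertex :: "nat pair_pre_digraph \<Rightarrow> nat \<Rightarrow> nat" where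
  "vertex G i = sorted_list_of_set (pverts G) ! i"

definition adjacency_matrix :: "nat pair_pre_digraph \<Rightarrow> complex mat" where
  "adjacency_matrix G = Matrix.mat (card (pverts G)) (card (pverts G))
     (\<lambda>(i, j). if (vertex G i, vertex G j) \<in> parcs G then 1 else 0)"

definition degree_matrix :: "nat pair_pre_digraph \<Rightarrow> complex mat" where
  "degree_matrix G = Matrix.mat (card (pverts G)) (card (pverts G))
     (\<lambda>(i, j). if i = j then of_nat (out_degree (with_proj G) (vertex G i)) else 0)"

definition A_alpha :: "real \<Rightarrow> nat pair_pre_digraph \<Rightarrow> complex mat" where
  "A_alpha \<alpha> G = complex_of_real \<alpha> \<cdot>\<^sub>m degree_matrix G
     + complex_of_real (1 - \<alpha>) \<cdot>\<^sub>m adjacency_matrix G"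

definition rho :: "real \<Rightarrow> nat pair_pre_digraph \<Rightarrow> real" where
  "rho \<alpha> G = spectral_radius (A_alpha \<alpha> G)"

definition is_rho_limit_point :: "real \<Rightarrow> real \<Rightarrow> bool" where
  "is_rho_limit_point \<alpha> c \<longleftrightarrow> (\<exists>G :: nat \<Rightarrow> nat pair_pre_digraph.
     (\<forall>k. simple_graph (G k)) \<and>
     (\<forall>i j. i \<noteq> j \<longrightarrow> rho \<alpha> (G i) \<noteq> rho \<alpha> (G j)) \<and>
     (\<lambda>k. rho \<alpha> (G k)) \<longlonglongrightarrow> c)"

text \<open>The path on the \<open>n\<close> vertices \<open>a, a + 1, \<dots>, a + n - 1\<close>.\<close>

definition path_from :: "nat \<Rightarrow> nat \<Rightarrow> nat pair_pre_digraph" where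
  "path_from a n = \<lparr> pverts = {a..<a + n},
     parcs = {(i, j). i \<in> {a..<a + n} \<and> j \<in> {a..<a + n} \<and> (j = Suc i \<or> i = Suc j)} \<rparr>"

text \<open>
  The tree \<open>P_2(P_m, P_n)\<close>, for \<open>m, n \<ge> 1\<close>: the three paths occupy consecutive blocks of vertices,
  \<open>u = 0\<close> is the chosen vertex of \<open>P_2\<close>, and it is joined to the end-vertices \<open>2\<close> of \<open>P_m\<close>
  and \<open>m + 2\<close> of \<open>P_n\<close>.
\<close>

definition P2_tree :: "nat \<Rightarrow> nat \<Rightarrow> nat pair_pre_digraph" where
  "P2_tree m n = \<lparr>
     pverts = pverts (path_from 0 2) \<union> pverts (path_from 2 m) \<union> pverts (path_from (m + 2) n),
     parcs = parcs (path_from 0 2) \<union> parcs (path_from 2 m) \<union> parcs (path_from (m + 2) n)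
       \<union> {(0, 2), (2, 0), (0, m + 2), (m + 2, 0)} \<rparr>"

text \<open>The sequence starts at \<open>P_2(P_1, P_1)\<close>.\<close>

definition Psi :: "real \<Rightarrow> real" where
  "Psi \<alpha> = lim (\<lambda>n. rho \<alpha> (P2_tree (Suc n) (Suc n)))"

text \<open>Only used for \<open>n \<ge> 1\<close> and \<open>x > 0\<close>.\<close>

definition Phi :: "nat \<Rightarrow> real \<Rightarrow> real \<Rightarrow> real" where
  "Phi n \<alpha> x =
    (if n = 1 then
       (1 - \<alpha>)\<^sup>2 * x\<^sup>2 + 2 * \<alpha> * (1 - \<alpha>) * x powr (3/2) + \<alpha>\<^sup>2 * x - (1 - \<alpha>)\<^sup>2
     else
       (1 - \<alpha>)\<^sup>2 * x ^ (n + 1)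
       + 2 * \<alpha> * (1 - \<alpha>) * (\<Sum>i = 0..n - 1. x powr (real n - real i + 1/2))
       + (1 - 2 * \<alpha> + 2 * \<alpha>\<^sup>2) * (\<Sum>i = 0..n - 2. x ^ (i + 2))
       + \<alpha>\<^sup>2 * x - (1 - \<alpha>)\<^sup>2)"

definition gamma_root :: "nat \<Rightarrow> real \<Rightarrow> real" where
  "gamma_root n \<alpha> = (if n = 0 then 1 else (THE x. x > 0 \<and> Phi n \<alpha> x = 0))"

definition eta :: "nat \<Rightarrow> real \<Rightarrow> real" where
  "eta n \<alpha> = 2 * \<alpha> + (1 - \<alpha>) * gamma_root n \<alpha> powr (1/2) + (1 - \<alpha>) * gamma_root n \<alpha> powr (- 1/2)"

end

theory Submission
  imports Defs
begin

text \<open>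
  For a nonnegative matrix, a nonzero \<open>f \<ge> 0\<close> with \<open>A f \<ge> c f\<close> forces \<open>\<rho>(A) \<ge> c\<close>, and a positive
  \<open>f\<close> with \<open>A f \<le> c f\<close> forces \<open>\<rho>(A) \<le> c\<close>; every estimate below comes from an explicit such \<open>f\<close>.
  Put \<open>kappa = \<alpha>/(1-\<alpha>)\<close> and parametrise the levels as \<open>2\<alpha> + (1-\<alpha>)(t + 1/t)\<close>, so that
  solutions along a path are combinations of \<open>t^k\<close> and \<open>t^(-k)\<close>.  With \<open>x = t\<^sup>2\<close> the polynomial
  factors as \<open>\<Phi>\<^sub>n(x) = (1-\<alpha>)\<^sup>2 ((t+kappa)\<^sup>2 (t\<^sup>2 + \<dots> + t^(2n)) - 1)\<close>, and its root is where the infinite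
  tree \<open>P\<^sub>2(P\<^sub>n, P\<^sub>\<infinity>)\<close> has a decaying eigenfunction; for \<open>n \<longrightarrow> \<infinity>\<close> the
  condition becomes \<open>(t+kappa)\<^sup>2 t\<^sup>2 = 1 - t\<^sup>2\<close>, which gives \<open>\<Psi>(\<alpha>)\<close>.

  Conversely, let \<open>c < \<Psi>(\<alpha>)\<close> lie strictly between \<open>\<eta>\<^sub>n\<close> and \<open>\<eta>\<^sub>n\<^sub>+\<^sub>1\<close>, and let \<open>G\<close> be connected with many
  vertices and spectral radius near \<open>c\<close>.  Its degrees are at most 4, so it has a long path.  Along a
  longest path the value \<open>c < \<Psi>(\<alpha>)\<close> excludes a cycle with a pendant edge, two pendants at
  one vertex, a longer branch, and two branching vertices in the same half; and \<open>c < \<eta>\<^sub>n\<^sub>+\<^sub>1\<close>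
  puts the branching vertices within distance \<open>n\<close> of the ends.  So \<open>G\<close> is a cycle, a path, or a path
  with at most one pendant near each end, and then a supersolution shows that its spectral radius
  is at most 2 or close to \<open>\<eta>\<^sub>n\<close>, a contradiction.
\<close>

section \<open>Sub- and supersolutions\<close>

text \<open>Dividing the eigenvalue equation by 1-\<alpha> and writing the level as
  (1-\<alpha>)(2*kappa + z), z = t + 1/t, removes kappa at every vertex of degree 2; it survives
  only at ends and branching vertices. A vertex of value 1 carrying a leaf, an arm of n vertices and
  an infinite path balances iff 3*kappa + leaf + arm_ratio + t = 2*kappa + t + 1/t, and this happens
  exactly when t^2 is the root of \<open>Phi n\<close>. Levels decrease in t, so a lower level means
  a larger t. The obstacle is that infinite paths must be replaced by finite ones, at a cost at the
  branching vertex. The converse therefore works with parameters strictly beside the roots: t to the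
  right of the limit root controls the shape of the graph, t' to the right of root n+1 the position
  of the branching vertices, and s to the left of root n carries the supersolution. The strict slack
  at each of them pays for every sufficiently long truncation. Large connected graphs suffice
  because a graph may be replaced by a connected subgraph with the same spectral radius, and graphs
  of bounded order have only finitely many spectral radii.\<close>

definition nbrs :: "nat pair_pre_digraph \<Rightarrow> nat \<Rightarrow> nat set" where
  "nbrs G v = {w. (v, w) \<in> parcs G}"

lemma simple_graphD:
  assumes "simple_graph G"
  shows "finite (pverts G)" "pverts G \<noteq> {}" "finite (nbrs G v)" "nbrs G v \<subseteq> pverts G"
    "v \<notin> nbrs G v" "w \<in> nbrs G v \<longleftrightarrow> v \<in> nbrs G w" "w \<in> nbrs G v \<Longrightarrow> v \<in> pverts G"
proof -
  interpret pair_graph G using assms by (simp add: simple_graph_def)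
  show f: "finite (pverts G)" by (rule pair_finite_verts)
  show "pverts G \<noteq> {}" using assms by (simp add: simple_graph_def)
  show s: "nbrs G v \<subseteq> pverts G" by (auto simp: nbrs_def dest: in_arcsD2)
  show "finite (nbrs G v)" using s f by (rule finite_subset)
  show "v \<notin> nbrs G v" using pair_no_loops by (force simp: nbrs_def)
  show "w \<in> nbrs G v \<longleftrightarrow> v \<in> nbrs G w"
    using pair_sym_arcs by (auto simp: nbrs_def symmetric_def sym_def)
  show "w \<in> nbrs G v \<Longrightarrow> v \<in> pverts G" by (auto simp: nbrs_def dest: in_arcsD1)
qed

lemma out_degree_eq_card_nbrs: "out_degree (with_proj G) v = card (nbrs G v)"
proof -
  have "out_arcs (with_proj G) v = Pair v ` nbrs G v"
    by (auto simp: out_arcs_def nbrs_def)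
  then show ?thesis
    by (simp add: out_degree_def card_image inj_on_def)
qed

lemma bij_betw_vertex:
  assumes "simple_graph G"
  shows "bij_betw (vertex G) {..<card (pverts G)} (pverts G)"
proof -
  have f: "finite (pverts G)" using assms by (rule simple_graphD)
  have "bij_betw ((!) (sorted_list_of_set (pverts G)))
      {..<length (sorted_list_of_set (pverts G))} (set (sorted_list_of_set (pverts G)))"
    by (rule bij_betw_nth) auto
  moreover have "vertex G = (!) (sorted_list_of_set (pverts G))"
    by (rule ext) (simp add: vertex_def)
  ultimately show ?thesis using f by simp
qed

lemma A_alpha_carrier [simp]: "A_alpha \<alpha> G \<in> carrier_mat (card (pverts G)) (card (pverts G))"
  by (simp add: A_alpha_def degree_matrix_def adjacency_matrix_def)

text \<open>The value type is left open because eigenvectors are complex while all test functions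
  are real.\<close>

definition act :: "real \<Rightarrow> nat pair_pre_digraph \<Rightarrow> (nat \<Rightarrow> 'a::real_algebra_1) \<Rightarrow> nat \<Rightarrow> 'a" where
  "act \<alpha> G f v = of_real (\<alpha> * card (nbrs G v)) * f v + of_real (1 - \<alpha>) * (\<Sum>w\<in>nbrs G v. f w)"

lemma A_alpha_mult_vec:
  fixes x :: "nat \<Rightarrow> complex"
  assumes G: "simple_graph G" and i: "i < card (pverts G)"
  defines "n \<equiv> card (pverts G)"
  shows "(A_alpha \<alpha> G *\<^sub>v Matrix.vec n (\<lambda>j. x (vertex G j))) $ i = act \<alpha> G x (vertex G i)"
proof -
  let ?vx = "vertex G"
  have bij: "bij_betw ?vx {..<n} (pverts G)" unfolding n_def by (rule bij_betw_vertex[OF G])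
  have fin: "finite (pverts G)" using G by (rule simple_graphD)
  have img: "?vx ` {..<n} = pverts G" and inj: "inj_on ?vx {..<n}"
    using bij by (auto simp: bij_betw_def)
  have "(A_alpha \<alpha> G *\<^sub>v Matrix.vec n (\<lambda>j. x (?vx j))) $ i
      = (\<Sum>j<n. A_alpha \<alpha> G $$ (i, j) * x (?vx j))"
    using i unfolding n_def
    by (simp add: A_alpha_def degree_matrix_def adjacency_matrix_def scalar_prod_def lessThan_atLeast0)
  also have "\<dots> = (\<Sum>j<n. (if i = j then of_real (\<alpha> * card (nbrs G (?vx j))) * x (?vx j) else 0)
       + (if ?vx j \<in> nbrs G (?vx i) then of_real (1 - \<alpha>) * x (?vx j) else 0))"
    using i unfolding n_def
    by (intro sum.cong) (auto simp: A_alpha_def degree_matrix_def adjacency_matrix_def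
        out_degree_eq_card_nbrs nbrs_def algebra_simps)
  also have "\<dots> = of_real (\<alpha> * card (nbrs G (?vx i))) * x (?vx i)
      + (\<Sum>j<n. if ?vx j \<in> nbrs G (?vx i) then of_real (1 - \<alpha>) * x (?vx j) else 0)"
    using i by (simp add: sum.distrib n_def)
  also have "(\<Sum>j<n. if ?vx j \<in> nbrs G (?vx i) then of_real (1 - \<alpha>) * x (?vx j) else 0)
      = (\<Sum>w\<in>pverts G. if w \<in> nbrs G (?vx i) then of_real (1 - \<alpha>) * x w else 0)"
    by (rule sum.reindex_bij_betw[OF bij])
  also have "\<dots> = (\<Sum>w\<in>nbrs G (?vx i). of_real (1 - \<alpha>) * x w)"
    using fin simple_graphD(4)[OF G, of "?vx i"]
    by (simp add: sum.If_cases Int_absorb1)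
  finally show ?thesis by (simp add: act_def sum_distrib_left)
qed

lemma act_mono:
  fixes f g :: "nat \<Rightarrow> real"
  assumes "simple_graph G" "0 \<le> \<alpha>" "\<alpha> < 1" "v \<in> pverts G" "\<And>w. w \<in> pverts G \<Longrightarrow> f w \<le> g w"
  shows "act \<alpha> G f v \<le> act \<alpha> G g v"
proof -
  have "(\<Sum>w\<in>nbrs G v. f w) \<le> (\<Sum>w\<in>nbrs G v. g w)"
    using assms simple_graphD(4)[OF assms(1), of v] by (intro sum_mono) auto
  then show ?thesis using assms unfolding act_def
    by (intro add_mono mult_left_mono) auto
qed

lemma act_scale: "act \<alpha> G (\<lambda>v. c * f v) v = c * act \<alpha> G f v" for f :: "nat \<Rightarrow> real"
  by (simp add: act_def sum_distrib_left algebra_simps)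

text \<open>Take absolute values of an eigenvector whose eigenvalue has maximal modulus: the
  triangle inequality turns the eigenvalue equation into an inequality. This covers disconnected
  graphs as well.\<close>

lemma rho_subeigenvector:
  assumes G: "simple_graph G" and \<alpha>: "0 \<le> \<alpha>" "\<alpha> < 1"
  obtains f :: "nat \<Rightarrow> real" where "\<And>v. f v \<ge> 0" "\<exists>v\<in>pverts G. f v > 0"
    "\<And>v. v \<in> pverts G \<Longrightarrow> rho \<alpha> G * f v \<le> act \<alpha> G f v" "0 \<le> rho \<alpha> G"
proof -
  define n where "n = card (pverts G)"
  have n: "n > 0" using simple_graphD(1,2)[OF G] by (simp add: n_def card_gt_0_iff)
  have A: "A_alpha \<alpha> G \<in> carrier_mat n n" by (simp add: n_def)
  from spectral_radius_mem_max(1)[OF A n] obtain ev where ev: "eigenvalue (A_alpha \<alpha> G) ev"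
    and rho: "rho \<alpha> G = norm ev" unfolding rho_def spectrum_def by auto
  from ev A obtain u where u: "u \<in> carrier_vec n" "u \<noteq> 0\<^sub>v n" "A_alpha \<alpha> G *\<^sub>v u = ev \<cdot>\<^sub>v u"
    unfolding eigenvalue_def eigenvector_def by auto
  have bij: "bij_betw (vertex G) {..<n} (pverts G)" unfolding n_def by (rule bij_betw_vertex[OF G])
  define x where "x v = u $ (inv_into {..<n} (vertex G) v)" for v
  have xv: "x (vertex G i) = u $ i" if "i < n" for i
    using bij that by (simp add: x_def bij_betw_def)
  have uvec: "u = Matrix.vec n (\<lambda>j. x (vertex G j))"
    using u(1) xv by auto
  have eq: "ev * x v = act \<alpha> G x v" if v: "v \<in> pverts G" for v
  proof -
    from v bij obtain i where i: "i < n" "v = vertex G i" unfolding bij_betw_def by blast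
    have "act \<alpha> G x v = (A_alpha \<alpha> G *\<^sub>v u) $ i"
      using A_alpha_mult_vec[OF G, of i \<alpha> x] i unfolding uvec n_def by simp
    also have "\<dots> = ev * u $ i" using u i by simp
    finally show ?thesis using xv i by simp
  qed
  show ?thesis
  proof (rule that[of "\<lambda>v. norm (x v)"])
    obtain i where "i < n" "u $ i \<noteq> 0" using u(1,2) by (metis eq_vecI carrier_vecD index_zero_vec)
    then show "\<exists>v\<in>pverts G. norm (x v) > 0"
      using xv bij by (intro bexI[of _ "vertex G i"]) (auto simp: bij_betw_def)
    fix v assume v: "v \<in> pverts G"
    have "rho \<alpha> G * norm (x v) = norm (act \<alpha> G x v)"
      using eq[OF v] by (simp add: rho norm_mult flip: eq[OF v])
    also have "\<dots> \<le> norm (of_real (\<alpha> * card (nbrs G v)) * x v) + norm (of_real (1 - \<alpha>) * (\<Sum>w\<in>nbrs G v. x w))"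
      unfolding act_def by (rule norm_triangle_ineq)
    also have "\<dots> \<le> act \<alpha> G (\<lambda>v. norm (x v)) v"
      unfolding act_def norm_mult norm_of_real using \<alpha>
      by (simp add: abs_mult mult_left_mono norm_sum)
    finally show "rho \<alpha> G * norm (x v) \<le> act \<alpha> G (\<lambda>v. norm (x v)) v" .
  qed (auto simp: rho)
qed

text \<open>Scale \<open>g\<close> until it touches the subeigenvector \<open>f\<close> from above,
  at a vertex \<open>v\<close> where \<open>f / g\<close> is largest. Monotonicity of
  \<open>act\<close> then bounds \<open>rho \<alpha> G * f v\<close> by \<open>c * f v\<close>, and
  \<open>f v > 0\<close>.\<close>

lemma rho_le:
  fixes g :: "nat \<Rightarrow> real"
  assumes G: "simple_graph G" and \<alpha>: "0 \<le> \<alpha>" "\<alpha> < 1"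
    and g: "\<And>v. v \<in> pverts G \<Longrightarrow> g v > 0" "\<And>v. v \<in> pverts G \<Longrightarrow> act \<alpha> G g v \<le> c * g v"
  shows "rho \<alpha> G \<le> c"
proof -
  obtain f :: "nat \<Rightarrow> real" where f: "\<And>v. f v \<ge> 0" "\<exists>v\<in>pverts G. f v > 0"
    "\<And>v. v \<in> pverts G \<Longrightarrow> rho \<alpha> G * f v \<le> act \<alpha> G f v"
    using rho_subeigenvector[OF G \<alpha>] by metis
  have fin: "finite (pverts G)" "pverts G \<noteq> {}" using G by (auto dest: simple_graphD)
  define r where "r = Max ((\<lambda>v. f v / g v) ` pverts G)"
  have rmax: "f v \<le> r * g v" if "v \<in> pverts G" for v
  proof -
    have "f v / g v \<le> r" unfolding r_def using fin that by simp
    then show ?thesis using g(1)[OF that] by (simp add: divide_le_eq)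
  qed
  have "r \<in> (\<lambda>v. f v / g v) ` pverts G" unfolding r_def using fin by (intro Max_in) auto
  then obtain v where v: "v \<in> pverts G" "f v = r * g v" using g(1) by force
  obtain v' where v': "v' \<in> pverts G" "f v' > 0" using f by auto
  have rpos: "r > 0" using rmax[OF v'(1)] v' g(1)[OF v'(1)]
    by (metis less_le_trans zero_less_mult_pos2)
  have "rho \<alpha> G * f v \<le> act \<alpha> G f v" by (rule f(3)[OF v(1)])
  also have "\<dots> \<le> act \<alpha> G (\<lambda>v. r * g v) v" by (rule act_mono[OF G \<alpha> v(1) rmax])
  also have "\<dots> \<le> r * (c * g v)" unfolding act_scale using rpos g(2)[OF v(1)] by simp
  also have "\<dots> = c * f v" by (simp add: v(2))
  finally show ?thesis using v(2) rpos g(1)[OF v(1)] by simp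
qed

text \<open>If \<open>\<rho> < m < c\<close>, the powers of \<open>A/m\<close> are bounded but stretch \<open>f\<close> by at least \<open>(c/m)^k\<close>.\<close>

lemma rho_ge:
  fixes f :: "nat \<Rightarrow> real"
  assumes G: "simple_graph G" and \<alpha>: "0 \<le> \<alpha>" "\<alpha> < 1"
    and f: "\<And>v. v \<in> pverts G \<Longrightarrow> f v \<ge> 0" "\<exists>v\<in>pverts G. f v > 0"
      "\<And>v. v \<in> pverts G \<Longrightarrow> c * f v \<le> act \<alpha> G f v"
  shows "c \<le> rho \<alpha> G"
proof (rule ccontr)
  assume "\<not> c \<le> rho \<alpha> G"
  then have lt: "rho \<alpha> G < c" by simp
  define n where "n = card (pverts G)"
  have n: "n > 0" using simple_graphD(1,2)[OF G] by (simp add: n_def card_gt_0_iff)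
  have bij: "bij_betw (vertex G) {..<n} (pverts G)" unfolding n_def by (rule bij_betw_vertex[OF G])
  have r0: "0 \<le> rho \<alpha> G" using rho_subeigenvector[OF G \<alpha>] by metis
  define m where "m = (rho \<alpha> G + c) / 2"
  have m: "rho \<alpha> G < m" "m < c" "m > 0" using lt r0 by (auto simp: m_def)
  define A where "A = A_alpha \<alpha> G"
  have A: "A \<in> carrier_mat n n" by (simp add: A_def n_def)
  define B where "B = complex_of_real (1 / m) \<cdot>\<^sub>m A"
  have B: "B \<in> carrier_mat n n" using A by (simp add: B_def)
  have "spectral_radius B < 1"
  proof -
    obtain ev where ev: "eigenvalue B ev" and sr: "spectral_radius B = norm ev"
      using spectral_radius_mem_max(1)[OF B n] unfolding spectrum_def by auto
    from ev B obtain u where u: "u \<in> carrier_vec n" "u \<noteq> 0\<^sub>v n" "B *\<^sub>v u = ev \<cdot>\<^sub>v u"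
      unfolding eigenvalue_def eigenvector_def by auto
    have "A *\<^sub>v u = (of_real m * ev) \<cdot>\<^sub>v u"
    proof -
      have "A = of_real m \<cdot>\<^sub>m B" using m A by (intro eq_matI) (auto simp: B_def)
      then have "A *\<^sub>v u = of_real m \<cdot>\<^sub>v (B *\<^sub>v u)" using B u(1) by auto
      then show ?thesis by (simp add: u(3) smult_smult_assoc)
    qed
    then have "of_real m * ev \<in> spectrum A"
      using u A by (auto simp: spectrum_def eigenvalue_def eigenvector_def)
    then have "norm (of_real m * ev) \<le> rho \<alpha> G"
      unfolding rho_def A_def[symmetric] using spectral_radius_mem_max(2)[OF A n] by blast
    then have "m * norm ev \<le> rho \<alpha> G" using m by (simp add: norm_mult)
    then have "m * norm ev < m * 1" using m by linarith
    then show ?thesis unfolding sr using m(3) by (simp only: mult_less_cancel_left_pos)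
  qed
  from spectral_radius_jnf_norm_bound_less_1_upper_triangular[OF B this]
  obtain C where C: "\<And>k. norm_bound (B ^\<^sub>m k) C" by auto
  define T where "T h v = act \<alpha> G h v / m" for h :: "nat \<Rightarrow> real" and v
  have step: "B *\<^sub>v Matrix.vec n (\<lambda>j. of_real (h (vertex G j))) = Matrix.vec n (\<lambda>j. of_real (T h (vertex G j)))" for h
  proof (intro eq_vecI)
    fix i assume "i < dim_vec (Matrix.vec n (\<lambda>j. complex_of_real (T h (vertex G j))))"
    then have i: "i < n" by simp
    have "(B *\<^sub>v Matrix.vec n (\<lambda>j. of_real (h (vertex G j)))) $ i
        = of_real (1/m) * (A *\<^sub>v Matrix.vec n (\<lambda>j. of_real (h (vertex G j)))) $ i"
      using A i unfolding B_def by (auto simp: scalar_prod_def sum_distrib_left intro!: sum.cong)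
    also have "\<dots> = of_real (1/m) * act \<alpha> G (\<lambda>v. complex_of_real (h v)) (vertex G i)"
      unfolding A_def using A_alpha_mult_vec[OF G, of i \<alpha> "\<lambda>v. of_real (h v)"] i by (simp add: n_def)
    finally show "(B *\<^sub>v Matrix.vec n (\<lambda>j. of_real (h (vertex G j)))) $ i
        = Matrix.vec n (\<lambda>j. complex_of_real (T h (vertex G j))) $ i"
      using i by (simp add: T_def act_def)
  qed (use B in auto)
  have pow: "B ^\<^sub>m k *\<^sub>v Matrix.vec n (\<lambda>j. of_real (h (vertex G j)))
      = Matrix.vec n (\<lambda>j. of_real ((T ^^ k) h (vertex G j)))" for k h
  proof (induction k arbitrary: h)
    case 0 then show ?case using B by simp
  next
    case (Suc k)
    have "B ^\<^sub>m Suc k *\<^sub>v Matrix.vec n (\<lambda>j. of_real (h (vertex G j)))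
        = B ^\<^sub>m k *\<^sub>v (B *\<^sub>v Matrix.vec n (\<lambda>j. of_real (h (vertex G j))))"
      using B by (simp add: assoc_mult_mat_vec[of _ n n _ n])
    also have "\<dots> = Matrix.vec n (\<lambda>j. of_real ((T ^^ k) (T h) (vertex G j)))"
      by (simp only: step Suc.IH)
    finally show ?case by (simp only: funpow_Suc_right o_apply)
  qed
  have low: "(c / m) ^ k * f v \<le> (T ^^ k) f v" if "v \<in> pverts G" for k v
    using that
  proof (induction k arbitrary: v)
    case 0 then show ?case by simp
  next
    case (Suc k)
    have "(c / m) ^ Suc k * f v = (c / m) ^ k * (c * f v) / m" by simp
    also have "\<dots> \<le> (c / m) ^ k * act \<alpha> G f v / m"
      using f(3)[OF Suc.prems] m by (intro divide_right_mono mult_left_mono) auto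
    also have "\<dots> = act \<alpha> G (\<lambda>v. (c / m) ^ k * f v) v / m" by (simp add: act_scale)
    also have "\<dots> \<le> act \<alpha> G ((T ^^ k) f) v / m"
      using m act_mono[OF G \<alpha> Suc.prems Suc.IH] by (intro divide_right_mono) auto
    also have "\<dots> = (T ^^ Suc k) f v" by (simp only: T_def funpow.simps o_apply)
    finally show ?case .
  qed
  obtain v where v: "v \<in> pverts G" "f v > 0" using f(2) by blast
  from v(1) bij have "v \<in> vertex G ` {..<n}" by (simp add: bij_betw_def)
  then obtain i where i: "i < n" "vertex G i = v" by auto
  define D where "D = (\<Sum>j<n. C * \<bar>f (vertex G j)\<bar>)"
  have up: "(T ^^ k) f v \<le> D" for k
  proof -
    have "(T ^^ k) f v \<le> norm ((B ^\<^sub>m k *\<^sub>v Matrix.vec n (\<lambda>j. complex_of_real (f (vertex G j)))) $ i)"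
      unfolding pow using i by (simp only: index_vec norm_of_real abs_ge_self)
    also have "\<dots> = norm (\<Sum>j<n. (B ^\<^sub>m k) $$ (i, j) * of_real (f (vertex G j)))"
    proof -
      have "B ^\<^sub>m k \<in> carrier_mat n n" using B by (rule pow_carrier_mat)
      then have "dim_row (B ^\<^sub>m k) = n" "dim_col (B ^\<^sub>m k) = n" by (rule carrier_matD)+
      then show ?thesis using i(1) by (simp only: index_mult_mat_vec scalar_prod_def dim_vec lessThan_atLeast0)
          (simp add: lessThan_atLeast0)
    qed
    also have "\<dots> \<le> (\<Sum>j<n. norm ((B ^\<^sub>m k) $$ (i, j) * of_real (f (vertex G j))))" by (rule norm_sum)
    also have "\<dots> \<le> D" unfolding D_def
    proof (intro sum_mono)
      fix j assume "j \<in> {..<n}"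
      then have "norm ((B ^\<^sub>m k) $$ (i, j)) \<le> C"
        using C[of k] B i unfolding norm_bound_def by auto
      then show "norm ((B ^\<^sub>m k) $$ (i, j) * complex_of_real (f (vertex G j))) \<le> C * \<bar>f (vertex G j)\<bar>"
        unfolding norm_mult norm_of_real by (rule mult_right_mono) simp
    qed
    finally show ?thesis .
  qed
  have "c / m > 1" using m by simp
  obtain k where "D / f v < (c / m) ^ k" using real_arch_pow[OF \<open>c / m > 1\<close>] by blast
  then have "D < (c / m) ^ k * f v" using v by (simp only: pos_divide_less_eq)
  then show False using low[OF v(1), of k] up[of k] by linarith
qed

section \<open>The roots of \<Phi>\<close>

definition spectral_sum :: "real \<Rightarrow> nat \<Rightarrow> real \<Rightarrow> real" where
  "spectral_sum kappa n t = (t + kappa)\<^sup>2 * (\<Sum>k=1..n. t ^ (2 * k))"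

text \<open>The geometric sum with its denominator cleared, so that t = 1 is no exception.\<close>

lemma spectral_sum_closed:
  "(1 - t\<^sup>2) * spectral_sum kappa n t = (t + kappa)\<^sup>2 * (t\<^sup>2 * (1 - t ^ (2 * n)))"
proof -
  have "(1 - t\<^sup>2) * (\<Sum>k=1..n. t ^ (2 * k)) = t\<^sup>2 * (1 - t ^ (2 * n))"
  proof (induction n)
    case (Suc n)
    have "(1 - t\<^sup>2) * (\<Sum>k=1..Suc n. t ^ (2 * k))
        = (1 - t\<^sup>2) * (\<Sum>k=1..n. t ^ (2 * k)) + (1 - t\<^sup>2) * t ^ (2 * Suc n)"
      by (simp add: distrib_left)
    moreover have "t ^ (2 * Suc n) = t\<^sup>2 * t ^ (2 * n)" by (simp add: power2_eq_square)
    ultimately show ?case unfolding Suc.IH by (simp only:) (simp only: algebra_simps)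
  qed simp
  then show ?thesis unfolding spectral_sum_def by (metis mult.left_commute)
qed

lemma spectral_sum_strict_mono:
  assumes "kappa \<ge> 0" "0 \<le> s" "s < t" "n \<ge> 1"
  shows "spectral_sum kappa n s < spectral_sum kappa n t"
proof -
  have "(\<Sum>k=1..n. s ^ (2 * k)) < (\<Sum>k=1..n. t ^ (2 * k))"
    using assms by (intro sum_strict_mono power_strict_mono) auto
  moreover have "(s + kappa)\<^sup>2 < (t + kappa)\<^sup>2" using assms by (intro power_strict_mono) auto
  moreover have "0 \<le> (\<Sum>k=1..n. s ^ (2 * k))" using assms by (intro sum_nonneg) auto
  ultimately show ?thesis unfolding spectral_sum_def
    using assms by (intro mult_strict_mono) auto
qed

lemma spectral_sum_Suc_less:
  assumes "kappa \<ge> 0" "0 < t"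
  shows "spectral_sum kappa n t < spectral_sum kappa (Suc n) t"
  using assms unfolding spectral_sum_def by (intro mult_strict_left_mono) auto

lemma continuous_spectral_sum [continuous_intros]:
  "continuous_on A (spectral_sum kappa n)"
  unfolding spectral_sum_def by (intro continuous_intros)

lemma spectral_sum_at_1: "spectral_sum kappa n 1 = (1 + kappa)\<^sup>2 * real n"
  by (simp add: spectral_sum_def)

lemma spectral_sum_root_exists:
  assumes "kappa \<ge> 0" "n \<ge> 1"
  shows "\<exists>t>0. t \<le> 1 \<and> spectral_sum kappa n t = 1"
proof -
  have "1 * 1 \<le> (1 + kappa)\<^sup>2 * real n" using assms by (intro mult_mono) auto
  then have "spectral_sum kappa n 1 \<ge> 1" by (simp add: spectral_sum_at_1)
  moreover have "spectral_sum kappa n 0 = 0" by (simp add: spectral_sum_def zero_power)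
  ultimately obtain t where "0 \<le> t" "t \<le> 1" "spectral_sum kappa n t = 1"
    using IVT'[of "spectral_sum kappa n" 0 1 1] continuous_spectral_sum by auto
  moreover from this have "t \<noteq> 0" using \<open>spectral_sum kappa n 0 = 0\<close> by auto
  ultimately show ?thesis by (intro exI[of _ t]) auto
qed

text \<open>\<open>(sqrt_gamma kappa n)\<^sup>2 = \<gamma>\<^sub>n(\<alpha>)\<close>; the choice is unique by strict monotonicity.\<close>

definition sqrt_gamma :: "real \<Rightarrow> nat \<Rightarrow> real" where
  "sqrt_gamma kappa n = (if n = 0 then 1 else (SOME t. 0 < t \<and> t \<le> 1 \<and> spectral_sum kappa n t = 1))"

lemma sqrt_gamma:
  assumes "kappa \<ge> 0"
  shows "0 < sqrt_gamma kappa n" "sqrt_gamma kappa n \<le> 1" "n \<ge> 1 \<Longrightarrow> spectral_sum kappa n (sqrt_gamma kappa n) = 1"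
proof -
  have *: "0 < sqrt_gamma kappa n \<and> sqrt_gamma kappa n \<le> 1 \<and> spectral_sum kappa n (sqrt_gamma kappa n) = 1" if "n \<ge> 1"
    using someI_ex[of "\<lambda>t. 0 < t \<and> t \<le> 1 \<and> spectral_sum kappa n t = 1"]
      spectral_sum_root_exists[OF assms that] that by (auto simp: sqrt_gamma_def)
  show "0 < sqrt_gamma kappa n" using * by (cases n) (auto simp: sqrt_gamma_def)
  show "sqrt_gamma kappa n \<le> 1" using * by (cases n) (auto simp: sqrt_gamma_def)
  show "n \<ge> 1 \<Longrightarrow> spectral_sum kappa n (sqrt_gamma kappa n) = 1" using * by auto
qed

lemma spectral_sum_less_1_iff:
  assumes "kappa \<ge> 0" "0 < t" "n \<ge> 1"
  shows "spectral_sum kappa n t < 1 \<longleftrightarrow> t < sqrt_gamma kappa n" "spectral_sum kappa n t > 1 \<longleftrightarrow> t > sqrt_gamma kappa n"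
    "spectral_sum kappa n t = 1 \<longleftrightarrow> t = sqrt_gamma kappa n"
  using spectral_sum_strict_mono[OF assms(1), of t "sqrt_gamma kappa n" n]
    spectral_sum_strict_mono[OF assms(1), of "sqrt_gamma kappa n" t n] sqrt_gamma[OF assms(1), of n] assms
  by (cases t "sqrt_gamma kappa n" rule: linorder_cases; force)+

text \<open>One more summand lifts the sum above 1 at the old root, so the root moves left. For n =
  0 the value at 1 is (1 + kappa)^2, which exceeds 1 only if kappa > 0; this is why \<alpha> = 0
  behaves differently.\<close>

lemma sqrt_gamma_Suc_less:
  assumes "kappa \<ge> 0" "n \<ge> 1 \<or> kappa > 0"
  shows "sqrt_gamma kappa (Suc n) < sqrt_gamma kappa n"
proof -
  have "spectral_sum kappa (Suc n) (sqrt_gamma kappa n) > 1"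
  proof (cases "n = 0")
    case True
    then have "1 < (1 + kappa)\<^sup>2" using assms by (intro one_less_power) auto
    then show ?thesis using True by (simp add: sqrt_gamma_def spectral_sum_at_1)
  next
    case False
    then show ?thesis
      using spectral_sum_Suc_less[OF assms(1) sqrt_gamma(1)[OF assms(1)], of n n] sqrt_gamma(3)[OF assms(1), of n] by simp
  qed
  then show ?thesis using spectral_sum_less_1_iff(2)[OF assms(1) sqrt_gamma(1)[OF assms(1), of n], of "Suc n"] by simp
qed

lemma sqrt_gamma_1_zero: "sqrt_gamma 0 1 = 1"
  using spectral_sum_less_1_iff(3)[of 0 1 1] by (simp add: spectral_sum_at_1)

lemma limit_root_exists:
  fixes kappa :: real
  assumes "kappa \<ge> 0"
  shows "\<exists>t>0. t < 1 \<and> (t + kappa)\<^sup>2 * t\<^sup>2 = 1 - t\<^sup>2"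
proof -
  let ?f = "\<lambda>t. (t + kappa)\<^sup>2 * t\<^sup>2 + t\<^sup>2"
  have "?f 1 \<ge> 1" by (simp add: algebra_simps)
  then obtain t where t: "0 \<le> t" "t \<le> 1" "?f t = 1"
    using IVT'[of ?f 0 1 1] by (fastforce intro!: continuous_intros)
  moreover have "t \<noteq> 0" using t by auto
  moreover have "t \<noteq> 1"
  proof
    assume "t = 1"
    then have "(1 + kappa)\<^sup>2 = 0" using t(3) by simp
    then show False using assms by simp
  qed
  ultimately show ?thesis by (intro exI[of _ t]) auto
qed

definition sqrt_gamma_inf :: "real \<Rightarrow> real" where
  "sqrt_gamma_inf kappa = (SOME t. 0 < t \<and> t < 1 \<and> (t + kappa)\<^sup>2 * t\<^sup>2 = 1 - t\<^sup>2)"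

lemma sqrt_gamma_inf:
  assumes "kappa \<ge> 0"
  shows "0 < sqrt_gamma_inf kappa" "sqrt_gamma_inf kappa < 1" "(sqrt_gamma_inf kappa + kappa)\<^sup>2 * (sqrt_gamma_inf kappa)\<^sup>2 = 1 - (sqrt_gamma_inf kappa)\<^sup>2"
  using someI_ex[of "\<lambda>t. 0 < t \<and> t < 1 \<and> (t + kappa)\<^sup>2 * t\<^sup>2 = 1 - t\<^sup>2"] limit_root_exists[OF assms]
  by (auto simp: sqrt_gamma_inf_def)

lemma above_sqrt_gamma_inf:
  assumes "kappa \<ge> 0" "sqrt_gamma_inf kappa < t"
  shows "1 - t\<^sup>2 < (t + kappa)\<^sup>2 * t\<^sup>2"
proof -
  have "(sqrt_gamma_inf kappa + kappa)\<^sup>2 * (sqrt_gamma_inf kappa)\<^sup>2 < (t + kappa)\<^sup>2 * t\<^sup>2"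
    using sqrt_gamma_inf[OF assms(1)] assms by (intro mult_strict_mono power_strict_mono) auto
  moreover have "(sqrt_gamma_inf kappa)\<^sup>2 < t\<^sup>2" using sqrt_gamma_inf[OF assms(1)] assms by (intro power_strict_mono) auto
  ultimately show ?thesis using sqrt_gamma_inf(3)[OF assms(1)] by simp
qed

text \<open>At the limit root the whole geometric series gives 1, so its n-th partial sum is 1 -
  t^(2n) < 1.\<close>

lemma sqrt_gamma_inf_less_sqrt_gamma:
  assumes "kappa \<ge> 0"
  shows "sqrt_gamma_inf kappa < sqrt_gamma kappa n"
proof (cases "n \<ge> 1")
  case True
  let ?t = "sqrt_gamma_inf kappa"
  have "?t\<^sup>2 < 1" using sqrt_gamma_inf[OF assms] by (simp add: power_less_one_iff abs_square_less_1)
  then have p: "1 - ?t\<^sup>2 > 0" by simp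
  have "(1 - ?t\<^sup>2) * spectral_sum kappa n ?t = (1 - ?t\<^sup>2) * (1 - ?t ^ (2 * n))"
    using spectral_sum_closed[of ?t kappa n] sqrt_gamma_inf(3)[OF assms] by (metis mult.assoc)
  then have "spectral_sum kappa n ?t = 1 - ?t ^ (2 * n)" using p by simp
  then have "spectral_sum kappa n ?t < 1" using sqrt_gamma_inf(1)[OF assms] by simp
  then show ?thesis using spectral_sum_less_1_iff(1)[OF assms sqrt_gamma_inf(1)[OF assms] True] by simp
qed (use sqrt_gamma_inf[OF assms] in \<open>simp add: sqrt_gamma_def\<close>)

lemma eventually_sqrt_gamma_less:
  assumes "kappa \<ge> 0" "sqrt_gamma_inf kappa < t"
  shows "\<forall>\<^sub>F n in sequentially. sqrt_gamma kappa n < t"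
proof (cases "t < 1")
  case True
  have t: "0 < t" using sqrt_gamma_inf(1)[OF assms(1)] assms by simp
  have "t\<^sup>2 < 1" using True t by (simp add: power_less_one_iff abs_square_less_1)
  then have p: "1 - t\<^sup>2 > 0" by simp
  have "(\<lambda>n. (t\<^sup>2) ^ n) \<longlonglongrightarrow> 0" using t \<open>t\<^sup>2 < 1\<close> by (intro LIMSEQ_realpow_zero) auto
  then have "(\<lambda>n. (t + kappa)\<^sup>2 * (t\<^sup>2 * (1 - (t\<^sup>2) ^ n)) / (1 - t\<^sup>2)) \<longlonglongrightarrow> (t + kappa)\<^sup>2 * (t\<^sup>2 * (1 - 0)) / (1 - t\<^sup>2)"
    using p by (intro tendsto_intros) auto
  moreover have "1 < (t + kappa)\<^sup>2 * (t\<^sup>2 * (1 - 0)) / (1 - t\<^sup>2)"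
    using above_sqrt_gamma_inf[OF assms] p by (simp add: less_divide_eq)
  ultimately have "\<forall>\<^sub>F n in sequentially. 1 < (t + kappa)\<^sup>2 * (t\<^sup>2 * (1 - (t\<^sup>2) ^ n)) / (1 - t\<^sup>2)"
    by (simp add: order_tendstoD)
  then have "\<forall>\<^sub>F n in sequentially. 1 < spectral_sum kappa n t"
  proof eventually_elim
    case (elim n)
    then show ?case using spectral_sum_closed[of t kappa n] p
      by (metis less_divide_eq_1_pos nonzero_mult_div_cancel_left less_numeral_extra(3) power_mult)
  qed
  with eventually_ge_at_top[of 1] show ?thesis
    by eventually_elim (use spectral_sum_less_1_iff(2)[OF assms(1) t] in auto)
next
  case False
  \<comment> \<open>Index 1 has to be left out: its root equals 1 when kappa = 0.\<close>
  have "sqrt_gamma kappa n < t" if "n \<ge> 2" for n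
  proof -
    have "Suc (n - 1) = n" "n - 1 \<ge> 1" using that by auto
    then show ?thesis
      using sqrt_gamma_Suc_less[OF assms(1), of "n - 1"] sqrt_gamma(2)[OF assms(1), of "n - 1"] False by simp
  qed
  then show ?thesis unfolding eventually_sequentially by blast
qed

lemma sqrt_gamma_tendsto:
  assumes "kappa \<ge> 0"
  shows "sqrt_gamma kappa \<longlonglongrightarrow> sqrt_gamma_inf kappa"
proof (rule order_tendstoI)
  fix a assume "a < sqrt_gamma_inf kappa"
  then show "\<forall>\<^sub>F n in sequentially. a < sqrt_gamma kappa n"
    using sqrt_gamma_inf_less_sqrt_gamma[OF assms] by (intro always_eventually) (force intro: less_trans)
qed (rule eventually_sqrt_gamma_less[OF assms])

section \<open>Levels as functions of t, and the translation of \<open>Phi\<close>,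
  \<open>gamma_root\<close> and \<open>eta\<close>\<close>

definition level :: "real \<Rightarrow> real \<Rightarrow> real" where
  "level \<alpha> t = 2 * \<alpha> + (1 - \<alpha>) * (t + 1 / t)"

lemma level_strict_antimono:
  assumes "\<alpha> < 1" "0 < s" "s < t" "t \<le> 1"
  shows "level \<alpha> t < level \<alpha> s"
proof -
  have "s * t < 1 * 1" using assms by (intro mult_less_le_imp_less) auto
  then have "0 < (t - s) * (1 - s * t) / (s * t)" using assms by simp
  also have "\<dots> = (s + 1 / s) - (t + 1 / t)" using assms by (simp add: field_simps)
  finally show ?thesis using assms by (simp add: level_def)
qed

lemma level_1: "level \<alpha> 1 = 2" by (simp add: level_def)

lemma level_conv:
  assumes "\<alpha> < 1"
  shows "level \<alpha> t = (1 - \<alpha>) * (2 * (\<alpha> / (1 - \<alpha>)) + (t + 1 / t))"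
  using assms by (simp add: level_def field_simps)

text \<open>With S = t^2 + ... + t^(2n), expand ((1-\<alpha>)t + \<alpha>)^2 S. The cross term t S
  gives the half-integral powers, summed backwards in \<open>Phi\<close>; t^2 S and S share the
  terms k = 2, ..., n, whose coefficient is (1-\<alpha>)^2 + \<alpha>^2 = 1 - 2\<alpha> +
  2\<alpha>^2, and leave over x^(n+1) and x.\<close>

lemma Phi_square:
  assumes "\<alpha> < 1" "n \<ge> 1" "0 < t"
  shows "Phi n \<alpha> (t\<^sup>2) = (1 - \<alpha>)\<^sup>2 * (spectral_sum (\<alpha> / (1 - \<alpha>)) n t - 1)"
proof -
  have half: "(t\<^sup>2) powr (real k + 1/2) = t ^ (2 * k + 1)" for k
  proof -
    have "(t\<^sup>2) powr (real k + 1/2) = (t powr 2) powr (real k + 1/2)"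
      using assms by (simp add: powr_numeral)
    also have "\<dots> = t powr real (2 * k + 1)" by (simp add: powr_powr algebra_simps)
    finally show ?thesis using assms by (simp only: powr_realpow)
  qed
  have sc: "(1 - \<alpha>)\<^sup>2 * spectral_sum (\<alpha> / (1 - \<alpha>)) n t = ((1 - \<alpha>) * t + \<alpha>)\<^sup>2 * (\<Sum>k=1..n. t ^ (2 * k))"
  proof -
    have "(1 - \<alpha>) * (t + \<alpha> / (1 - \<alpha>)) = (1 - \<alpha>) * t + \<alpha>" using assms by (simp add: field_simps)
    then show ?thesis unfolding spectral_sum_def by (metis mult.assoc power_mult_distrib)
  qed
  show ?thesis
  proof (cases "n = 1")
    case True
    have "(t\<^sup>2) powr (3/2) = t ^ 3" using half[of 1] by simp
    then have "Phi n \<alpha> (t\<^sup>2) = ((1 - \<alpha>) * t + \<alpha>)\<^sup>2 * (\<Sum>k=1..n. t ^ (2 * k)) - (1 - \<alpha>)\<^sup>2"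
      using True by (simp add: Phi_def algebra_simps power2_eq_square power3_eq_cube)
    then show ?thesis by (simp add: right_diff_distrib sc)
  next
    case False
    then obtain m where m: "n = Suc (Suc m)" using assms by (metis One_nat_def Suc_le_D le_SucE not0_implies_Suc not_less_eq_eq zero_less_one)
    have s1: "(\<Sum>i=0..n-1. (t\<^sup>2) powr (real n - real i + 1/2)) = (\<Sum>k=1..n. t ^ (2 * k + 1))"
    proof -
      have "(\<Sum>i=0..n-1. (t\<^sup>2) powr (real n - real i + 1/2)) = (\<Sum>i=0..n-1. t ^ (2 * (n - i) + 1))"
      proof (intro sum.cong refl)
        fix i assume "i \<in> {0..n-1}"
        then have "i \<le> n" by auto
        then show "(t\<^sup>2) powr (real n - real i + 1/2) = t ^ (2 * (n - i) + 1)"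
          using half[of "n - i"] by (simp add: of_nat_diff)
      qed
      also have "\<dots> = (\<Sum>k=1..n. t ^ (2 * k + 1))"
        by (rule sum.reindex_bij_witness[of _ "\<lambda>k. n - k" "\<lambda>i. n - i"]) (use m in auto)
      finally show ?thesis .
    qed
    have s2: "(\<Sum>i=0..n-2. (t\<^sup>2) ^ (i + 2)) = (\<Sum>k=2..n. t ^ (2 * k))"
      unfolding power_mult[symmetric]
    proof (rule sum.reindex_bij_witness[of _ "\<lambda>k. k - 2" "\<lambda>i. i + 2"])
    qed (use m in auto)
    have e1: "(\<Sum>k=1..n. t ^ (2 * k)) = t\<^sup>2 + (\<Sum>k=2..n. t ^ (2 * k))"
      using m by (simp add: sum.atLeast_Suc_atMost numeral_2_eq_2)
    have e2: "t\<^sup>2 * (\<Sum>k=1..n. t ^ (2 * k)) = (\<Sum>k=2..n. t ^ (2 * k)) + t ^ (2 * (n + 1))"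
    proof -
      have "t\<^sup>2 * (\<Sum>k=1..n. t ^ (2 * k)) = (\<Sum>k=1..n. t ^ (2 * Suc k))"
        by (simp add: sum_distrib_left power2_eq_square algebra_simps)
      also have "\<dots> = (\<Sum>k=2..Suc n. t ^ (2 * k))"
        by (subst sum.shift_bounds_cl_Suc_ivl[symmetric]) (simp add: numeral_2_eq_2)
      finally show ?thesis using m by simp
    qed
    have e3: "t * (\<Sum>k=1..n. t ^ (2 * k)) = (\<Sum>k=1..n. t ^ (2 * k + 1))"
      by (simp add: sum_distrib_left)
    have "Phi n \<alpha> (t\<^sup>2) = (1 - \<alpha>)\<^sup>2 * ((\<Sum>k=2..n. t ^ (2 * k)) + t ^ (2 * (n + 1))) + 2 * \<alpha> * (1 - \<alpha>) * (\<Sum>k=1..n. t ^ (2 * k + 1))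
        + \<alpha>\<^sup>2 * (t\<^sup>2 + (\<Sum>k=2..n. t ^ (2 * k))) - (1 - \<alpha>)\<^sup>2"
      using False unfolding Phi_def s1 s2
      by (simp add: algebra_simps power2_eq_square power_mult[symmetric])
        (simp add: power_mult power2_eq_square)
    also have "\<dots> = ((1 - \<alpha>) * t + \<alpha>)\<^sup>2 * (\<Sum>k=1..n. t ^ (2 * k)) - (1 - \<alpha>)\<^sup>2"
      unfolding e1[symmetric] e2[symmetric] e3[symmetric]
      by (simp add: algebra_simps power2_eq_square)
    finally show ?thesis by (simp add: right_diff_distrib sc)
  qed
qed

lemma Phi_root_iff:
  assumes "0 \<le> \<alpha>" "\<alpha> < 1" "n \<ge> 1" "x > 0"
  shows "Phi n \<alpha> x = 0 \<longleftrightarrow> x = (sqrt_gamma (\<alpha> / (1 - \<alpha>)) n)\<^sup>2"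
proof -
  have k: "\<alpha> / (1 - \<alpha>) \<ge> 0" using assms by simp
  have "Phi n \<alpha> x = 0 \<longleftrightarrow> sqrt x = sqrt_gamma (\<alpha> / (1 - \<alpha>)) n"
    using Phi_square[OF assms(2,3), of "sqrt x"] spectral_sum_less_1_iff(3)[OF k, of "sqrt x" n] assms by simp
  also have "\<dots> \<longleftrightarrow> x = (sqrt_gamma (\<alpha> / (1 - \<alpha>)) n)\<^sup>2"
  proof
    assume "sqrt x = sqrt_gamma (\<alpha> / (1 - \<alpha>)) n"
    then have "(sqrt x)\<^sup>2 = (sqrt_gamma (\<alpha> / (1 - \<alpha>)) n)\<^sup>2" by (rule arg_cong)
    then show "x = (sqrt_gamma (\<alpha> / (1 - \<alpha>)) n)\<^sup>2" using assms by simp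
  next
    assume "x = (sqrt_gamma (\<alpha> / (1 - \<alpha>)) n)\<^sup>2"
    then show "sqrt x = sqrt_gamma (\<alpha> / (1 - \<alpha>)) n" using sqrt_gamma(1)[OF k, of n] by simp
  qed
  finally show ?thesis .
qed

lemma gamma_root_eq:
  assumes "0 \<le> \<alpha>" "\<alpha> < 1"
  shows "gamma_root n \<alpha> = (sqrt_gamma (\<alpha> / (1 - \<alpha>)) n)\<^sup>2"
proof (cases "n = 0")
  case False
  have "0 < sqrt_gamma (\<alpha> / (1 - \<alpha>)) n" using assms by (intro sqrt_gamma) simp
  then show ?thesis using False Phi_root_iff[OF assms, of n]
    by (auto simp: gamma_root_def intro!: the_equality)
qed (simp add: gamma_root_def sqrt_gamma_def)

lemma eta_eq:
  assumes "0 \<le> \<alpha>" "\<alpha> < 1"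
  shows "eta n \<alpha> = level \<alpha> (sqrt_gamma (\<alpha> / (1 - \<alpha>)) n)"
proof -
  let ?t = "sqrt_gamma (\<alpha> / (1 - \<alpha>)) n"
  have t: "0 < ?t" using assms by (intro sqrt_gamma) simp
  have "(?t\<^sup>2) powr (1/2) = ?t" using t by (simp add: powr_half_sqrt)
  moreover have "(?t\<^sup>2) powr (- 1/2) = 1 / ?t"
    using calculation powr_minus_divide[of "?t\<^sup>2" "1/2"] by simp
  ultimately show ?thesis by (simp add: eta_def gamma_root_eq[OF assms] level_def algebra_simps)
qed

section \<open>Solutions along arms\<close>

text \<open>
  \<open>arm\<close> solves the equation at level \<open>2kappa + t + 1/t\<close> along a pendant path whose
  end-vertex has index 0 and degree 1; \<open>leaf\<close> is the value at a leaf whose neighbour has value 1.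
  Attaching a leaf, a pendant path of \<open>n\<close> vertices and an infinite path to one vertex balances at
  that vertex iff \<open>gap\<close> vanishes.  \<open>trunc\<close> replaces the decaying solution \<open>t^j\<close> by the one that
  vanishes at \<open>j = M\<close>; a subsolution may be cut off at a zero, since \<open>A f \<ge> 0\<close> there.
\<close>

definition arm :: "real \<Rightarrow> real \<Rightarrow> nat \<Rightarrow> real" where
  "arm kappa t k = (1 + kappa * t) / t ^ k - (t + kappa) * t ^ (k + 1)"

text \<open>Index n is the branching vertex itself: an arm of n vertices occupies the indices 0,
  ..., n-1, and the ratio is the value next to a branching vertex of value 1.\<close>

definition arm_ratio :: "real \<Rightarrow> real \<Rightarrow> nat \<Rightarrow> real" where
  "arm_ratio kappa t n = arm kappa t (n - 1) / arm kappa t n"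

definition leaf :: "real \<Rightarrow> real \<Rightarrow> real" where
  "leaf kappa t = t / (t * (t + kappa) + 1)"

definition gap :: "real \<Rightarrow> nat \<Rightarrow> real \<Rightarrow> real" where
  "gap kappa n t = 1 / t - kappa - leaf kappa t - arm_ratio kappa t n"

definition trunc :: "real \<Rightarrow> nat \<Rightarrow> nat \<Rightarrow> real" where
  "trunc t M j = (if j \<le> M then (t ^ j - t ^ (2 * M - j)) / (1 - t ^ (2 * M)) else 0)"

lemma leaf:
  assumes "kappa \<ge> 0" "0 < t"
  shows "leaf kappa t * (kappa + (t + 1 / t)) = 1" "0 < leaf kappa t" "leaf kappa t \<le> t" "leaf kappa t = 1 / (kappa + (t + 1 / t))"
proof -
  have p: "t * (t + kappa) + 1 > 0" "t * (t + kappa) \<ge> 0" using assms by (auto intro: add_nonneg_pos)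
  have "t * (kappa + (t + 1 / t)) = t * (t + kappa) + 1" using assms by (simp add: field_simps)
  then show 1: "leaf kappa t * (kappa + (t + 1 / t)) = 1" using p by (simp add: leaf_def)
  show "0 < leaf kappa t" "leaf kappa t \<le> t" unfolding leaf_def using p assms
    by (auto simp only: pos_divide_le_eq intro!: divide_pos_pos) (simp add: mult_le_cancel_left1)
  show "leaf kappa t = 1 / (kappa + (t + 1 / t))" using 1
    by (metis eq_divide_eq mult_zero_right zero_neq_one)
qed

lemma arm_scaled:
  assumes "0 < t"
  shows "arm kappa t k * t ^ k = (1 + kappa * t) - (t + kappa) * (t * t ^ (2 * k))"
  using assms by (simp add: arm_def left_diff_distrib mult_2 power_add)

text \<open>The smallest value occurs at k = 0, where the expression equals 1 - t^2.\<close>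

lemma arm_scaled_pos:
  fixes kappa t :: real
  assumes "kappa \<ge> 0" "0 < t" "t < 1"
  shows "(1 + kappa * t) - (t + kappa) * (t * t ^ (2 * k)) > 0"
proof -
  have "t ^ (2 * k) \<le> 1" using assms by (intro power_le_one) auto
  then have "(t + kappa) * (t * t ^ (2 * k)) \<le> (t + kappa) * (t * 1)"
    using assms by (intro mult_left_mono) auto
  moreover have "t * t < 1 * 1" using assms by (intro mult_strict_mono) auto
  ultimately show ?thesis by (simp add: algebra_simps)
qed

lemma arm_pos:
  assumes "kappa \<ge> 0" "0 < t" "t < 1"
  shows "arm kappa t k > 0"
  using arm_scaled_pos[OF assms, of k] arm_scaled[OF assms(2), of kappa k] assms(2)
  by (metis zero_less_mult_pos2 zero_less_power)

lemma arm_rec: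
  assumes "0 < t"
  shows "arm kappa t k + arm kappa t (Suc (Suc k)) = (t + 1 / t) * arm kappa t (Suc k)"
  using assms by (simp add: arm_def field_simps)

text \<open>The equation at the free end, which has degree 1; it fixes the two coefficients in
  \<open>arm\<close> up to scale.\<close>

lemma arm_1:
  assumes "0 < t"
  shows "arm kappa t (Suc 0) = (kappa + (t + 1 / t)) * arm kappa t 0"
  using assms by (simp add: arm_def field_simps)

lemma arm_ratio_eq:
  assumes "kappa \<ge> 0" "0 < t" "t < 1" "n \<ge> 1"
  shows "arm_ratio kappa t n = (t * (1 + kappa * t) - (t + kappa) * t ^ (2 * n)) / ((1 + kappa * t) - (t + kappa) * (t * t ^ (2 * n)))"
proof -
  obtain m where m: "n = Suc m" using assms by (cases n) auto
  have "arm kappa t m * t ^ n = t * (arm kappa t m * t ^ m)" by (simp add: m)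
  also have "\<dots> = t * (1 + kappa * t) - (t + kappa) * t ^ (2 * n)"
    unfolding arm_scaled[OF assms(2)] m by (simp add: algebra_simps)
  finally have "arm kappa t m * t ^ n / (arm kappa t n * t ^ n)
      = (t * (1 + kappa * t) - (t + kappa) * t ^ (2 * n)) / ((1 + kappa * t) - (t + kappa) * (t * t ^ (2 * n)))"
    unfolding arm_scaled[OF assms(2)] by simp
  then show ?thesis using assms(2) by (simp add: arm_ratio_def m)
qed

lemma arm_ratio_defect:
  assumes "kappa \<ge> 0" "0 < t" "t < 1" "n \<ge> 1"
  shows "t - arm_ratio kappa t n = (t + kappa) * (1 - t\<^sup>2) * t ^ (2 * n) / ((1 + kappa * t) - (t + kappa) * (t * t ^ (2 * n)))"
  unfolding arm_ratio_eq[OF assms] using arm_scaled_pos[OF assms(1-3), of n]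
  by (simp add: field_simps power2_eq_square)

lemma square_less_1: "0 < t \<Longrightarrow> t < 1 \<Longrightarrow> t\<^sup>2 < 1" for t :: real
  by (simp add: power_less_one_iff)

text \<open>The shortfall of a finite arm against the infinite one, whose ratio is t, has a
  numerator that falls and a denominator that grows with n. A longer arm thus contributes more at
  the branching vertex, so n is the worst case for supersolutions with arms of at most n
  vertices.\<close>

lemma arm_ratio_mono:
  assumes "kappa \<ge> 0" "0 < t" "t < 1" "1 \<le> m" "m \<le> n"
  shows "arm_ratio kappa t m \<le> arm_ratio kappa t n"
proof -
  have le: "t ^ (2 * n) \<le> t ^ (2 * m)" using assms by (intro power_decreasing) auto
  have "t - arm_ratio kappa t n \<le> t - arm_ratio kappa t m"
    unfolding arm_ratio_defect[OF assms(1-4)] arm_ratio_defect[OF assms(1-3) order_trans[OF assms(4,5)]]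
    using le assms arm_scaled_pos[OF assms(1-3), of m] square_less_1[OF assms(2,3)]
    by (intro frac_le mult_left_mono diff_left_mono mult_nonneg_nonneg) auto
  then show ?thesis by simp
qed

text \<open>The bridge from test functions to \<open>Phi\<close>: clearing the denominators of
  \<open>leaf\<close> and \<open>arm_ratio\<close> exposes the factor
  \<open>1 - spectral_sum kappa n t\<close>, with positive cofactors.\<close>

lemma gap_eq:
  assumes "kappa \<ge> 0" "0 < t" "t < 1" "n \<ge> 1"
  shows "gap kappa n t * (t * (t * (t + kappa) + 1) * ((1 + kappa * t) - (t + kappa) * (t * t ^ (2 * n))))
    = (1 + kappa * t) * (1 - t\<^sup>2) * (1 - spectral_sum kappa n t)"
proof -
  define Q where "Q = t ^ (2 * n)"
  define D where "D = (1 + kappa * t) - (t + kappa) * (t * Q)"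
  define E where "E = t * (t + kappa) + 1"
  have D: "D > 0" unfolding D_def Q_def by (rule arm_scaled_pos[OF assms(1-3)])
  have E: "E > 0" unfolding E_def using assms by (auto intro: add_nonneg_pos)
  have r: "arm_ratio kappa t n * D = t * (1 + kappa * t) - (t + kappa) * Q"
    using D unfolding arm_ratio_eq[OF assms] D_def Q_def by simp
  have l: "leaf kappa t * E = t" using E unfolding leaf_def E_def by simp
  have "gap kappa n t * (t * E * D) = (1 / t * t) * E * D - kappa * t * E * D - (leaf kappa t * E) * t * D - (arm_ratio kappa t n * D) * t * E"
    unfolding gap_def by (simp only: algebra_simps)
  also have "\<dots> = E * D - kappa * t * E * D - t * t * D - (t * (1 + kappa * t) - (t + kappa) * Q) * t * E"
    unfolding r l using assms by simp
  also have "\<dots> = (1 + kappa * t) * ((1 - t\<^sup>2) - (t + kappa)\<^sup>2 * (t\<^sup>2 * (1 - Q)))"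
    unfolding D_def E_def by (simp add: algebra_simps power2_eq_square)
  also have "\<dots> = (1 + kappa * t) * (1 - t\<^sup>2) * (1 - spectral_sum kappa n t)"
    unfolding Q_def spectral_sum_closed[symmetric] by (simp only: algebra_simps)
  finally show ?thesis unfolding E_def D_def Q_def .
qed

text \<open>To the right of the root the branching vertex receives more than it needs, which allows
  subsolutions on finite trees; to the left it receives less, which allows supersolutions.\<close>

lemma gap_sign:
  assumes "kappa \<ge> 0" "0 < t" "t < 1" "n \<ge> 1"
  shows "gap kappa n t < 0 \<longleftrightarrow> sqrt_gamma kappa n < t" "gap kappa n t > 0 \<longleftrightarrow> t < sqrt_gamma kappa n"
    "gap kappa n t = 0 \<longleftrightarrow> t = sqrt_gamma kappa n"
proof -
  define D where "D = t * (t * (t + kappa) + 1) * ((1 + kappa * t) - (t + kappa) * (t * t ^ (2 * n)))"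
  define N where "N = (1 + kappa * t) * (1 - t\<^sup>2)"
  have D: "D > 0" unfolding D_def using assms arm_scaled_pos[OF assms(1-3), of n]
    by (intro mult_pos_pos add_nonneg_pos) auto
  have N: "N > 0" unfolding N_def using assms square_less_1[OF assms(2,3)]
    by (intro mult_pos_pos add_pos_nonneg) auto
  have eq: "gap kappa n t = N / D * (1 - spectral_sum kappa n t)"
    using gap_eq[OF assms] D unfolding D_def[symmetric] N_def[symmetric] by (simp add: field_simps)
  have ND: "N / D > 0" using N D by simp
  have "gap kappa n t < 0 \<longleftrightarrow> spectral_sum kappa n t > 1" unfolding eq mult_less_0_iff using ND by linarith
  then show 1: "gap kappa n t < 0 \<longleftrightarrow> sqrt_gamma kappa n < t" using spectral_sum_less_1_iff(2)[OF assms(1,2,4)] by simp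
  have "gap kappa n t > 0 \<longleftrightarrow> spectral_sum kappa n t < 1" unfolding eq zero_less_mult_iff using ND by linarith
  then show 2: "gap kappa n t > 0 \<longleftrightarrow> t < sqrt_gamma kappa n" using spectral_sum_less_1_iff(1)[OF assms(1,2,4)] by simp
  show "gap kappa n t = 0 \<longleftrightarrow> t = sqrt_gamma kappa n" using 1 2 by linarith
qed

lemma trunc_0: "0 < t \<Longrightarrow> t < 1 \<Longrightarrow> 1 \<le> M \<Longrightarrow> trunc t M 0 = 1" for t :: real
  using power_less_one_iff[of t "2 * M"] by (simp add: trunc_def)

lemma trunc_pos:
  assumes "0 < t" "t < 1" "j < M"
  shows "trunc t M j > 0"
proof -
  have "t ^ (2 * M - j) < t ^ j" using assms by (intro power_strict_decreasing) auto
  moreover have "t ^ (2 * M) < 1" using assms by (simp add: power_less_one_iff)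
  ultimately show ?thesis using assms by (simp add: trunc_def)
qed

lemma trunc_end: "M \<le> j \<Longrightarrow> trunc t M j = 0"
  by (auto simp: trunc_def mult_2)

lemma trunc_nonneg: "0 < t \<Longrightarrow> t < 1 \<Longrightarrow> trunc t M j \<ge> 0"
  by (cases "j < M") (auto simp: trunc_end dest: trunc_pos[of t j M])

lemma trunc_rec:
  assumes "0 < t" "1 \<le> j" "j < M"
  shows "trunc t M (j - 1) + trunc t M (j + 1) = (t + 1 / t) * trunc t M j"
proof -
  obtain i where i: "j = Suc i" using assms by (cases j) auto
  obtain d where d: "2 * M - j = Suc d" "2 * M - Suc j = d" "2 * M - i = Suc (Suc d)"
    using assms i by (metis Suc_diff_Suc Suc_lessD less_imp_Suc_add mult_2 trans_less_add1)
  have "(t ^ i - t ^ Suc (Suc d)) + (t ^ Suc (Suc i) - t ^ d) = (t + 1 / t) * (t ^ Suc i - t ^ Suc d)"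
    using assms by (simp add: field_simps)
  then have "((t ^ i - t ^ Suc (Suc d)) + (t ^ Suc (Suc i) - t ^ d)) / (1 - t ^ (2 * M))
      = (t + 1 / t) * ((t ^ Suc i - t ^ Suc d) / (1 - t ^ (2 * M)))" by simp
  then show ?thesis using assms d unfolding i trunc_def by (simp add: add_divide_distrib)
qed

lemma trunc_sub:
  assumes "0 < t" "t < 1" "1 \<le> j"
  shows "(t + 1 / t) * trunc t M j \<le> trunc t M (j - 1) + trunc t M (j + 1)"
proof (cases "j < M")
  case True then show ?thesis using trunc_rec[OF assms(1,3) True] by simp
next
  case False then show ?thesis using trunc_nonneg[OF assms(1,2)] by (simp add: trunc_end add_nonneg_nonneg)
qed

lemma trunc_1_less:
  assumes "0 < t" "t < 1" "1 \<le> M"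
  shows "trunc t M 1 < t"
proof -
  have p: "t ^ (2 * M) < 1" using assms by (simp add: power_less_one_iff)
  obtain d where d: "2 * M = Suc (Suc d)" "2 * M - 1 = Suc d" using assms by (cases M) auto
  have "t ^ Suc (Suc (Suc d)) < t ^ Suc d" using assms by (intro power_strict_decreasing) auto
  then show ?thesis using assms p unfolding trunc_def d by (simp add: divide_less_eq algebra_simps)
qed

lemma trunc_1_tendsto:
  assumes "0 < t" "t < 1"
  shows "(\<lambda>M. trunc t M 1) \<longlonglongrightarrow> t"
proof -
  have l: "(\<lambda>M. (t\<^sup>2) ^ M) \<longlonglongrightarrow> 0"
    using assms square_less_1[OF assms] by (intro LIMSEQ_realpow_zero) auto
  have "(\<lambda>M. (t - (t\<^sup>2) ^ M / t) / (1 - (t\<^sup>2) ^ M)) \<longlonglongrightarrow> (t - 0 / t) / (1 - 0)"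
    using assms by (intro tendsto_intros l) auto
  moreover have "\<forall>\<^sub>F M in sequentially. (t - (t\<^sup>2) ^ M / t) / (1 - (t\<^sup>2) ^ M) = trunc t M 1"
    using eventually_ge_at_top[of 1]
  proof eventually_elim
    case (elim M)
    then obtain d where d: "2 * M = Suc (Suc d)" "2 * M - 1 = Suc d" by (cases M) auto
    have "(t\<^sup>2) ^ M = t ^ (2 * M)" by (simp add: power_mult)
    then show ?case using elim assms unfolding trunc_def d by simp
  qed
  ultimately show ?thesis by (simp add: tendsto_cong)
qed

text \<open>A strict inequality that holds with the value t of the infinite path survives every
  sufficiently long truncation.\<close>

lemma eventually_trunc:
  assumes "0 < t" "t < 1" "c < t"
  shows "\<exists>M0. \<forall>M\<ge>M0. c \<le> trunc t M 1"
  using order_tendstoD(1)[OF trunc_1_tendsto[OF assms(1,2)] assms(3)]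
  unfolding eventually_sequentially by (meson less_imp_le)

section \<open>Levels below \<Psi>(\<alpha>)\<close>

text \<open>
  The third condition says that the level of \<open>t\<close> is below \<open>\<Psi>(\<alpha>)\<close>; the fourth one, \<open>t \<le> sqrt_gamma kappa 1\<close>,
  gives \<open>t \<le> 2 * leaf kappa t\<close>, so that two leaves are worth at least an infinite path.
\<close>

definition above_limit :: "real \<Rightarrow> real \<Rightarrow> bool" where
  "above_limit kappa t \<longleftrightarrow> 0 < t \<and> t < 1 \<and> 1 - t\<^sup>2 < (t + kappa)\<^sup>2 * t\<^sup>2 \<and> t * (t + kappa) \<le> 1"

text \<open>The balance at a branching vertex with one leaf and two infinite decaying paths,
  denominators cleared; the right-hand side vanishes at \<open>sqrt_gamma_inf\<close>.\<close>

lemma limit_defect: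
  fixes kappa t :: real
  assumes "kappa \<ge> 0" "0 < t"
  shows "(t + 1 / t - (kappa + leaf kappa t + 2 * t)) * (t * (t * (t + kappa) + 1)) = 1 - t\<^sup>2 - (t + kappa)\<^sup>2 * t\<^sup>2"
proof -
  define r x where "r = leaf kappa t" and "x = t * (t + kappa)"
  have "x \<ge> 0" using assms by (simp add: x_def)
  then have rx: "r * (x + 1) = t" by (simp add: r_def leaf_def x_def)
  have tt: "1 / t * t = 1" using assms by simp
  have "(t + 1 / t - (kappa + r + 2 * t)) * (t * (x + 1))
      = (1 / t * t) * (x + 1) - (t * t) * (x + 1) - (kappa * t) * (x + 1) - t * (r * (x + 1))"
    by (simp only: algebra_simps)
  also have "\<dots> = 1 - t\<^sup>2 - (t + kappa)\<^sup>2 * t\<^sup>2"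
    unfolding rx tt by (simp add: x_def algebra_simps power2_eq_square)
  finally show ?thesis unfolding r_def x_def .
qed

text \<open>The first claim is surplus at a vertex with a leaf and two decaying paths. In the last
  one, 1/(z - r) is the value on the inner vertex of a pendant path of two vertices attached to a
  vertex of value 1; the claim is surplus at a vertex with two such paths and one infinite
  path.\<close>

lemma above_limitD:
  assumes "kappa \<ge> 0" and t: "above_limit kappa t"
  defines "z \<equiv> t + 1 / t" and "r \<equiv> leaf kappa t"
  shows "z < kappa + r + 2 * t" "t \<le> 2 * r" "z - r > 0" "1 / t - kappa < 2 / (z - r)"
proof -
  define x where "x = t * (t + kappa)"
  define T where "T = t\<^sup>2"
  have t: "0 < t" "t < 1" "1 - T < x\<^sup>2" "x \<le> 1"
    using t by (auto simp: above_limit_def x_def T_def power_mult_distrib mult.commute)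
  have x: "T \<le> x" "0 < x" using t(1) assms(1)
    by (auto simp: x_def T_def power2_eq_square distrib_left intro!: add_pos_nonneg)
  have T: "0 < T" "t * t = T" using t by (auto simp: T_def power2_eq_square)
  have r: "r = t / (x + 1)" by (simp add: r_def leaf_def x_def)
  have k: "kappa * t = x - T" by (simp add: x_def T_def power2_eq_square algebra_simps)
  have rx: "r * (x + 1) = t" using x unfolding r by simp
  have tt: "1 / t * t = 1" using t(1) by simp
  have "(z - (kappa + r + 2 * t)) * (t * (x + 1)) = 1 - T - x\<^sup>2"
    using limit_defect[OF assms(1) t(1)]
    by (simp add: z_def r_def x_def T_def power_mult_distrib mult.commute[of "t\<^sup>2"])
  then have "(z - (kappa + r + 2 * t)) * (t * (x + 1)) < 0" using t(3) by simp
  moreover have "t * (x + 1) > 0" using t x by simp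
  ultimately show "z < kappa + r + 2 * t" using t(1) x(2) by (simp only: mult_less_0_iff) linarith
  show "t \<le> 2 * r" using t x unfolding r by (simp add: field_simps)
  have "r \<le> t" using leaf[OF assms(1) t(1)] by (simp add: r_def)
  moreover have "1 / t > 0" using t by simp
  ultimately show zr: "z - r > 0" unfolding z_def by linarith
  have e: "(z - r) * (t * (x + 1)) = 1 + x + x * T"
  proof -
    have "(z - r) * (t * (x + 1)) = (1 / t * t) * (x + 1) + (t * t) * (x + 1) - t * (r * (x + 1))"
      unfolding z_def by (simp only: algebra_simps)
    also have "\<dots> = 1 + x + x * T" unfolding rx tt T(2) by (simp add: algebra_simps)
    finally show ?thesis .
  qed
  \<comment> \<open>The last claim, cleared of denominators, asks that this difference be negative.
    Its first part is negative by the third condition of \<open>above_limit\<close>; the second is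
    nonpositive because T \<le> x, that is, kappa \<ge> 0.\<close>
  have "(1 + T - x) * (1 + x + x * T) - 2 * T * (x + 1) = (1 - T - x\<^sup>2) + x * T * (T - x)"
    by (simp add: algebra_simps power2_eq_square)
  moreover have "x * T * (T - x) \<le> 0" using x T by (simp add: mult_nonneg_nonpos)
  ultimately have "(1 + T - x) * (1 + x + x * T) < 2 * T * (x + 1)" using t(3) by linarith
  moreover have "1 + T - x = (1 / t - kappa) * t" using t(1) k by (simp add: algebra_simps)
  ultimately have "(1 / t - kappa) * t * ((z - r) * (t * (x + 1))) < 2 * T * (x + 1)" unfolding e by simp
  then have "((1 / t - kappa) * (z - r)) * (T * (x + 1)) < 2 * (T * (x + 1))"
    unfolding T(2)[symmetric] by (simp add: mult_ac)
  moreover have "T * (x + 1) > 0" using T x by simp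
  ultimately have "(1 / t - kappa) * (z - r) < 2" by (meson mult_less_cancel_right_pos)
  then show "1 / t - kappa < 2 / (z - r)" using zr by (simp add: pos_less_divide_eq)
qed

text \<open>Conditions at a centre of value 1 from which one path runs until it is cut off after M
  steps, with s its first value. Besides that path the centre carries, in turn: three leaves; two
  pendant paths of two vertices; a leaf and a path decaying like powers of t.\<close>

definition long_arm :: "real \<Rightarrow> real \<Rightarrow> nat \<Rightarrow> bool" where
  "long_arm kappa t M \<longleftrightarrow> 1 \<le> M \<and>
    (let z = t + 1 / t; r = leaf kappa t; s = trunc t M 1 in
      z \<le> 2 * kappa + 3 * r + s \<and> z - kappa \<le> 2 / (z - r) + s \<and> z - kappa - r \<le> t + s)"

text \<open>All three conditions are strict when s is replaced by its limit t, by
  \<open>above_limitD\<close>.\<close>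

lemma exists_long_arm:
  assumes "kappa \<ge> 0" and t: "above_limit kappa t"
  shows "\<exists>M0. \<forall>M\<ge>M0. long_arm kappa t M"
proof -
  let ?z = "t + 1 / t" and ?r = "leaf kappa t"
  have t01: "0 < t" "t < 1" using t by (auto simp: above_limit_def)
  note i = above_limitD[OF assms]
  have "?z - 2 * kappa - 3 * ?r < t" "?z - kappa - 2 / (?z - ?r) < t" "?z - kappa - ?r - t < t"
    using i assms(1) by linarith+
  then obtain A B C where
    A: "\<forall>M\<ge>A. ?z - 2 * kappa - 3 * ?r \<le> trunc t M 1" and
    B: "\<forall>M\<ge>B. ?z - kappa - 2 / (?z - ?r) \<le> trunc t M 1" and
    C: "\<forall>M\<ge>C. ?z - kappa - ?r - t \<le> trunc t M 1"
    using eventually_trunc[OF t01] by meson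
  show ?thesis
  proof (intro exI[of _ "max (max A B) (max C 1)"] allI impI)
    fix M assume M: "max (max A B) (max C 1) \<le> M"
    have "?z - 2 * kappa - 3 * ?r \<le> trunc t M 1" "?z - kappa - 2 / (?z - ?r) \<le> trunc t M 1"
      "?z - kappa - ?r - t \<le> trunc t M 1" using A B C M by auto
    then show "long_arm kappa t M" unfolding long_arm_def Let_def using M by auto
  qed
qed

section \<open>Caterpillars\<close>

definition is_path :: "nat pair_pre_digraph \<Rightarrow> (nat \<Rightarrow> nat) \<Rightarrow> nat \<Rightarrow> bool" where
  "is_path G p K \<longleftrightarrow> inj_on p {..K} \<and> p 0 \<in> pverts G \<and> (\<forall>k<K. p (Suc k) \<in> nbrs G (p k))"

text \<open>The leaves \<open>D k\<close> hang at the \<open>k\<close>-th vertex of the path \<open>p 0, \<dots>, p K\<close> with \<open>K\<close> edges.\<close>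

definition pendants :: "nat pair_pre_digraph \<Rightarrow> (nat \<Rightarrow> nat) \<Rightarrow> nat \<Rightarrow> (nat \<Rightarrow> nat set) \<Rightarrow> bool" where
  "pendants G p K D \<longleftrightarrow> (\<forall>k\<le>K. D k \<subseteq> nbrs G (p k) \<and> D k \<inter> p ` {..K} = {})
     \<and> (\<forall>j\<le>K. \<forall>k\<le>K. j \<noteq> k \<longrightarrow> D j \<inter> D k = {}) \<and> D 0 = {} \<and> D K = {}"

locale alpha_param =
  fixes \<alpha> kappa :: real
  assumes \<alpha>: "0 \<le> \<alpha>" "\<alpha> < 1" and kappa: "kappa = \<alpha> / (1 - \<alpha>)"
begin

lemma kappa_nonneg: "kappa \<ge> 0" using \<alpha> kappa by simp

end

locale alpha_graph = alpha_param \<alpha> kappa for G :: "nat pair_pre_digraph" and \<alpha> kappa +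
  assumes G: "simple_graph G"
begin

lemma sym: "v \<in> nbrs G w \<Longrightarrow> w \<in> nbrs G v"
  using simple_graphD(6)[OF G] by blast

text \<open>In this form the level reads 2*kappa + z, and at a vertex of degree 2 the terms with
  kappa cancel: along a path only the recurrence with coefficient z remains.\<close>

lemma act_real:
  fixes f :: "nat \<Rightarrow> real"
  shows "act \<alpha> G f v = (1 - \<alpha>) * (kappa * card (nbrs G v) * f v + (\<Sum>w\<in>nbrs G v. f w))"
proof -
  have "\<alpha> = (1 - \<alpha>) * kappa" using \<alpha> kappa by simp
  then have "\<alpha> * card (nbrs G v) * f v = (1 - \<alpha>) * (kappa * card (nbrs G v) * f v)"
    by (metis mult.assoc)
  then show ?thesis by (simp add: act_def distrib_left)
qed

text \<open>Further neighbours only increase the right-hand side, and where \<open>f\<close>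
  vanishes the inequality is automatic. A subsolution found on any subgraph, induced or not,
  therefore bounds the spectral radius of the whole graph.\<close>

lemma rho_ge_local:
  fixes f :: "nat \<Rightarrow> real" and z :: real
  assumes f: "\<And>v. f v \<ge> 0" "\<exists>v\<in>pverts G. f v > 0"
      "\<And>v. v \<in> pverts G \<Longrightarrow> f v > 0 \<Longrightarrow>
        \<exists>S\<subseteq>nbrs G v. (2 * kappa + z) * f v \<le> kappa * card S * f v + (\<Sum>w\<in>S. f w)"
  shows "(1 - \<alpha>) * (2 * kappa + z) \<le> rho \<alpha> G"
proof (rule rho_ge[OF G \<alpha> _ f(2)])
  fix v assume v: "v \<in> pverts G"
  have fin: "finite (nbrs G v)" by (rule simple_graphD(3)[OF G])
  have "(2 * kappa + z) * f v \<le> kappa * card (nbrs G v) * f v + (\<Sum>w\<in>nbrs G v. f w)"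
  proof (cases "f v > 0")
    case True
    then obtain S where S: "S \<subseteq> nbrs G v" "(2 * kappa + z) * f v \<le> kappa * card S * f v + (\<Sum>w\<in>S. f w)"
      using f(3)[OF v] by auto
    have "kappa * card S * f v \<le> kappa * card (nbrs G v) * f v"
      using card_mono[OF fin S(1)] kappa_nonneg f(1) by (intro mult_right_mono mult_left_mono) auto
    moreover have "(\<Sum>w\<in>S. f w) \<le> (\<Sum>w\<in>nbrs G v. f w)"
      using fin S(1) f(1) by (intro sum_mono2) auto
    ultimately show ?thesis using S(2) by linarith
  next
    case False
    then have "f v = 0" using f(1)[of v] by simp
    then show ?thesis using f(1) by (simp add: sum_nonneg)
  qed
  then show "(1 - \<alpha>) * (2 * kappa + z) * f v \<le> act \<alpha> G f v"
    unfolding act_real using \<alpha> by (simp only: mult.assoc) (intro mult_left_mono, auto)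
qed (use f in auto)

text \<open>Dually, a supersolution may be checked against too many neighbours, so that structural
  upper bounds on neighbourhoods are enough.\<close>

lemma rho_le_local:
  fixes g :: "nat \<Rightarrow> real" and z :: real
  assumes g: "\<And>v. v \<in> pverts G \<Longrightarrow> g v > 0"
      "\<And>v. v \<in> pverts G \<Longrightarrow>
        \<exists>S. finite S \<and> nbrs G v \<subseteq> S \<and> S \<subseteq> pverts G \<and> kappa * card S * g v + (\<Sum>w\<in>S. g w) \<le> (2 * kappa + z) * g v"
  shows "rho \<alpha> G \<le> (1 - \<alpha>) * (2 * kappa + z)"
proof (rule rho_le[OF G \<alpha> g(1)])
  fix v assume v: "v \<in> pverts G"
  obtain S where S: "finite S" "nbrs G v \<subseteq> S" "S \<subseteq> pverts G"
    "kappa * card S * g v + (\<Sum>w\<in>S. g w) \<le> (2 * kappa + z) * g v" using g(2)[OF v] by auto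
  have "kappa * card (nbrs G v) * g v \<le> kappa * card S * g v"
    using card_mono[OF S(1,2)] kappa_nonneg g(1)[OF v] by (intro mult_right_mono mult_left_mono) auto
  moreover have "(\<Sum>w\<in>nbrs G v. g w) \<le> (\<Sum>w\<in>S. g w)"
    using S g(1) by (intro sum_mono2) (auto intro: less_imp_le)
  ultimately have "kappa * card (nbrs G v) * g v + (\<Sum>w\<in>nbrs G v. g w) \<le> (2 * kappa + z) * g v"
    using S(4) by linarith
  then show "act \<alpha> G g v \<le> (1 - \<alpha>) * (2 * kappa + z) * g v"
    unfolding act_real using \<alpha> by (simp only: mult.assoc) (intro mult_left_mono, auto)
qed

lemma is_path_verts:
  assumes "is_path G p K" "k \<le> K"
  shows "p k \<in> pverts G"
proof (cases k)
  case (Suc j)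
  then have "p (Suc j) \<in> nbrs G (p j)" using assms by (auto simp: is_path_def)
  then show ?thesis using simple_graphD(4)[OF G] Suc by blast
qed (use assms in \<open>auto simp: is_path_def\<close>)

lemma caterpillar_function:
  fixes h :: "nat \<Rightarrow> real"
  assumes p: "is_path G p K" and D: "pendants G p K D"
  obtains f where "\<And>k. k \<le> K \<Longrightarrow> f (p k) = h k" "\<And>k w. k \<le> K \<Longrightarrow> w \<in> D k \<Longrightarrow> f w = r * h k"
    "\<And>v. v \<notin> p ` {..K} \<Longrightarrow> (\<And>k. k \<le> K \<Longrightarrow> v \<notin> D k) \<Longrightarrow> f v = 0"
proof
  let ?f = "\<lambda>v. if v \<in> p ` {..K} then h (inv_into {..K} p v)
    else if \<exists>k\<le>K. v \<in> D k then r * h (SOME k. k \<le> K \<and> v \<in> D k) else 0"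
  show "?f (p k) = h k" if "k \<le> K" for k
    using p that by (simp add: is_path_def)
  show "?f w = r * h k" if k: "k \<le> K" "w \<in> D k" for k w
  proof -
    have "w \<notin> p ` {..K}" using D k unfolding pendants_def by blast
    moreover have "(SOME k. k \<le> K \<and> w \<in> D k) = k"
    proof (rule some_equality)
      fix j assume "j \<le> K \<and> w \<in> D j"
      then show "j = k" using D k unfolding pendants_def by blast
    qed (use k in simp)
    ultimately show ?thesis using k by auto
  qed
  show "?f v = 0" if "v \<notin> p ` {..K}" "\<And>k. k \<le> K \<Longrightarrow> v \<notin> D k" for v
    using that by auto
qed

lemma caterpillar_star:
  fixes f h :: "nat \<Rightarrow> real"
  assumes p: "is_path G p K" and D: "pendants G p K D" and k: "0 < k" "k < K"
    and f: "\<And>k. k \<le> K \<Longrightarrow> f (p k) = h k" "\<And>k w. k \<le> K \<Longrightarrow> w \<in> D k \<Longrightarrow> f w = r * h k"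
  defines "S \<equiv> D k \<union> {p (k - 1), p (k + 1)}"
  shows "S \<subseteq> nbrs G (p k)" "card S = card (D k) + 2" "sum f S = card (D k) * (r * h k) + h (k - 1) + h (k + 1)"
proof -
  have "p k \<in> nbrs G (p (k - 1))" using p k unfolding is_path_def by (cases k) auto
  then have n1: "p (k - 1) \<in> nbrs G (p k)" using simple_graphD(6)[OF G] by blast
  have n2: "p (k + 1) \<in> nbrs G (p k)" using p k unfolding is_path_def by auto
  show "S \<subseteq> nbrs G (p k)" using n1 n2 D k unfolding S_def pendants_def by auto
  have ne: "p (k - 1) \<noteq> p (k + 1)"
  proof
    assume "p (k - 1) = p (k + 1)"
    then have "k - 1 = k + 1" using p k unfolding is_path_def by (auto dest!: inj_onD)
    then show False using k by simp
  qed
  have fin: "finite (D k)" using D k finite_subset[OF _ simple_graphD(3)[OF G]]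
    unfolding pendants_def by (meson less_imp_le)
  have "D k \<inter> p ` {..K} = {}" using D k unfolding pendants_def by auto
  moreover have "p (k - 1) \<in> p ` {..K}" "p (k + 1) \<in> p ` {..K}" using k by auto
  ultimately have dj: "D k \<inter> {p (k - 1), p (k + 1)} = {}" by blast
  show "card S = card (D k) + 2" unfolding S_def using fin dj ne by (simp add: card_Un_disjoint)
  have "sum f (D k) = card (D k) * (r * h k)" using f(2)[of k] k by simp
  then show "sum f S = card (D k) * (r * h k) + h (k - 1) + h (k + 1)"
    unfolding S_def using fin dj ne k by (simp add: sum.union_disjoint f(1))
qed

text \<open>
  A pendant leaf carries \<open>1/(kappa + z)\<close> times the value of its neighbour, which solves the equation
  at the leaf exactly; there it only lowers the coefficient \<open>z\<close> of the path by \<open>kappa + 1/(kappa + z)\<close>.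
\<close>

lemma caterpillar_ge:
  fixes h :: "nat \<Rightarrow> real" and z :: real
  assumes p: "is_path G p K" and D: "pendants G p K D" and K: "0 < K"
    and z: "kappa + z > 0" and h: "\<And>k. k \<le> K \<Longrightarrow> h k \<ge> 0" "\<exists>k\<le>K. h k > 0"
    and h0: "(kappa + z) * h 0 \<le> h 1" and hK: "(kappa + z) * h K \<le> h (K - 1)"
    and hk: "\<And>k. 0 < k \<Longrightarrow> k < K \<Longrightarrow>
      (z - card (D k) * (kappa + 1 / (kappa + z))) * h k \<le> h (k - 1) + h (k + 1)"
  shows "(1 - \<alpha>) * (2 * kappa + z) \<le> rho \<alpha> G"
proof -
  define r where "r = 1 / (kappa + z)"
  have r: "r > 0" "r * (kappa + z) = 1" using z by (auto simp: r_def)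
  obtain f where f: "\<And>k. k \<le> K \<Longrightarrow> f (p k) = h k" "\<And>k w. k \<le> K \<Longrightarrow> w \<in> D k \<Longrightarrow> f w = r * h k"
    "\<And>v. v \<notin> p ` {..K} \<Longrightarrow> (\<And>k. k \<le> K \<Longrightarrow> v \<notin> D k) \<Longrightarrow> f v = 0"
    using caterpillar_function[OF p D, of h r] by blast
  have nn: "f v \<ge> 0" for v
  proof (cases "v \<in> p ` {..K}")
    case True then show ?thesis using f(1) h(1) by auto
  next
    case False
    show ?thesis
    proof (cases "\<exists>k\<le>K. v \<in> D k")
      case True then show ?thesis using f(2) h(1) r(1) by auto
    qed (use False f(3) in auto)
  qed
  show ?thesis
  proof (rule rho_ge_local[OF nn])
    show "\<exists>v\<in>pverts G. f v > 0" using h(2) f(1) is_path_verts[OF p] by (metis (no_types))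
    fix v assume v: "v \<in> pverts G" "f v > 0"
    then consider (path) k where "k \<le> K" "v = p k" | (pend) k where "k \<le> K" "v \<in> D k"
      using f(3)[of v] by fastforce
    then show "\<exists>S\<subseteq>nbrs G v. (2 * kappa + z) * f v \<le> kappa * card S * f v + (\<Sum>w\<in>S. f w)"
    proof cases
      case path
      consider "k = 0" | "k = K" | "0 < k" "k < K" using path by linarith
      then show ?thesis
      proof cases
        case 1
        then show ?thesis using p K path f(1)[of 0] f(1)[of 1] h0
          by (intro exI[of _ "{p 1}"]) (auto simp: is_path_def algebra_simps)
      next
        case 2
        have "p K \<in> nbrs G (p (K - 1))" using p K unfolding is_path_def by (cases K) auto
        then have "p (K - 1) \<in> nbrs G (p K)" using simple_graphD(6)[OF G] by blast
        then show ?thesis using 2 path f(1)[of K] f(1)[of "K - 1"] hK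
          by (intro exI[of _ "{p (K - 1)}"]) (auto simp: algebra_simps)
      next
        case 3
        note S = caterpillar_star[where f = f and h = h and r = r, OF p D 3 f(1,2)]
        have "(2 * kappa + z) * f v \<le> kappa * real (card (D k) + 2) * f v + (real (card (D k)) * (r * h k) + h (k - 1) + h (k + 1))"
          using hk[OF 3] path f(1)[of k] by (simp add: r_def[symmetric] algebra_simps)
        then show ?thesis using S path(2) by (metis (no_types, lifting))
      qed
    next
      case pend
      have nb: "{p k} \<subseteq> nbrs G v" using D pend simple_graphD(6)[OF G, of v "p k"]
        unfolding pendants_def by auto
      have "(2 * kappa + z) * f v = kappa * f v + (r * (kappa + z)) * h k" using f(2)[OF pend] by (simp add: algebra_simps)
      then have "(2 * kappa + z) * f v \<le> kappa * card {p k} * f v + sum f {p k}" using r(2) f(1)[OF pend(1)] by simp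
      then show ?thesis using nb by blast
    qed
  qed
qed

text \<open>The leaves carry the same values as in \<open>caterpillar_ge\<close>, but a
  supersolution must account for every edge; hence the hypotheses that \<open>G\<close> contains
  nothing beyond the caterpillar.\<close>

lemma caterpillar_le:
  fixes h :: "nat \<Rightarrow> real" and z :: real
  assumes p: "is_path G p K" and D: "pendants G p K D" and K: "0 < K"
    and V: "pverts G \<subseteq> p ` {..K} \<union> (\<Union>k\<le>K. D k)"
    and N0: "nbrs G (p 0) \<subseteq> {p 1}" and NK: "nbrs G (p K) \<subseteq> {p (K - 1)}"
    and Nk: "\<And>k. 0 < k \<Longrightarrow> k < K \<Longrightarrow> nbrs G (p k) \<subseteq> D k \<union> {p (k - 1), p (k + 1)}"
    and ND: "\<And>k w. k \<le> K \<Longrightarrow> w \<in> D k \<Longrightarrow> nbrs G w \<subseteq> {p k}"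
    and z: "kappa + z > 0" and h: "\<And>k. k \<le> K \<Longrightarrow> h k > 0"
    and h0: "h 1 \<le> (kappa + z) * h 0" and hK: "h (K - 1) \<le> (kappa + z) * h K"
    and hk: "\<And>k. 0 < k \<Longrightarrow> k < K \<Longrightarrow>
      h (k - 1) + h (k + 1) \<le> (z - card (D k) * (kappa + 1 / (kappa + z))) * h k"
  shows "rho \<alpha> G \<le> (1 - \<alpha>) * (2 * kappa + z)"
proof -
  define r where "r = 1 / (kappa + z)"
  have r: "r > 0" "r * (kappa + z) = 1" using z by (auto simp: r_def)
  obtain f where f: "\<And>k. k \<le> K \<Longrightarrow> f (p k) = h k" "\<And>k w. k \<le> K \<Longrightarrow> w \<in> D k \<Longrightarrow> f w = r * h k"
    "\<And>v. v \<notin> p ` {..K} \<Longrightarrow> (\<And>k. k \<le> K \<Longrightarrow> v \<notin> D k) \<Longrightarrow> f v = 0"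
    using caterpillar_function[OF p D, of h r] by blast
  have cases: "(\<exists>k\<le>K. v = p k) \<or> (\<exists>k\<le>K. v \<in> D k)" if "v \<in> pverts G" for v
    using V that by auto
  have pv: "p k \<in> pverts G" if "k \<le> K" for k using is_path_verts[OF p that] .
  show ?thesis
  proof (rule rho_le_local)
    fix v assume v: "v \<in> pverts G"
    show "f v > 0" using cases[OF v] f h r(1) by auto
    consider (path) k where "k \<le> K" "v = p k" | (pend) k where "k \<le> K" "v \<in> D k"
      using cases[OF v] by blast
    then show "\<exists>S. finite S \<and> nbrs G v \<subseteq> S \<and> S \<subseteq> pverts G \<and> kappa * card S * f v + (\<Sum>w\<in>S. f w) \<le> (2 * kappa + z) * f v"
    proof cases
      case path
      consider "k = 0" | "k = K" | "0 < k" "k < K" using path by linarith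
      then show ?thesis
      proof cases
        case 1
        then show ?thesis using N0 K path f(1)[of 0] f(1)[of 1] h0 pv[of 1]
          by (intro exI[of _ "{p 1}"]) (auto simp: algebra_simps)
      next
        case 2
        then show ?thesis using NK path f(1)[of K] f(1)[of "K - 1"] hK pv[of "K - 1"]
          by (intro exI[of _ "{p (K - 1)}"]) (auto simp: algebra_simps)
      next
        case 3
        let ?S = "D k \<union> {p (k - 1), p (k + 1)}"
        note S = caterpillar_star[where f = f and h = h and r = r, OF p D 3 f(1,2)]
        have "kappa * real (card (D k) + 2) * f v + (real (card (D k)) * (r * h k) + h (k - 1) + h (k + 1)) \<le> (2 * kappa + z) * f v"
          using hk[OF 3] path f(1)[of k] by (simp add: r_def[symmetric] algebra_simps)
        then have "kappa * card ?S * f v + sum f ?S \<le> (2 * kappa + z) * f v" using S(2,3) by metis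
        moreover have "finite ?S" using S(1) simple_graphD(3)[OF G] finite_subset by blast
        moreover have "?S \<subseteq> pverts G" using S(1) simple_graphD(4)[OF G] by blast
        ultimately show ?thesis using Nk[OF 3] path(2) by blast
      qed
    next
      case pend
      have "(2 * kappa + z) * f v = kappa * f v + (r * (kappa + z)) * h k" using f(2)[OF pend] by (simp add: algebra_simps)
      then have "kappa * card {p k} * f v + sum f {p k} \<le> (2 * kappa + z) * f v" using r(2) f(1)[OF pend(1)] by simp
      then show ?thesis using ND[OF pend] pv[OF pend(1)] by (intro exI[of _ "{p k}"] conjI) auto
    qed
  qed
qed

section \<open>Subgraphs that force a large spectral radius\<close>

lemma is_path_shift:
  assumes p: "is_path G p K" and "a + L \<le> K"
  shows "is_path G (\<lambda>k. p (a + k)) L"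
proof -
  have "inj_on (\<lambda>k. p (a + k)) {..L}"
  proof (rule inj_onI)
    fix x y assume "x \<in> {..L}" "y \<in> {..L}" "p (a + x) = p (a + y)"
    then have "a + x = a + y" using p assms(2) unfolding is_path_def by (auto dest!: inj_onD)
    then show "x = y" by simp
  qed
  moreover have "p (a + 0) \<in> pverts G" using is_path_verts[OF p, of a] assms(2) by simp
  ultimately show ?thesis using p assms(2) unfolding is_path_def by auto
qed

lemma is_path_rev:
  assumes p: "is_path G p K"
  shows "is_path G (\<lambda>k. p (K - k)) K"
proof -
  have "inj_on (\<lambda>k. p (K - k)) {..K}"
  proof (rule inj_onI)
    fix x y assume xy: "x \<in> {..K}" "y \<in> {..K}" "p (K - x) = p (K - y)"
    then have "K - x = K - y" using p unfolding is_path_def by (auto dest!: inj_onD)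
    then show "x = y" using xy by auto
  qed
  moreover have "p (K - Suc k) \<in> nbrs G (p (K - k))" if "k < K" for k
  proof -
    have "p (Suc (K - Suc k)) \<in> nbrs G (p (K - Suc k))" using p that unfolding is_path_def by auto
    then show ?thesis using that simple_graphD(6)[OF G] by (simp add: Suc_diff_Suc)
  qed
  ultimately show ?thesis using is_path_verts[OF p, of K] unfolding is_path_def by auto
qed

lemma image_rev: "(\<lambda>k. p (K - k)) ` {..K::nat} = p ` {..K}"
proof (intro equalityI subsetI)
  fix x assume "x \<in> p ` {..K}"
  then obtain k where "k \<le> K" "x = p k" by auto
  then show "x \<in> (\<lambda>k. p (K - k)) ` {..K}" by (intro image_eqI[of _ _ "K - k"]) auto
qed auto

lemma level_kappa: "level \<alpha> t = (1 - \<alpha>) * (2 * kappa + (t + 1 / t))"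
  using level_conv[OF \<alpha>(2)] kappa by simp

lemma level_le_caterpillar:
  assumes t: "0 < t" and p: "is_path G p K" and D: "pendants G p K D" and K: "0 < K"
    and h: "\<And>k. k \<le> K \<Longrightarrow> h k \<ge> 0" "\<exists>k\<le>K. h k > 0"
    and h0: "(kappa + (t + 1 / t)) * h 0 \<le> h 1" and hK: "(kappa + (t + 1 / t)) * h K \<le> h (K - 1)"
    and hk: "\<And>k. 0 < k \<Longrightarrow> k < K \<Longrightarrow>
      (t + 1 / t - card (D k) * (kappa + leaf kappa t)) * h k \<le> h (k - 1) + h (k + 1)"
  shows "level \<alpha> t \<le> rho \<alpha> G"
  unfolding level_kappa
proof (rule caterpillar_ge[OF p D K _ h h0 hK])
  show "kappa + (t + 1 / t) > 0" using t kappa_nonneg by (intro add_nonneg_pos add_pos_pos) auto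
qed (use hk in \<open>simp_all add: leaf(4)[OF kappa_nonneg t]\<close>)

lemma leaf_end:
  assumes "0 < t"
  shows "(kappa + (t + 1 / t)) * (leaf kappa t * c) = c"
  using leaf(1)[OF kappa_nonneg assms] by (metis mult.commute mult.assoc mult_1)

text \<open>The function follows \<open>arm\<close> up to the branching vertex and
  \<open>trunc\<close> beyond it. Only the last m vertices before \<open>p i\<close> are used, so
  one condition at m serves all positions i \<ge> m; extra edges at the cut do no harm to a
  subsolution.\<close>

lemma spur_level_le:
  assumes t: "0 < t" "t < 1" and M: "1 \<le> M" and m: "1 \<le> m" "m \<le> i"
    and p: "is_path G p K" and iM: "i + M \<le> K"
    and w: "w \<in> nbrs G (p i)" "w \<notin> p ` {..K}"
    and c: "t + 1 / t - kappa - leaf kappa t \<le> arm_ratio kappa t m + trunc t M 1"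
  shows "level \<alpha> t \<le> rho \<alpha> G"
proof -
  define q where "q k = p (i - m + k)" for k
  define D where "D k = (if k = m then {w} else {})" for k
  define h where "h k = (if k \<le> m then arm kappa t k / arm kappa t m else trunc t M (k - m))" for k
  have q: "is_path G q (m + M)" unfolding q_def using is_path_shift[OF p, of "i - m" "m + M"] m iM by simp
  have "q ` {..m + M} \<subseteq> p ` {..K}" unfolding q_def using m iM by auto
  then have D: "pendants G q (m + M) D"
    unfolding pendants_def D_def using w m M by (auto simp: q_def)
  have a: "arm kappa t k > 0" for k by (rule arm_pos[OF kappa_nonneg t])
  show ?thesis
  proof (rule level_le_caterpillar[OF t(1) q D, of h])
    show "0 < m + M" using m by simp
    show "h k \<ge> 0" for k using a[of k] a[of m] trunc_nonneg[OF t] by (auto simp: h_def)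
    show "\<exists>k\<le>m + M. 0 < h k" using a[of m] by (intro exI[of _ m]) (simp add: h_def)
    show "(kappa + (t + 1 / t)) * h 0 \<le> h 1"
      using m arm_1[OF t(1), of kappa] by (simp add: h_def)
    show "(kappa + (t + 1 / t)) * h (m + M) \<le> h (m + M - 1)"
      using m M a[of m] a[of "m + M - 1"] trunc_nonneg[OF t] by (simp add: h_def trunc_end)
    fix k assume k: "0 < k" "k < m + M"
    consider "k < m" | "k = m" | "k > m" by linarith
    then show "(t + 1 / t - card (D k) * (kappa + leaf kappa t)) * h k \<le> h (k - 1) + h (k + 1)"
    proof cases
      case 1
      then have "k - Suc 0 \<le> m" by simp
      then show ?thesis using 1 arm_rec[OF t(1), of kappa "k - 1"] k
        by (simp add: h_def D_def add_divide_distrib[symmetric])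
    next
      case 2
      have "h (m - 1) = arm_ratio kappa t m" using m by (simp add: h_def arm_ratio_def)
      moreover have "h m = 1" "h (m + 1) = trunc t M 1" using a[of m] by (auto simp: h_def)
      ultimately show ?thesis using c 2 by (simp add: D_def)
    next
      case 3
      have "h (k - 1) = trunc t M (k - m - 1)"
      proof (cases "k - 1 = m")
        case True
        then have "k - m - 1 = 0" by simp
        then show ?thesis using True a[of m] trunc_0[OF t M] by (simp add: h_def)
      next
        case False
        then have "\<not> k - Suc 0 \<le> m" "k - Suc m = k - Suc 0 - m" using 3 by auto
        then show ?thesis by (simp add: h_def)
      qed
      moreover have "h (k + 1) = trunc t M (k - m + 1)" "h k = trunc t M (k - m)"
        using 3 by (auto simp: h_def Suc_diff_le)
      ultimately show ?thesis using trunc_sub[OF t, of "k - m" M] 3 by (simp add: D_def)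
    qed
  qed
qed

text \<open>The preceding path vertex is used as a third leaf, so that \<open>p i\<close> becomes
  the first of the three centres in \<open>long_arm\<close>.\<close>

lemma double_pendant_level_le:
  assumes t: "above_limit kappa t" and M: "long_arm kappa t M"
    and p: "is_path G p K" and i: "1 \<le> i" "i + M \<le> K"
    and w: "w \<in> nbrs G (p i)" "w' \<in> nbrs G (p i)" "w \<notin> p ` {..K}" "w' \<notin> p ` {..K}" "w \<noteq> w'"
  shows "level \<alpha> t \<le> rho \<alpha> G"
proof -
  let ?r = "leaf kappa t"
  have t01: "0 < t" "t < 1" using t by (auto simp: above_limit_def)
  have M1: "1 \<le> M" using M by (simp add: long_arm_def)
  define q where "q k = p (i - 1 + k)" for k
  define D where "D k = (if k = 1 then {w, w'} else {})" for k :: nat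
  define h where "h k = (if k = 0 then ?r else trunc t M (k - 1))" for k
  have q: "is_path G q (1 + M)" unfolding q_def using is_path_shift[OF p, of "i - 1" "1 + M"] i by simp
  have "q ` {..1 + M} \<subseteq> p ` {..K}" unfolding q_def using i by auto
  then have D: "pendants G q (1 + M) D"
    unfolding pendants_def D_def using w i M1 by (auto simp: q_def)
  have r: "0 < ?r" by (rule leaf(2)[OF kappa_nonneg t01(1)])
  show ?thesis
  proof (rule level_le_caterpillar[OF t01(1) q D, of h])
    show "h k \<ge> 0" for k using r trunc_nonneg[OF t01] by (auto simp: h_def)
    show "\<exists>k\<le>1 + M. 0 < h k" using r by (intro exI[of _ 0]) (simp add: h_def)
    show "(kappa + (t + 1 / t)) * h 0 \<le> h 1"
      using leaf_end[OF t01(1), of 1] trunc_0[OF t01 M1] by (simp add: h_def)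
    show "(kappa + (t + 1 / t)) * h (1 + M) \<le> h (1 + M - 1)"
      using M1 trunc_nonneg[OF t01] by (simp add: h_def trunc_end)
    fix k :: nat assume k: "0 < k" "k < 1 + M"
    show "(t + 1 / t - card (D k) * (kappa + ?r)) * h k \<le> h (k - 1) + h (k + 1)"
    proof (cases "k = 1")
      case True
      then show ?thesis using M w(5) trunc_0[OF t01 M1]
        by (simp add: h_def D_def long_arm_def Let_def)
    next
      case False
      then show ?thesis using trunc_sub[OF t01, of "k - 1" M] k
        by (simp add: h_def D_def)
    qed
  qed simp
qed

text \<open>At \<open>p i\<close> the preceding path vertex and \<open>w\<close> act as two leaves.
  Since t \<le> 2 * leaf, they replace an infinite continuation of the decaying solution, so from
  \<open>p j\<close> the part towards \<open>p i\<close> looks like an infinite path;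
  \<open>p j\<close> is then the third centre in \<open>long_arm\<close>.\<close>

lemma fork_level_le:
  assumes t: "above_limit kappa t" and M: "long_arm kappa t M"
    and p: "is_path G p K" and i: "1 \<le> i" "i < j" "j + M \<le> K"
    and w: "w \<in> nbrs G (p i)" "w' \<in> nbrs G (p j)" "w \<notin> p ` {..K}" "w' \<notin> p ` {..K}" "w \<noteq> w'"
  shows "level \<alpha> t \<le> rho \<alpha> G"
proof -
  let ?r = "leaf kappa t"
  have t01: "0 < t" "t < 1" using t by (auto simp: above_limit_def)
  have M1: "1 \<le> M" using M by (simp add: long_arm_def)
  define d where "d = j - i"
  have d: "d > 0" "j = i + d" using i by (auto simp: d_def)
  define q where "q k = p (i - 1 + k)" for k
  define D where "D k = (if k = 1 then {w} else if k = 1 + d then {w'} else {})" for k :: nat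
  define h where "h k = (if k = 0 then ?r * t ^ d else if k \<le> 1 + d then t ^ (1 + d - k) else trunc t M (k - 1 - d))" for k
  have q: "is_path G q (1 + d + M)" unfolding q_def using is_path_shift[OF p, of "i - 1" "1 + d + M"] i d by simp
  have "q ` {..1 + d + M} \<subseteq> p ` {..K}" unfolding q_def using i d by auto
  then have D: "pendants G q (1 + d + M) D"
    unfolding pendants_def D_def using w i d M1 by (auto simp: q_def)
  have r: "0 < ?r" by (rule leaf(2)[OF kappa_nonneg t01(1)])
  show ?thesis
  proof (rule level_le_caterpillar[OF t01(1) q D, of h])
    show "h k \<ge> 0" for k using r t01 trunc_nonneg[OF t01] by (auto simp: h_def)
    show "\<exists>k\<le>1 + d + M. 0 < h k" using r t01 by (intro exI[of _ 0]) (simp add: h_def)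
    have "h 0 = ?r * t ^ d" "h 1 = t ^ d" by (simp_all add: h_def)
    then show "(kappa + (t + 1 / t)) * h 0 \<le> h 1" by (simp only: leaf_end[OF t01(1)] order_refl)
    show "(kappa + (t + 1 / t)) * h (1 + d + M) \<le> h (1 + d + M - 1)"
      using M1 trunc_nonneg[OF t01] t01 by (simp add: h_def trunc_end)
    fix k :: nat assume k: "0 < k" "k < 1 + d + M"
    consider "k = 1" | "1 < k" "k < 1 + d" | "k = 1 + d" | "1 + d < k" using k by linarith
    then show "(t + 1 / t - card (D k) * (kappa + ?r)) * h k \<le> h (k - 1) + h (k + 1)"
    proof cases
      case 1
      obtain e where e: "d = Suc e" using d by (cases d) auto
      have "t \<le> kappa + 2 * ?r" using above_limitD(2)[OF kappa_nonneg t] kappa_nonneg by linarith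
      then have "t * t ^ d \<le> (kappa + 2 * ?r) * t ^ d" using t01 by (intro mult_right_mono) auto
      moreover have "1 / t * t ^ d = t ^ e" using t01 by (simp add: e)
      ultimately have "(t + 1 / t - (kappa + ?r)) * t ^ d \<le> ?r * t ^ d + t ^ e"
        by (simp only: distrib_right left_diff_distrib)
      then show ?thesis using 1 d by (simp add: h_def D_def e)
    next
      case 2
      obtain e where e: "1 + d - k = Suc e" using 2 by (metis Suc_diff_Suc)
      then have e': "1 + d - (k - 1) = Suc (Suc e)" "1 + d - (k + 1) = e" using 2 by auto
      have "(t + 1 / t) * t ^ Suc e = t ^ Suc (Suc e) + t ^ e" using t01 by (simp add: field_simps)
      moreover have "h k = t ^ Suc e" unfolding h_def e using 2 by simp
      moreover have "h (k - 1) = t ^ Suc (Suc e)" unfolding h_def e' using 2 by auto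
      moreover have "h (k + 1) = t ^ e" unfolding h_def e' using 2 by auto
      moreover have "D k = {}" using 2 by (simp add: D_def)
      ultimately show ?thesis by simp
    next
      case 3
      then show ?thesis using M d by (simp add: h_def D_def long_arm_def Let_def algebra_simps)
    next
      case 4
      have "h (k - 1) = trunc t M (k - 1 - d - 1)"
      proof (cases "k - 1 = 1 + d")
        case True
        then have "k - 1 - d - 1 = 0" by simp
        then show ?thesis using True trunc_0[OF t01 M1] by (simp add: h_def)
      next
        case False
        then have "\<not> k - Suc 0 \<le> Suc d" "k - 1 \<noteq> 0" "k - 1 - 1 - d = k - 1 - d - 1" using 4 by auto
        then show ?thesis by (simp add: h_def)
      qed
      moreover have "h (k + 1) = trunc t M (k - 1 - d + 1)" "h k = trunc t M (k - 1 - d)"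
        using 4 Suc_diff_Suc[of d k] by (auto simp: h_def)
      ultimately show ?thesis using trunc_sub[OF t01, of "k - 1 - d" M] 4 by (simp add: D_def)
    qed
  qed simp
qed

section \<open>Subsolutions on stars, cycles with a pendant edge, and longer branches\<close>

lemma level_le_local:
  fixes f :: "nat \<Rightarrow> real"
  assumes "\<And>v. f v \<ge> 0" "\<exists>v\<in>pverts G. f v > 0"
    "\<And>v. v \<in> pverts G \<Longrightarrow> f v > 0 \<Longrightarrow>
        \<exists>S\<subseteq>nbrs G v. (2 * kappa + (t + 1 / t)) * f v \<le> kappa * card S * f v + (\<Sum>w\<in>S. f w)"
  shows "level \<alpha> t \<le> rho \<alpha> G"
  unfolding level_kappa by (rule rho_ge_local[OF assms])

lemma leaf_local:
  assumes "0 < t"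
  shows "(2 * kappa + (t + 1 / t)) * (leaf kappa t * c) = kappa * (leaf kappa t * c) + c"
  using leaf_end[OF assms, of c] by (simp add: algebra_simps)

text \<open>A star with five leaves: z < kappa + r + 2t and t \<le> 2r give z < kappa + 5r, where r
  is the leaf value.\<close>

lemma degree_level_le:
  assumes t: "above_limit kappa t" and v: "card (nbrs G v) \<ge> 5"
  shows "level \<alpha> t \<le> rho \<alpha> G"
proof -
  let ?r = "leaf kappa t" and ?z = "t + 1 / t"
  have t01: "0 < t" "t < 1" using t by (auto simp: above_limit_def)
  have r: "0 < ?r" by (rule leaf(2)[OF kappa_nonneg t01(1)])
  define f where "f w = (if w = v then 1 else if w \<in> nbrs G v then ?r else 0)" for w
  have vV: "v \<in> pverts G"
    using v simple_graphD(7)[OF G, of _ v] by (metis card.empty equals0I not_numeral_le_zero)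
  have vn: "v \<notin> nbrs G v" by (rule simple_graphD(5)[OF G])
  show ?thesis
  proof (rule level_le_local[of f])
    show "f w \<ge> 0" for w using r by (simp add: f_def)
    show "\<exists>v\<in>pverts G. f v > 0" using vV by (intro bexI[of _ v]) (simp_all add: f_def)
    fix w assume w: "w \<in> pverts G" "f w > 0"
    show "\<exists>S\<subseteq>nbrs G w. (2 * kappa + ?z) * f w \<le> kappa * card S * f w + (\<Sum>w\<in>S. f w)"
    proof (cases "w = v")
      case True
      have "sum f (nbrs G v) = (\<Sum>w\<in>nbrs G v. ?r)"
        using vn by (intro sum.cong) (auto simp: f_def)
      then have s: "sum f (nbrs G v) = card (nbrs G v) * ?r" by simp
      have "5 * (kappa + ?r) \<le> card (nbrs G v) * (kappa + ?r)"
        using v r kappa_nonneg by (intro mult_right_mono) auto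
      moreover have "2 * kappa + ?z \<le> 5 * (kappa + ?r)"
        using above_limitD(1,2)[OF kappa_nonneg t] kappa_nonneg
        unfolding distrib_left by linarith
      ultimately have "(2 * kappa + ?z) * f v \<le> kappa * card (nbrs G v) * f v + sum f (nbrs G v)"
        unfolding s by (simp add: f_def algebra_simps)
      then show ?thesis using True by blast
    next
      case False
      then have wn: "w \<in> nbrs G v" using w by (auto simp: f_def split: if_splits)
      have "f w = ?r" "f v = 1" using False wn by (auto simp: f_def)
      then have "(2 * kappa + ?z) * f w \<le> kappa * card {v} * f w + sum f {v}"
        using leaf_local[OF t01(1), of 1] by simp
      then show ?thesis using sym[OF wn] by (intro exI[of _ "{v}"]) auto
    qed
  qed
qed

text \<open>On the cycle the subsolution is \<open>t\<close> to the power of the distance to \<open>p 0\<close>.\<close>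

lemma pan_level_le:
  assumes t: "above_limit kappa t" and p: "is_path G p K" and K: "2 \<le> K"
    and c: "p K \<in> nbrs G (p 0)" and x: "x \<in> nbrs G (p 0)" "x \<notin> p ` {..K}"
  shows "level \<alpha> t \<le> rho \<alpha> G"
proof -
  let ?r = "leaf kappa t" and ?z = "t + 1 / t"
  have t01: "0 < t" "t < 1" using t by (auto simp: above_limit_def)
  have r: "0 < ?r" by (rule leaf(2)[OF kappa_nonneg t01(1)])
  have inj: "inj_on p {..K}" using p by (simp add: is_path_def)
  define d where "d k = min k (K + 1 - k)" for k
  define f where "f v = (if v = x then ?r else if v \<in> p ` {..K} then t ^ d (inv_into {..K} p v) else 0)" for v
  have fp: "f (p k) = t ^ d k" if "k \<le> K" for k
    using inj x(2) that by (auto simp: f_def)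
  have fx: "f x = ?r" by (simp add: f_def)
  show ?thesis
  proof (rule level_le_local[of f])
    show "f w \<ge> 0" for w using r t01 by (simp add: f_def)
    show "\<exists>v\<in>pverts G. f v > 0" using is_path_verts[OF p, of 0] fp[of 0] t01 by (intro bexI[of _ "p 0"]) simp_all
    fix v assume v: "v \<in> pverts G" "f v > 0"
    show "\<exists>S\<subseteq>nbrs G v. (2 * kappa + ?z) * f v \<le> kappa * card S * f v + (\<Sum>w\<in>S. f w)"
    proof (cases "v = x")
      case True
      have "(2 * kappa + ?z) * f v \<le> kappa * card {p 0} * f v + sum f {p 0}"
        using leaf_local[OF t01(1), of 1] True fx fp[of 0] by (simp add: d_def)
      then show ?thesis using sym[OF x(1)] True by (intro exI[of _ "{p 0}"]) auto
    next
      case False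
      then obtain k where k: "k \<le> K" "v = p k" using v(2) by (auto simp: f_def split: if_splits)
      have nb: "p (Suc j) \<in> nbrs G (p j)" if "j < K" for j using p that by (auto simp: is_path_def)
      have ne: "p i \<noteq> p j" if "i \<le> K" "j \<le> K" "i \<noteq> j" for i j
        using inj that by (auto dest: inj_onD)
      show ?thesis
      proof (cases "k = 0")
        case True
        have "x \<noteq> p 1" "x \<noteq> p K" using x(2) K by auto
        moreover have "p 1 \<noteq> p K" using ne[of 1 K] K by simp
        ultimately have "card {x, p 1, p K} = 3" "sum f {x, p 1, p K} = ?r + t + t"
          using fx fp[of 1] fp[of K] K by (auto simp: d_def)
        then have "(2 * kappa + ?z) * f v \<le> kappa * card {x, p 1, p K} * f v + sum f {x, p 1, p K}"
          using k True fp[of 0] above_limitD(1)[OF kappa_nonneg t] by (simp add: d_def)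
        moreover have "{x, p 1, p K} \<subseteq> nbrs G v" using k True x(1) c nb[of 0] K by auto
        ultimately show ?thesis by blast
      next
        case k0: False
        define b where "b = (if k = K then p 0 else p (k + 1))"
        define e where "e = (if k = K then 0 else d (k + 1))"
        have fb: "f b = t ^ e" using fp[of 0] fp[of "k + 1"] k by (auto simp: b_def e_def d_def)
        have nb2: "{p (k - 1), b} \<subseteq> nbrs G v"
          using nb[of "k - 1"] nb[of k] k k0 sym[OF nb[of "k - 1"]] sym[OF c] by (auto simp: b_def)
        have ne2: "p (k - 1) \<noteq> b" using ne[of "k - 1" 0] ne[of "k - 1" "k + 1"] k k0 K by (auto simp: b_def)
        \<comment> \<open>Equality holds for m' = m + 2. Where the two sides of the cycle meet, the
          distance to \<open>p 0\<close> stops growing, and the larger power only helps.\<close>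
        have two: "?z * t ^ Suc m \<le> t ^ m + t ^ m'" if "m' \<le> m + 2" for m m'
        proof -
          have "t ^ (m + 2) \<le> t ^ m'" using that t01 by (intro power_decreasing) auto
          moreover have "?z * t ^ Suc m = t ^ m + t ^ (m + 2)" using t01 by (simp add: field_simps)
          ultimately show ?thesis by simp
        qed
        \<comment> \<open>On the first half the neighbour closer to \<open>p 0\<close> is
          \<open>p (k - 1)\<close>, on the second half it is \<open>b\<close>.\<close>
        have "?z * t ^ d k \<le> t ^ d (k - 1) + t ^ e"
        proof (cases "k \<le> K + 1 - k")
          case True
          then have "d k = Suc (d (k - 1))" "e \<le> d (k - 1) + 2" using k k0 by (auto simp: d_def e_def)
          then show ?thesis using two by simp
        next
          case False
          then have "d k = Suc e" "d (k - 1) \<le> e + 2" using k k0 by (auto simp: d_def e_def)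
          then show ?thesis using two[of "d (k - 1)" e] by simp
        qed
        moreover have "card {p (k - 1), b} = 2" "sum f {p (k - 1), b} = t ^ d (k - 1) + t ^ e"
          using ne2 fb fp[of "k - 1"] k by auto
        ultimately have "(2 * kappa + ?z) * f v \<le> kappa * card {p (k - 1), b} * f v + sum f {p (k - 1), b}"
          using k fp[of k] by (simp add: algebra_simps)
        then show ?thesis using nb2 by blast
      qed
    qed
  qed
qed

text \<open>\<open>w\<close>, \<open>w'\<close> on one side and the two preceding path vertices on
  the other form two pendant paths of two vertices at \<open>p i\<close>, the second centre in
  \<open>long_arm\<close>.\<close>

lemma double_spur_level_le:
  assumes t: "above_limit kappa t" and M: "long_arm kappa t M"
    and p: "is_path G p K" and i: "2 \<le> i" "i + M \<le> K"
    and w: "w \<in> nbrs G (p i)" "w' \<in> nbrs G w" "w \<notin> p ` {..K}" "w' \<notin> p ` {..K}"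
  shows "level \<alpha> t \<le> rho \<alpha> G"
proof -
  let ?r = "leaf kappa t" and ?z = "t + 1 / t"
  have t01: "0 < t" "t < 1" using t by (auto simp: above_limit_def)
  have M1: "1 \<le> M" using M by (simp add: long_arm_def)
  have r: "0 < ?r" by (rule leaf(2)[OF kappa_nonneg t01(1)])
  define a where "a = 1 / (?z - ?r)"
  have a: "a > 0" "?z * a = ?r * a + 1"
    using above_limitD(3)[OF kappa_nonneg t] by (auto simp: a_def field_simps)
  define q where "q k = p (i - 2 + k)" for k
  have q: "is_path G q (2 + M)" unfolding q_def using is_path_shift[OF p, of "i - 2" "2 + M"] i by simp
  then have inj: "inj_on q {..2 + M}" by (simp add: is_path_def)
  have qp: "q ` {..2 + M} \<subseteq> p ` {..K}" unfolding q_def using i by auto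
  have qin: "q k \<in> p ` {..K}" if "k \<le> 2 + M" for k using qp that by auto
  have q2: "q 2 = p i" using i by (simp only: q_def le_add_diff_inverse2)
  have ww: "w \<noteq> w'" using w(2) simple_graphD(5)[OF G] by auto
  define h where "h k = (if k = 0 then ?r * a else if k = 1 then a else trunc t M (k - 2))" for k
  define f where "f v = (if v = w then a else if v = w' then ?r * a
      else if v \<in> q ` {..2 + M} then h (inv_into {..2 + M} q v) else 0)" for v
  have fq: "f (q k) = h k" if "k \<le> 2 + M" for k
  proof -
    have "q k \<noteq> w" "q k \<noteq> w'" "q k \<in> q ` {..2 + M}" using w(3,4) qp that by auto
    then show ?thesis using inj that by (simp add: f_def)
  qed
  have fw: "f w = a" "f w' = ?r * a" using ww by (auto simp: f_def)
  have h0: "h 0 = ?r * a" "h 1 = a" "h 2 = 1" "h 3 = trunc t M 1"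
    using trunc_0[OF t01 M1] by (auto simp: h_def)
  have nb: "q (Suc j) \<in> nbrs G (q j)" if "j < 2 + M" for j using q that by (auto simp: is_path_def)
  have ne: "q i \<noteq> q j" if "i \<le> 2 + M" "j \<le> 2 + M" "i \<noteq> j" for i j
    using inj that by (auto dest: inj_onD)
  show ?thesis
  proof (rule level_le_local[of f])
    have "h k \<ge> 0" for k using r a trunc_nonneg[OF t01] by (simp add: h_def)
    then show "f v \<ge> 0" for v using r a by (simp add: f_def)
    show "\<exists>v\<in>pverts G. f v > 0"
      using is_path_verts[OF q, of 2] fq[of 2] h0 by (intro bexI[of _ "q 2"]) simp_all
    fix v assume v: "v \<in> pverts G" "f v > 0"
    have inner: "\<exists>S\<subseteq>nbrs G v. (2 * kappa + ?z) * f v \<le> kappa * card S * f v + (\<Sum>w\<in>S. f w)"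
      if "x \<in> nbrs G v" "y \<in> nbrs G v" "x \<noteq> y" "?z * f v \<le> f x + f y" for x y
    proof -
      have "(2 * kappa + ?z) * f v \<le> kappa * card {x, y} * f v + sum f {x, y}"
        using that by (simp add: algebra_simps)
      then show ?thesis using that by (intro exI[of _ "{x, y}"]) auto
    qed
    have outer: "\<exists>S\<subseteq>nbrs G v. (2 * kappa + ?z) * f v \<le> kappa * card S * f v + (\<Sum>w\<in>S. f w)"
      if "x \<in> nbrs G v" "f v = ?r * f x" for x
    proof -
      have "(2 * kappa + ?z) * f v \<le> kappa * card {x} * f v + sum f {x}"
        using that leaf_local[OF t01(1), of "f x"] by simp
      then show ?thesis using that by (intro exI[of _ "{x}"]) auto
    qed
    consider "v = w" | "v = w'" | k where "k \<le> 2 + M" "v = q k"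
      using v(2) by (auto simp: f_def split: if_splits)
    then show "\<exists>S\<subseteq>nbrs G v. (2 * kappa + ?z) * f v \<le> kappa * card S * f v + (\<Sum>w\<in>S. f w)"
    proof cases
      case 1
      have "w' \<noteq> q 2" using w(4) qin[of 2] by auto
      then show ?thesis using inner[of w' "q 2"] 1 sym[OF w(1)] w(2) q2 fw fq[of 2] h0 a by simp
    next
      case 2
      then show ?thesis using outer[of w] sym[OF w(2)] fw by simp
    next
      case 3
      consider "k = 0" | "k = 1" | "k = 2" | "2 < k" "k < 2 + M" | "k = 2 + M" using 3 by linarith
      then show ?thesis
      proof cases
        case 1
        then show ?thesis using outer[of "q 1"] nb[of 0] 3 fq[of 0] fq[of 1] h0 by simp
      next
        case k: 2
        then show ?thesis using inner[of "q 0" "q 2"] nb[of 1] sym[OF nb[of 0]] ne[of 0 2] 3 fq[of 0] fq[of 1] fq[of 2] h0 a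
          by (simp add: numeral_2_eq_2)
      next
        case k: 3
        have "w \<noteq> q 1" "w \<noteq> q 3" using w(3) qin[of 1] qin[of 3] M1 by auto
        moreover have "q 1 \<noteq> q 3" using ne[of 1 3] M1 by simp
        ultimately have s: "card {w, q 1, q 3} = 3" "sum f {w, q 1, q 3} = a + a + trunc t M 1"
          using fw fq[of 1] fq[of 3] M1 h0 by auto
        have "?z - kappa \<le> 2 * a + trunc t M 1" using M by (simp add: long_arm_def Let_def a_def)
        then have "(2 * kappa + ?z) * f v \<le> kappa * card {w, q 1, q 3} * f v + sum f {w, q 1, q 3}"
          unfolding s using 3 k fq[of 2] h0 by simp
        moreover have "{w, q 1, q 3} \<subseteq> nbrs G v"
          using 3 k w(1) q2 nb[of 2] sym[OF nb[of 1]] M1 by (simp add: numeral_2_eq_2 numeral_3_eq_3)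
        ultimately show ?thesis by blast
      next
        case k: 4
        have "k - 2 + 1 = k + 1 - 2" using k by simp
        then have e: "h (k - 1) = trunc t M (k - 2 - 1)" "h k = trunc t M (k - 2)" "h (k + 1) = trunc t M (k - 2 + 1)"
          using k by (auto simp: h_def numeral_2_eq_2)
        have "?z * f v \<le> f (q (k - 1)) + f (q (k + 1))"
          using trunc_sub[OF t01, of "k - 2" M] k 3 fq[of "k - 1"] fq[of k] fq[of "k + 1"] e by simp
        moreover have "q (k - 1) \<in> nbrs G v" "q (k + 1) \<in> nbrs G v"
          using 3 nb[of k] sym[OF nb[of "k - 1"]] k by auto
        moreover have "q (k - 1) \<noteq> q (k + 1)" using ne[of "k - 1" "k + 1"] k by auto
        ultimately show ?thesis using inner by blast
      next
        case k: 5
        then have "f v = 0" using 3 fq[of k] M1 by (simp add: h_def trunc_end)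
        then show ?thesis using v(2) by simp
      qed
    qed
  qed
qed

text \<open>The sine vanishes at both ends of the path, so nothing is required there, and the
  recurrence holds exactly with z = 2 cos(pi/K). Every graph containing a long path thus has
  spectral radius at least nearly 2.\<close>

lemma path_cos_le:
  assumes p: "is_path G p K" and K: "3 \<le> K"
  shows "(1 - \<alpha>) * (2 * kappa + 2 * cos (pi / K)) \<le> rho \<alpha> G"
proof (rule caterpillar_ge[OF p, of "\<lambda>_. {}" _ "\<lambda>k. sin (k * pi / K)"])
  show "pendants G p K (\<lambda>_. {})" by (simp add: pendants_def)
  show "0 < K" using K by simp
  have "pi / K \<le> pi / 3" using K by (intro divide_left_mono) auto
  then have "cos (pi / 3) \<le> cos (pi / K)" by (intro cos_monotone_0_pi_le) auto
  then show "kappa + 2 * cos (pi / K) > 0" using kappa_nonneg by (simp add: cos_60)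
  show nn: "0 \<le> sin (k * pi / K)" if "k \<le> K" for k :: nat
    using that K by (intro sin_ge_zero) (auto simp: field_simps)
  show "\<exists>k\<le>K. 0 < sin (k * pi / K)"
    using K by (intro exI[of _ 1]) (auto intro!: sin_gt_zero simp: field_simps)
  show "(kappa + 2 * cos (pi / K)) * sin (real 0 * pi / K) \<le> sin (real 1 * pi / K)"
    using nn[of 1] K by simp
  show "(kappa + 2 * cos (pi / K)) * sin (real K * pi / K) \<le> sin (real (K - 1) * pi / K)"
    using nn[of "K - 1"] K by simp
  fix k assume k: "0 < k" "k < K"
  have "real (k - 1) * pi / K = real k * pi / K - pi / K" "real (k + 1) * pi / K = real k * pi / K + pi / K"
    using k by (auto simp: of_nat_diff field_simps)
  then show "(2 * cos (pi / K) - real (card {}) * (kappa + 1 / (kappa + 2 * cos (pi / K)))) * sin (real k * pi / K)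
      \<le> sin (real (k - 1) * pi / K) + sin (real (k + 1) * pi / K)"
    by (simp add: sin_add sin_diff)
qed

text \<open>The row sums of the matrix are the degrees, so the constant function is a
  supersolution.\<close>

lemma rho_le_2:
  assumes "\<And>v. v \<in> pverts G \<Longrightarrow> card (nbrs G v) \<le> 2"
  shows "rho \<alpha> G \<le> 2"
proof (rule rho_le[OF G \<alpha>, of "\<lambda>_. 1"])
  fix v assume "v \<in> pverts G"
  then have "real (card (nbrs G v)) \<le> 2" using assms by force
  then show "act \<alpha> G (\<lambda>_. 1) v \<le> 2 * (1::real)"
    by (simp add: act_def algebra_simps)
qed auto

end

section \<open>Longest paths\<close>

text \<open>
  Left half of the supersolution on a path with a pendant at index \<open>j\<close> and one near the other end: the arm
  solution up to \<open>j\<close>, and beyond it the symmetric \<open>t^i + t^(L-i)\<close>, so that the two halves agree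
  on the stretch of length \<open>L\<close> between the two branching vertices.
\<close>

definition profile :: "real \<Rightarrow> real \<Rightarrow> nat \<Rightarrow> nat \<Rightarrow> nat \<Rightarrow> real" where
  "profile kappa t L j k = (if k \<le> j then (1 + t ^ L) * (arm kappa t k / arm kappa t j) else t ^ (k - j) + t ^ (L - (k - j)))"

lemma profile_pos:
  assumes "kappa \<ge> 0" "0 < t" "t < 1"
  shows "profile kappa t L j k > 0"
  using arm_pos[OF assms, of k] arm_pos[OF assms, of j] assms
  by (auto simp: profile_def intro!: mult_pos_pos add_pos_pos divide_pos_pos)

lemma profile_ge:
  assumes "kappa \<ge> 0" "0 < t" "t < 1" "j \<le> k"
  shows "profile kappa t L j k = t ^ (k - j) + t ^ (L - (k - j))"
  using arm_pos[OF assms(1-3), of j] assms(4) by (cases "k = j") (auto simp: profile_def)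

lemma profile_start:
  assumes "kappa \<ge> 0" "0 < t" "t < 1" "1 \<le> j"
  shows "profile kappa t L j 1 = (kappa + (t + 1 / t)) * profile kappa t L j 0"
  using assms arm_1[OF assms(2), of kappa] by (simp add: profile_def)

text \<open>The fraction in the third line of conditions is the first step of the symmetric solution
  relative to its value at j. The condition is stated for the longest arm n and passes to j \<le> n
  by monotonicity; \<open>d\<close> may be 0 at j, since a missing pendant only weakens the
  requirement.\<close>

lemma profile_super:
  assumes k: "kappa \<ge> 0" and t: "0 < t" "t < 1" and j: "1 \<le> j" "j \<le> n" and L: "1 \<le> L"
    and c: "arm_ratio kappa t n + (t + t ^ (L - 1)) / (1 + t ^ L) \<le> t + 1 / t - kappa - leaf kappa t"
    and i: "0 < i" "i < j + L" and d: "d \<le> (if i = j then 1 else 0)" "0 \<le> d"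
  shows "profile kappa t L j (i - 1) + profile kappa t L j (i + 1) \<le> (t + 1 / t - d * (kappa + leaf kappa t)) * profile kappa t L j i"
proof -
  let ?r = "leaf kappa t"
  have r: "0 < ?r" by (rule leaf(2)[OF k t(1)])
  have dd: "(t + 1 / t - (if i = j then 1 else 0) * (kappa + ?r)) * profile kappa t L j i
      \<le> (t + 1 / t - d * (kappa + ?r)) * profile kappa t L j i"
    using d r k profile_pos[OF k t, of L j i]
    by (intro mult_right_mono diff_left_mono) auto
  consider "i < j" | "i = j" | "i > j" by linarith
  then show ?thesis
  proof cases
    case 1
    then have "i - Suc 0 \<le> j" by simp
    then have "profile kappa t L j (i - 1) + profile kappa t L j (i + 1) = (t + 1 / t) * profile kappa t L j i"
      using 1 arm_rec[OF t(1), of kappa "i - 1"] i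
      by (simp add: profile_def add_divide_distrib[symmetric] distrib_left[symmetric])
    then show ?thesis using dd 1 by simp
  next
    case 2
    have p: "1 + t ^ L > 0" using t by (simp add: add_pos_pos)
    have "arm_ratio kappa t j + (t + t ^ (L - 1)) / (1 + t ^ L) \<le> t + 1 / t - (kappa + ?r)"
      using c arm_ratio_mono[OF k t j] by simp
    then have le: "(arm_ratio kappa t j + (t + t ^ (L - 1)) / (1 + t ^ L)) * (1 + t ^ L) \<le> (t + 1 / t - (kappa + ?r)) * (1 + t ^ L)"
      using p by (intro mult_right_mono) auto
    have "arm_ratio kappa t j * (1 + t ^ L) + (t + t ^ (L - 1)) \<le> (t + 1 / t - (kappa + ?r)) * (1 + t ^ L)"
    proof -
      have "(t + t ^ (L - 1)) / (1 + t ^ L) * (1 + t ^ L) = t + t ^ (L - 1)" using p by simp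
      then show ?thesis using le unfolding distrib_right[of "arm_ratio kappa t j"] by simp
    qed
    moreover have "profile kappa t L j (j - 1) = arm_ratio kappa t j * (1 + t ^ L)"
      by (simp add: profile_def arm_ratio_def)
    moreover have "profile kappa t L j (j + 1) = t + t ^ (L - 1)" "profile kappa t L j j = 1 + t ^ L"
      using profile_ge[OF k t, of j "j + 1" L] profile_ge[OF k t, of j j L] by simp_all
    ultimately show ?thesis using dd 2 by simp
  next
    case 3
    define e where "e = i - j - 1"
    define g where "g = L - (i - j) - 1"
    have le: "j \<le> i - 1" "j \<le> i + 1" "j \<le> i" using 3 by auto
    have e: "i - j = Suc e" "i - 1 - j = e" "i + 1 - j = Suc (Suc e)" using 3 by (auto simp: e_def)
    have g: "L - Suc e = Suc g" "L - e = Suc (Suc g)" "L - Suc (Suc e) = g"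
      using 3 i by (auto simp: g_def e_def)
    have "t ^ e + t ^ Suc (Suc g) + (t ^ Suc (Suc e) + t ^ g) = (t + 1 / t) * (t ^ Suc e + t ^ Suc g)"
      using t by (simp add: field_simps)
    then have "profile kappa t L j (i - 1) + profile kappa t L j (i + 1) = (t + 1 / t) * profile kappa t L j i"
      unfolding profile_ge[OF k t le(1)] profile_ge[OF k t le(2)] profile_ge[OF k t le(3)] e g by simp
    then show ?thesis using dd 3 by simp
  qed
qed

lemma profile_swap:
  assumes "kappa \<ge> 0" "0 < t" "t < 1" "j \<le> k" "k \<le> j + L"
  shows "profile kappa t L j k = profile kappa t L j' (j + L + j' - k)"
proof -
  have "j + L + j' - k - j' = L - (k - j)" "L - (L - (k - j)) = k - j" "j' \<le> j + L + j' - k" using assms by auto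
  then show ?thesis
    using profile_ge[OF assms(1-4), of L] profile_ge[OF assms(1-3), of j' "j + L + j' - k" L] by simp
qed

text \<open>The first step of the symmetric solution tends to t relative to its value at the
  branching vertex as L grows, and the positive \<open>gap\<close> leaves room for the
  difference.\<close>

lemma exists_profile_length:
  assumes k: "kappa \<ge> 0" and t: "0 < t" and n: "1 \<le> n" and less: "t < sqrt_gamma kappa n"
  shows "\<exists>L0. \<forall>L\<ge>L0. arm_ratio kappa t n + (t + t ^ (L - 1)) / (1 + t ^ L) \<le> t + 1 / t - kappa - leaf kappa t"
proof -
  have t1: "t < 1" using less sqrt_gamma(2)[OF k, of n] by simp
  have "gap kappa n t > 0" using gap_sign(2)[OF k t t1 n] less by simp
  then have c: "t < t + 1 / t - kappa - leaf kappa t - arm_ratio kappa t n" by (simp add: gap_def)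
  have "(\<lambda>L. (t + t ^ L / t) / (1 + t ^ L)) \<longlonglongrightarrow> (t + 0 / t) / (1 + 0)"
    using t t1 by (intro tendsto_intros LIMSEQ_realpow_zero) auto
  then have "(\<lambda>L. (t + t ^ L / t) / (1 + t ^ L)) \<longlonglongrightarrow> t" by simp
  from order_tendstoD(2)[OF this c] obtain L0 where L0: "\<forall>L\<ge>L0. (t + t ^ L / t) / (1 + t ^ L) < t + 1 / t - kappa - leaf kappa t - arm_ratio kappa t n"
    unfolding eventually_sequentially by auto
  show ?thesis
  proof (intro exI[of _ "max L0 1"] allI impI)
    fix L assume L: "max L0 1 \<le> L"
    then have "t ^ (L - 1) = t ^ L / t" using t by (cases L) auto
    then show "arm_ratio kappa t n + (t + t ^ (L - 1)) / (1 + t ^ L) \<le> t + 1 / t - kappa - leaf kappa t"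
      using L0[rule_format, of L] L by simp
  qed
qed

text \<open>Stated with closed sets instead of walks: this is the form in which a path together with
  its pendants is shown to exhaust the graph.\<close>

definition connected_graph :: "nat pair_pre_digraph \<Rightarrow> bool" where
  "connected_graph G \<longleftrightarrow> (\<forall>A\<subseteq>pverts G. A \<noteq> {} \<longrightarrow> (\<forall>v\<in>A. nbrs G v \<subseteq> A) \<longrightarrow> A = pverts G)"

context alpha_graph
begin

lemma rho_le_level:
  assumes t: "0 < t" and "is_path G p K" "pendants G p K D" "0 < K"
    "pverts G \<subseteq> p ` {..K} \<union> (\<Union>k\<le>K. D k)"
    "nbrs G (p 0) \<subseteq> {p 1}" "nbrs G (p K) \<subseteq> {p (K - 1)}"
    "\<And>k. 0 < k \<Longrightarrow> k < K \<Longrightarrow> nbrs G (p k) \<subseteq> D k \<union> {p (k - 1), p (k + 1)}"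
    "\<And>k w. k \<le> K \<Longrightarrow> w \<in> D k \<Longrightarrow> nbrs G w \<subseteq> {p k}"
    "\<And>k. k \<le> K \<Longrightarrow> h k > 0"
    "h 1 \<le> (kappa + (t + 1 / t)) * h 0" "h (K - 1) \<le> (kappa + (t + 1 / t)) * h K"
    and hk: "\<And>k. 0 < k \<Longrightarrow> k < K \<Longrightarrow>
      h (k - 1) + h (k + 1) \<le> (t + 1 / t - card (D k) * (kappa + leaf kappa t)) * h k"
  shows "rho \<alpha> G \<le> level \<alpha> t"
  unfolding level_kappa
proof (rule caterpillar_le[where h = h, OF assms(2-9) _ assms(10-12)])
  show "kappa + (t + 1 / t) > 0" using t kappa_nonneg by (intro add_nonneg_pos add_pos_pos) auto
qed (use hk in \<open>simp_all add: leaf(4)[OF kappa_nonneg t]\<close>)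

text \<open>The pendants at i and at distance i' from the other end may be absent, so one statement
  covers one and two branching vertices.\<close>

lemma two_ended_le:
  assumes t: "0 < t" "t < 1" and i: "1 \<le> i" "i \<le> n" "1 \<le> i'" "i' \<le> n" and L: "1 \<le> L"
    and c: "arm_ratio kappa t n + (t + t ^ (L - 1)) / (1 + t ^ L) \<le> t + 1 / t - kappa - leaf kappa t"
    and K: "K = i + L + i'" and p: "is_path G p K" and D: "pendants G p K D"
    and Dcard: "\<And>k. k \<le> K \<Longrightarrow> card (D k) \<le> 1" "\<And>k. k \<le> K \<Longrightarrow> k \<noteq> i \<Longrightarrow> k \<noteq> K - i' \<Longrightarrow> D k = {}"
    and struct: "pverts G \<subseteq> p ` {..K} \<union> (\<Union>k\<le>K. D k)"
    "nbrs G (p 0) \<subseteq> {p 1}" "nbrs G (p K) \<subseteq> {p (K - 1)}"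
    "\<And>k. 0 < k \<Longrightarrow> k < K \<Longrightarrow> nbrs G (p k) \<subseteq> D k \<union> {p (k - 1), p (k + 1)}"
    "\<And>k w. k \<le> K \<Longrightarrow> w \<in> D k \<Longrightarrow> nbrs G w \<subseteq> {p k}"
  shows "rho \<alpha> G \<le> level \<alpha> t"
proof -
  \<comment> \<open>Both profiles agree on the stretch between the branching vertices, so around
    each k one of them describes three consecutive values.\<close>
  define h where "h k = (if k \<le> i + L then profile kappa t L i k else profile kappa t L i' (K - k))" for k
  have h_right: "h k = profile kappa t L i' (K - k)" if "i \<le> k" for k
    using profile_swap[OF kappa_nonneg t that, of L i'] K by (simp add: h_def)
  have K0: "0 < K" using K i by simp
  show ?thesis
  proof (rule rho_le_level[OF t(1) p D K0 struct])
    show "h k > 0" for k using profile_pos[OF kappa_nonneg t] by (simp add: h_def)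
    show "h 1 \<le> (kappa + (t + 1 / t)) * h 0"
      using profile_start[OF kappa_nonneg t i(1), of L] i L by (simp add: h_def)
    show "h (K - 1) \<le> (kappa + (t + 1 / t)) * h K"
      using profile_start[OF kappa_nonneg t i(3), of L] i L K by (simp add: h_right)
    fix k assume k: "0 < k" "k < K"
    show "h (k - 1) + h (k + 1) \<le> (t + 1 / t - card (D k) * (kappa + leaf kappa t)) * h k"
    proof (cases "k < i + L")
      case True
      have "card (D k) \<le> (if k = i then 1 else 0)" using Dcard[of k] k True K by auto
      then have "real (card (D k)) \<le> (if k = i then 1 else 0)" by (auto split: if_splits)
      from profile_super[OF kappa_nonneg t i(1,2) L c k(1) True this] have
        "profile kappa t L i (k - 1) + profile kappa t L i (k + 1)
          \<le> (t + 1 / t - card (D k) * (kappa + leaf kappa t)) * profile kappa t L i k" by simp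
      moreover have "k - 1 \<le> i + L" "k + 1 \<le> i + L" "k \<le> i + L" using True by auto
      ultimately show ?thesis by (simp only: h_def if_True)
    next
      case False
      have k': "0 < K - k" "K - k < i' + L" using k K False i L by auto
      have "card (D k) \<le> (if K - k = i' then 1 else 0)" using Dcard[of k] k False K L by auto
      then have d: "real (card (D k)) \<le> (if K - k = i' then 1 else 0)" by (auto split: if_splits)
      have e: "K - (k + 1) = K - k - 1" "K - (k - 1) = K - k + 1" using k by auto
      have "h (k + 1) = profile kappa t L i' (K - k - 1)" "h (k - 1) = profile kappa t L i' (K - k + 1)"
        "h k = profile kappa t L i' (K - k)"
        using h_right[of "k + 1"] h_right[of "k - 1"] h_right[of k] False L e by auto
      then show ?thesis using profile_super[OF kappa_nonneg t i(3,4) L c k' d] by simp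
    qed
  qed
qed

lemma extend_front:
  assumes p: "is_path G p K" and x: "x \<in> nbrs G (p 0)" "x \<notin> p ` {..K}"
  shows "is_path G (\<lambda>k. if k = 0 then x else p (k - 1)) (Suc K)"
proof -
  have "inj_on (\<lambda>k. if k = 0 then x else p (k - 1)) {..Suc K}"
  proof (rule inj_onI)
    fix a b assume ab: "a \<in> {..Suc K}" "b \<in> {..Suc K}"
      "(if a = 0 then x else p (a - 1)) = (if b = 0 then x else p (b - 1))"
    have ne: "p c \<noteq> x" if "c \<le> K" for c using x(2) that by auto
    have "p (a - 1) \<noteq> x" "p (b - 1) \<noteq> x" using ab(1,2) by (auto intro!: ne)
    then have "a = 0 \<longleftrightarrow> b = 0" using ab(3) by (auto split: if_splits)
    moreover have "a - 1 = b - 1" if "a \<noteq> 0" "b \<noteq> 0"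
      using p ab that unfolding is_path_def by (auto dest!: inj_onD)
    ultimately show "a = b" by (cases "a = 0") auto
  qed
  moreover have "x \<in> pverts G" using simple_graphD(4)[OF G] x(1) by blast
  ultimately show ?thesis using p sym[OF x(1)] unfolding is_path_def
    by (auto simp: gr0_conv_Suc)
qed

end

text \<open>Maximality is over all paths of \<open>G\<close>, not only extensions of
  \<open>p\<close>; rerouted paths of the same length can then be extended to a
  contradiction.\<close>

locale longest_path = alpha_graph +
  fixes t :: real and M :: nat and p :: "nat \<Rightarrow> nat" and K :: nat
  assumes t: "above_limit kappa t" and M: "long_arm kappa t M" and low: "rho \<alpha> G < level \<alpha> t"
    and p: "is_path G p K" and maximal: "\<And>q. \<not> is_path G q (Suc K)"
begin

text \<open>The exclusion results need M edges of \<open>p\<close> to the right of the vertex in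
  question; reversal transfers them to the right half.\<close>

lemma reversed: "longest_path G \<alpha> kappa t M (\<lambda>k. p (K - k)) K"
  using G \<alpha> kappa t M low maximal is_path_rev[OF p] by unfold_locales auto

lemma neq: "i \<le> K \<Longrightarrow> j \<le> K \<Longrightarrow> i \<noteq> j \<Longrightarrow> p i \<noteq> p j"
  using p by (auto simp: is_path_def dest: inj_onD)

lemma nb: "k < K \<Longrightarrow> p (Suc k) \<in> nbrs G (p k)"
  using p by (auto simp: is_path_def)

text \<open>The chord closes a cycle on which \<open>p (i - 1)\<close> is pendant. Together with
  reversal only an edge between the two ends of \<open>p\<close> remains possible.\<close>

lemma chord_start:
  assumes "0 < i" "i + 2 \<le> j" "j \<le> K" "p j \<in> nbrs G (p i)"
  shows False
proof -
  have q: "is_path G (\<lambda>k. p (i + k)) (j - i)" using is_path_shift[OF p, of i "j - i"] assms by simp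
  have "p (i - 1) \<notin> (\<lambda>k. p (i + k)) ` {..j - i}"
  proof
    assume "p (i - 1) \<in> (\<lambda>k. p (i + k)) ` {..j - i}"
    then obtain k where k: "k \<le> j - i" "p (i - 1) = p (i + k)" by auto
    have "i - 1 \<le> K" "i + k \<le> K" "i - 1 \<noteq> i + k" using k(1) assms by linarith+
    from neq[OF this] k(2) show False by simp
  qed
  moreover have "p (i - 1) \<in> nbrs G (p (i + 0))" using sym[OF nb[of "i - 1"]] assms by simp
  moreover have "2 \<le> j - i" using assms by simp
  ultimately show False using pan_level_le[OF t q, of "p (i - 1)"] assms low by simp
qed

lemma chord_ends:
  assumes "i + 2 \<le> j" "j \<le> K" "p j \<in> nbrs G (p i)"
  shows "i = 0" "j = K"
proof -
  show "i = 0" using chord_start[OF _ assms] by auto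
  interpret rev: longest_path G \<alpha> kappa t M "\<lambda>k. p (K - k)" K by (rule reversed)
  show "j = K"
  proof (rule ccontr)
    assume "j \<noteq> K"
    then have "0 < K - j" "K - j + 2 \<le> K - i" "K - i \<le> K" "K - (K - i) = i" "K - (K - j) = j"
      using assms(1,2) by linarith+
    then show False using rev.chord_start[of "K - j" "K - i"] sym[OF assms(3)] by simp
  qed
qed

lemma end_nbrs: "nbrs G (p 0) \<subseteq> p ` {..K}"
  using extend_front[OF p] maximal by blast

text \<open>Opening the cycle elsewhere makes each \<open>p k\<close> the start of a longest path,
  hence without neighbours off the path. By connectedness the cycle is spanning; it has no chords,
  so all degrees are at most 2.\<close>

lemma cycle_rho_le_2:
  assumes conn: "connected_graph G" and K: "2 \<le> K" and c: "p K \<in> nbrs G (p 0)"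
  shows "rho \<alpha> G \<le> 2"
proof -
  define s where "s k = (if k = K then 0 else Suc k)" for k
  define r where "r k = (if k = 0 then K else k - 1)" for k
  have inside: "nbrs G (p k) \<subseteq> p ` {..K}" if k: "k \<le> K" for k
  proof -
    \<comment> \<open>The cyclic enumeration starting at k; it passes from K back to 0 after K - k
      steps.\<close>
    define idx where "idx m = (if m \<le> K - k then k + m else k + m - Suc K)" for m
    define q where "q m = p (idx m)" for m
    have "inj_on q {..K}"
    proof (rule inj_onI)
      fix a b assume ab: "a \<in> {..K}" "b \<in> {..K}" "q a = q b"
      then have "idx a \<le> K" "idx b \<le> K" using k by (auto simp: idx_def)
      then have "idx a = idx b" using ab(3) neq by (auto simp: q_def)
      then show "a = b" using ab k by (auto simp: idx_def split: if_splits)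
    qed
    moreover have "q (Suc m) \<in> nbrs G (q m)" if "m < K" for m
    proof -
      consider "Suc m \<le> K - k" | "m = K - k" | "K - k < m" by linarith
      then show ?thesis
      proof cases
        case 1 then show ?thesis using nb[of "k + m"] k by (simp add: q_def idx_def)
      next
        case 2 then show ?thesis using sym[OF c] k by (simp add: q_def idx_def)
      next
        case 3
        then have "k + Suc m - Suc K = Suc (k + m - Suc K)" "k + m - Suc K < K" "\<not> Suc m \<le> K - k" "\<not> m \<le> K - k"
          using that k by linarith+
        then show ?thesis using nb[of "k + m - Suc K"] unfolding q_def idx_def by simp
      qed
    qed
    moreover have q0: "q 0 = p k" by (simp add: q_def idx_def)
    ultimately have q: "is_path G q K" using is_path_verts[OF p k] by (simp add: is_path_def)
    have "q ` {..K} \<subseteq> p ` {..K}" using k by (auto simp: q_def idx_def)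
    moreover have "card (q ` {..K}) = card (p ` {..K})"
      using q p by (simp add: is_path_def card_image)
    ultimately have "q ` {..K} = p ` {..K}" by (intro card_subset_eq) auto
    then show ?thesis using extend_front[OF q] maximal unfolding q0 by blast
  qed
  have "p ` {..K} = pverts G"
  proof (rule conn[unfolded connected_graph_def, THEN spec, THEN mp, THEN mp, THEN mp])
    show "p ` {..K} \<subseteq> pverts G" using is_path_verts[OF p] by (intro image_subsetI) simp
    show "\<forall>v\<in>p ` {..K}. nbrs G v \<subseteq> p ` {..K}"
    proof
      fix v assume "v \<in> p ` {..K}"
      then obtain k where "k \<le> K" "v = p k" by (elim imageE) simp
      then show "nbrs G v \<subseteq> p ` {..K}" using inside[of k] by simp
    qed
  qed simp
  moreover have "card (nbrs G (p k)) \<le> 2" if k: "k \<le> K" for k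
  proof -
    have "nbrs G (p k) \<subseteq> {p (s k), p (r k)}"
    proof
      fix y assume y: "y \<in> nbrs G (p k)"
      then obtain j where j: "j \<le> K" "y = p j" using inside[OF k] by auto
      have "j \<noteq> k" using y j simple_graphD(5)[OF G] by auto
      then consider "j = Suc k" | "k = Suc j" | "k + 2 \<le> j" | "j + 2 \<le> k" by linarith
      then show "y \<in> {p (s k), p (r k)}"
      proof cases
        case 3 then show ?thesis using chord_ends[of k j] y j by (auto simp: r_def)
      next
        case 4 then show ?thesis using chord_ends[of j k] sym[OF y] j k by (auto simp: s_def)
      qed (use j k in \<open>auto simp: s_def r_def\<close>)
    qed
    then have "card (nbrs G (p k)) \<le> card {p (s k), p (r k)}" by (intro card_mono) auto
    also have "\<dots> \<le> 2" by (simp add: card_insert_if)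
    finally show ?thesis .
  qed
  ultimately show ?thesis by (intro rho_le_2) (metis atMost_iff imageE)
qed

definition off :: "nat \<Rightarrow> nat set" where
  "off k = nbrs G (p k) - p ` {..K}"

lemma off_0: "off 0 = {}" using end_nbrs by (auto simp: off_def)

text \<open>The vertices w, p j, ..., p k form a cycle on which \<open>p (k - 1)\<close> is
  pendant.\<close>

lemma detour:
  assumes "1 \<le> k" "k < j" "j \<le> K" "w \<in> nbrs G (p k)" "w \<in> nbrs G (p j)" "w \<notin> p ` {..K}"
  shows False
proof -
  have q: "is_path G (\<lambda>m. p (k + m)) (j - k)" using is_path_shift[OF p, of k "j - k"] assms by simp
  have qr: "is_path G (\<lambda>m. p (k + (j - k - m))) (j - k)" using is_path_rev[OF q] .
  have sub: "(\<lambda>m. p (k + (j - k - m))) ` {..j - k} \<subseteq> p ` {k..K}"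
  proof (rule image_subsetI)
    fix m assume "m \<in> {..j - k}"
    then have "k + (j - k - m) \<in> {k..K}" using assms by auto
    then show "p (k + (j - k - m)) \<in> p ` {k..K}" by (rule imageI)
  qed
  have wn: "w \<notin> p ` {k..K}" using assms(6) by auto
  define q' where "q' = (\<lambda>m. if m = 0 then w else p (k + (j - k - (m - 1))))"
  have q': "is_path G q' (Suc (j - k))" unfolding q'_def
    by (rule extend_front[OF qr]) (use assms(2,5) sub wn in auto)
  have sub': "q' ` {..Suc (j - k)} \<subseteq> insert w (p ` {k..K})"
  proof (rule image_subsetI)
    fix m assume m: "m \<in> {..Suc (j - k)}"
    have "p (k + (j - k - (m - 1))) \<in> (\<lambda>m. p (k + (j - k - m))) ` {..j - k}" if "m \<noteq> 0"
      using m by (intro image_eqI[of _ _ "m - 1"]) auto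
    then show "q' m \<in> insert w (p ` {k..K})" using sub by (auto simp: q'_def)
  qed
  have "q' (Suc (j - k)) = p k" "q' 0 = w" by (simp_all add: q'_def)
  moreover have "p (k - 1) \<notin> insert w (p ` {k..K})"
  proof
    assume "p (k - 1) \<in> insert w (p ` {k..K})"
    moreover have "p (k - 1) \<in> p ` {..K}" using assms by auto
    ultimately obtain m where m: "k \<le> m" "m \<le> K" "p (k - 1) = p m" using assms(6) by auto
    have "k - 1 \<le> K" "k - 1 \<noteq> m" using assms m(1) by linarith+
    from neq[OF this(1) m(2) this(2)] m(3) show False by simp
  qed
  then have "p (k - 1) \<notin> q' ` {..Suc (j - k)}" using sub' by blast
  moreover have "p (k - 1) \<in> nbrs G (p k)" using sym[OF nb[of "k - 1"]] assms by simp
  moreover have "2 \<le> Suc (j - k)" using assms by simp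
  ultimately show False
    using pan_level_le[OF t is_path_rev[OF q'], of "p (k - 1)"] assms low
    unfolding image_rev by simp
qed

lemma M_pos: "1 \<le> M" using M by (simp add: long_arm_def)

lemma off_finite: "finite (off k)"
  unfolding off_def using simple_graphD(3)[OF G] by blast

lemma off_card:
  assumes "k + M \<le> K"
  shows "card (off k) \<le> 1"
proof (rule ccontr)
  assume "\<not> card (off k) \<le> 1"
  then obtain w w' where w: "w \<in> off k" "w' \<in> off k" "w \<noteq> w'"
    using card_le_Suc0_iff_eq[OF off_finite, of k] by auto
  have "1 \<le> k" using w(1) off_0 by (cases k) auto
  then show False
    using double_pendant_level_le[OF t M p _ assms, of w w'] w low by (auto simp: off_def)
qed

text \<open>A second neighbour x of w on the path is a \<open>detour\<close>. If x is off the path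
  and k = 1, replacing \<open>p 0\<close> by x, w yields a longer path; for k \<ge> 2 the vertices
  w, x form a branch of length two.\<close>

lemma off_leaf:
  assumes k: "k + M \<le> K" and w: "w \<in> off k"
  shows "nbrs G w \<subseteq> {p k}"
proof
  fix x assume x: "x \<in> nbrs G w"
  interpret rev: longest_path G \<alpha> kappa t M "\<lambda>k. p (K - k)" K by (rule reversed)
  have k1: "1 \<le> k" using w off_0 by (cases k) auto
  have kK: "k < K" using k M_pos by simp
  have w': "w \<in> nbrs G (p k)" "w \<notin> p ` {..K}" using w by (auto simp: off_def)
  show "x \<in> {p k}"
  proof (rule ccontr)
    assume ne: "x \<notin> {p k}"
    show False
    proof (cases "x \<in> p ` {..K}")
      case True
      then obtain j where j: "j \<le> K" "x = p j" by auto
      have jn: "w \<in> nbrs G (p j)" using sym[OF x] j by simp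
      have "j \<noteq> k" using ne j by auto
      then consider "k < j" | "j < k" by linarith
      then show False
      proof cases
        case 1 then show False using detour[OF k1 1 j(1) w'(1) jn w'(2)] by simp
      next
        case 2
        have "w \<notin> (\<lambda>k. p (K - k)) ` {..K}" unfolding image_rev by (rule w'(2))
        moreover have "1 \<le> K - k" "K - k < K - j" "K - j \<le> K" "K - (K - k) = k" "K - (K - j) = j"
          using 2 kK by linarith+
        ultimately show False using rev.detour[of "K - k" "K - j" w] w'(1) jn by simp
      qed
    next
      case False
      show False
      proof (cases "k = 1")
        case True
        have q: "is_path G (\<lambda>m. p (1 + m)) (K - 1)" using is_path_shift[OF p, of 1 "K - 1"] kK by simp
        have sub: "(\<lambda>m. p (1 + m)) ` {..K - 1} \<subseteq> p ` {..K}" using kK by auto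
        define q1 where "q1 = (\<lambda>m. if m = 0 then w else p (1 + (m - 1)))"
        have q1: "is_path G q1 (Suc (K - 1))" unfolding q1_def
          by (rule extend_front[OF q]) (use w' True sub in auto)
        have "x \<noteq> w" using x simple_graphD(5)[OF G] by auto
        moreover have "q1 ` {..Suc (K - 1)} \<subseteq> insert w (p ` {..K})"
          using kK by (auto simp: q1_def)
        ultimately have "x \<notin> q1 ` {..Suc (K - 1)}" using False by blast
        moreover have "x \<in> nbrs G (q1 0)" using x by (simp add: q1_def)
        ultimately show False using extend_front[OF q1] maximal kK by auto
      next
        case k2: False
        then have "2 \<le> k" using k1 by simp
        from double_spur_level_le[OF t M p this k w'(1) x w'(2) False] show False using low by simp
      qed
    qed
  qed
qed

lemma off_unique:
  assumes "i < j" "j + M \<le> K" "off i \<noteq> {}" "off j \<noteq> {}"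
  shows False
proof -
  obtain w w' where w: "w \<in> off i" "w' \<in> off j" using assms by blast
  have "1 \<le> i" using w(1) off_0 by (cases i) auto
  moreover have "w \<noteq> w'"
  proof
    assume "w = w'"
    then have "p j \<in> nbrs G w" using w sym by (auto simp: off_def)
    then have "p j = p i" using off_leaf[of i w] w assms by auto
    then show False using neq[of j i] assms by simp
  qed
  ultimately show False using fork_level_le[OF t M p _ assms(1,2), of w w'] w low by (auto simp: off_def)
qed

text \<open>A second parameter t' enters: a branching vertex beyond index n would have an arm of at
  least n + 1 vertices, which already forces the level of t'.\<close>

lemma off_bound:
  assumes t': "0 < t'" "t' < 1" and low': "rho \<alpha> G < level \<alpha> t'"
    and c: "t' + 1 / t' - kappa - leaf kappa t' \<le> arm_ratio kappa t' (Suc n) + trunc t' M 1"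
    and i: "i + M \<le> K" "off i \<noteq> {}"
  shows "i \<le> n"
proof (rule ccontr)
  assume "\<not> i \<le> n"
  then have n: "1 \<le> Suc n" "Suc n \<le> i" by auto
  obtain w where "w \<in> nbrs G (p i)" "w \<notin> p ` {..K}" using i by (auto simp: off_def)
  from spur_level_le[OF t' M_pos n p i(1) this c] low' show False by simp
qed

lemma off_rev:
  assumes "k \<le> K"
  shows "longest_path.off G (\<lambda>k. p (K - k)) K k = off (K - k)"
proof -
  interpret rev: longest_path G \<alpha> kappa t M "\<lambda>k. p (K - k)" K by (rule reversed)
  show ?thesis unfolding rev.off_def off_def image_rev by simp
qed

text \<open>Here t controls the shape, t' the positions, and s carries the supersolution. In the
  bound on K the summand 2M lets every vertex see M edges on one side, while 2n + L0 + 1 leaves a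
  stretch of positive length at least L0 between the branching vertices.\<close>

lemma rho_bound:
  assumes conn: "connected_graph G"
    and t': "0 < t'" "t' < 1" and low': "rho \<alpha> G < level \<alpha> t'"
    and c: "t' + 1 / t' - kappa - leaf kappa t' \<le> arm_ratio kappa t' (Suc n) + trunc t' M 1"
    and s: "0 < s" "s < 1"
    and cs: "\<And>L. n \<ge> 1 \<Longrightarrow> L0 \<le> L \<Longrightarrow>
      arm_ratio kappa s n + (s + s ^ (L - 1)) / (1 + s ^ L) \<le> s + 1 / s - kappa - leaf kappa s"
    and K: "2 * M + 2 * n + L0 + 1 \<le> K"
  shows "rho \<alpha> G \<le> max 2 (level \<alpha> s)"
proof (cases "\<exists>i j. i + 2 \<le> j \<and> j \<le> K \<and> p j \<in> nbrs G (p i)")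
  case True
  then obtain i j where "i + 2 \<le> j" "j \<le> K" "p j \<in> nbrs G (p i)" by auto
  with chord_ends[OF this] have "rho \<alpha> G \<le> 2" by (intro cycle_rho_le_2[OF conn]) auto
  then show ?thesis by simp
next
  case no_chord: False
  interpret rev: longest_path G \<alpha> kappa t M "\<lambda>k. p (K - k)" K by (rule reversed)
  have side: "k + M \<le> K \<or> (K - k) + M \<le> K" if "k \<le> K" for k using K by linarith
  have card1: "card (off k) \<le> 1" if k: "k \<le> K" for k
    using side[OF k]
  proof
    assume "K - k + M \<le> K"
    then show ?thesis using rev.off_card[of "K - k"] off_rev[of "K - k"] k by simp
  qed (rule off_card)
  have leaf: "nbrs G w \<subseteq> {p k}" if k: "k \<le> K" "w \<in> off k" for k w
    using side[OF k(1)]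
  proof
    assume "K - k + M \<le> K"
    then show ?thesis using rev.off_leaf[of "K - k" w] off_rev[of "K - k"] k by simp
  qed (rule off_leaf[OF _ k(2)])
  have loc: "k \<le> n \<or> K - k \<le> n" if k: "k \<le> K" "off k \<noteq> {}" for k
    using side[OF k(1)]
  proof
    assume "k + M \<le> K"
    from off_bound[OF t' low' c this k(2)] show ?thesis by simp
  next
    assume 1: "K - k + M \<le> K"
    have "rev.off (K - k) \<noteq> {}" using off_rev[of "K - k"] k by simp
    from rev.off_bound[OF t' low' c 1 this] show ?thesis by simp
  qed
  have off_K: "off K = {}" using rev.off_0 off_rev[of 0] by simp
  have inner: "nbrs G (p k) \<subseteq> off k \<union> {p j | j. j \<le> K \<and> (j = Suc k \<or> k = Suc j)}" if k: "k \<le> K" for k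
  proof
    fix y assume y: "y \<in> nbrs G (p k)"
    show "y \<in> off k \<union> {p j | j. j \<le> K \<and> (j = Suc k \<or> k = Suc j)}"
    proof (cases "y \<in> p ` {..K}")
      case True
      then obtain j where j: "j \<le> K" "y = p j" by auto
      have "j \<noteq> k" using y j simple_graphD(5)[OF G] by auto
      moreover have "\<not> k + 2 \<le> j" using no_chord j y by blast
      moreover have "\<not> j + 2 \<le> k" using no_chord k sym[OF y] j by blast
      ultimately have "j = Suc k \<or> k = Suc j" by linarith
      then show ?thesis using j by blast
    qed (use y in \<open>simp add: off_def\<close>)
  qed
  have pend: "pendants G p K off"
    unfolding pendants_def
  proof (intro conjI allI impI off_0 off_K)
    fix j k assume jk: "j \<le> K" "k \<le> K" "j \<noteq> k"
    show "off j \<inter> off k = {}"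
    proof (rule ccontr)
      assume "off j \<inter> off k \<noteq> {}"
      then obtain w where w: "w \<in> off j" "w \<in> off k" by blast
      have "p k \<in> nbrs G w" using w(2) sym by (auto simp: off_def)
      then have "p k = p j" using leaf[OF jk(1) w(1)] by auto
      then show False using neq[of k j] jk by simp
    qed
  qed (auto simp: off_def)
  let ?W = "p ` {..K} \<union> (\<Union>k\<le>K. off k)"
  have V: "?W = pverts G"
  proof (rule conn[unfolded connected_graph_def, THEN spec, THEN mp, THEN mp, THEN mp])
    have "p ` {..K} \<subseteq> pverts G" using is_path_verts[OF p] by (intro image_subsetI) simp
    moreover have "off k \<subseteq> pverts G" for k unfolding off_def using simple_graphD(4)[OF G] by blast
    ultimately show "?W \<subseteq> pverts G" by blast
    show "\<forall>v\<in>?W. nbrs G v \<subseteq> ?W"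
    proof
      fix v assume "v \<in> ?W"
      then consider k where "k \<le> K" "v = p k" | k where "k \<le> K" "v \<in> off k" by blast
      then show "nbrs G v \<subseteq> ?W"
      proof cases
        case 1 then show ?thesis using inner[of k] by blast
      next
        case 2 then show ?thesis using leaf[of k v] by blast
      qed
    qed
  qed simp
  have n0: "nbrs G (p 0) \<subseteq> {p 1}" using inner[of 0] off_0 by auto
  have nK: "nbrs G (p K) \<subseteq> {p (K - 1)}" using inner[of K] off_K by auto
  have nk: "nbrs G (p k) \<subseteq> off k \<union> {p (k - 1), p (k + 1)}" if "0 < k" "k < K" for k
    using inner[of k] that by auto
  show ?thesis
  proof (cases "\<exists>k\<le>K. off k \<noteq> {}")
    case False
    have "card (nbrs G v) \<le> 2" if v: "v \<in> pverts G" for v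
    proof -
      obtain k where k: "k \<le> K" "v = p k" using v V False by blast
      have "nbrs G v \<subseteq> {p (k - 1), p (k + 1)}" using inner[OF k(1)] False k by auto
      then have "card (nbrs G v) \<le> card {p (k - 1), p (k + 1)}" by (intro card_mono) auto
      also have "\<dots> \<le> 2" by (simp add: card_insert_if)
      finally show ?thesis .
    qed
    then have "rho \<alpha> G \<le> 2" by (rule rho_le_2)
    then show ?thesis by simp
  next
    case True
    then obtain k0 where k0: "k0 \<le> K" "off k0 \<noteq> {}" by blast
    \<comment> \<open>For n = 0 a pendant could only hang at an end of the path, which maximality
      forbids.\<close>
    have n: "1 \<le> n"
    proof (rule ccontr)
      assume "\<not> 1 \<le> n"
      then have "k0 = 0 \<or> k0 = K" using loc[OF k0] k0(1) by auto
      then show False using off_0 off_K k0 by auto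
    qed
    \<comment> \<open>If there is no pendant near this end, any index from 1 to n serves, as
      \<open>two_ended_le\<close> permits an absent one.\<close>
    have ex: "\<exists>i. 1 \<le> i \<and> i \<le> n \<and> (\<forall>k\<le>n. off k \<noteq> {} \<longrightarrow> k = i)"
    proof (cases "\<exists>i\<le>n. off i \<noteq> {}")
      case True
      then obtain i where i: "i \<le> n" "off i \<noteq> {}" by blast
      have "1 \<le> i" using i off_0 by (cases i) auto
      moreover have "k = i" if k: "k \<le> n" "off k \<noteq> {}" for k
        using off_unique[of k i] off_unique[of i k] i k K by (cases k i rule: linorder_cases) auto
      ultimately show ?thesis using i by blast
    qed (use n in blast)
    have ex': "\<exists>i. 1 \<le> i \<and> i \<le> n \<and> (\<forall>k\<le>n. off (K - k) \<noteq> {} \<longrightarrow> k = i)"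
    proof (cases "\<exists>i\<le>n. off (K - i) \<noteq> {}")
      case True
      then obtain i where i: "i \<le> n" "off (K - i) \<noteq> {}" by blast
      have "1 \<le> i" using i off_K by (cases i) auto
      moreover have "k = i" if k: "k \<le> n" "off (K - k) \<noteq> {}" for k
        using rev.off_unique[of k i] rev.off_unique[of i k] off_rev[of k] off_rev[of i] i k K
        by (cases k i rule: linorder_cases) auto
      ultimately show ?thesis using i by blast
    qed (use n in blast)
    obtain i where i: "1 \<le> i" "i \<le> n" "\<And>k. k \<le> n \<Longrightarrow> off k \<noteq> {} \<Longrightarrow> k = i" using ex by blast
    obtain i' where i': "1 \<le> i'" "i' \<le> n" "\<And>k. k \<le> n \<Longrightarrow> off (K - k) \<noteq> {} \<Longrightarrow> k = i'" using ex' by blast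
    define L where "L = K - i - i'"
    have L: "L0 \<le> L" "1 \<le> L" "K = i + L + i'" using K i(2) i'(2) by (auto simp: L_def)
    have only: "off k = {}" if k: "k \<le> K" "k \<noteq> i" "k \<noteq> K - i'" for k
    proof (rule ccontr)
      assume a: "off k \<noteq> {}"
      from loc[OF k(1) a] show False
      proof
        assume "k \<le> n" then show False using i(3) a k(2) by blast
      next
        assume "K - k \<le> n"
        then have "K - k = i'" using i'(3)[of "K - k"] a k(1) by simp
        then show False using k by simp
      qed
    qed
    have "rho \<alpha> G \<le> level \<alpha> s"
      by (rule two_ended_le[OF s i(1,2) i'(1,2) L(2) cs[OF n L(1)] L(3) p pend card1 only
          equalityD2[OF V] n0 nK nk leaf])
    then show ?thesis by simp
  qed
qed

end

section \<open>Reduction to connected graphs with long paths\<close>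

fun nbhd :: "nat pair_pre_digraph \<Rightarrow> nat \<Rightarrow> nat \<Rightarrow> nat set" where
  "nbhd G v 0 = {v}"
| "nbhd G v (Suc k) = nbhd G v k \<union> (\<Union>w\<in>nbhd G v k. nbrs G w)"

lemma nbhd_mono: "j \<le> k \<Longrightarrow> nbhd G v j \<subseteq> nbhd G v k"
  by (induction k) (auto simp: le_Suc_eq)

lemma nbhd_card:
  assumes G: "simple_graph G" and d: "\<And>v. card (nbrs G v) \<le> d"
  shows "finite (nbhd G v k) \<and> card (nbhd G v k) \<le> Suc d ^ k"
proof (induction k)
  case (Suc k)
  have "card (\<Union>w\<in>nbhd G v k. nbrs G w) \<le> (\<Sum>w\<in>nbhd G v k. card (nbrs G w))"
    using Suc by (intro card_UN_le) auto
  also have "\<dots> \<le> (\<Sum>w\<in>nbhd G v k. d)" using d by (intro sum_mono) auto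
  finally have "card (\<Union>w\<in>nbhd G v k. nbrs G w) \<le> card (nbhd G v k) * d" by simp
  then have "card (nbhd G v (Suc k)) \<le> card (nbhd G v k) + card (nbhd G v k) * d"
    using card_Un_le[of "nbhd G v k" "\<Union>w\<in>nbhd G v k. nbrs G w"] by simp
  also have "\<dots> \<le> Suc d * Suc d ^ k" using Suc by (simp add: algebra_simps add_mono mult_le_mono)
  finally show ?case using Suc simple_graphD(3)[OF G] by auto
qed simp

text \<open>Distances are counted back from \<open>p K\<close>, because paths are extended at the
  front and keep their end fixed.\<close>

lemma path_start_in_nbhd:
  assumes G: "simple_graph G" and p: "is_path G p K"
  shows "j \<le> K \<Longrightarrow> p (K - j) \<in> nbhd G (p K) j"
proof (induction j)
  case (Suc j)
  have "p (Suc (K - Suc j)) \<in> nbrs G (p (K - Suc j))" using p Suc.prems by (auto simp: is_path_def)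
  then have "p (K - Suc j) \<in> nbrs G (p (K - j))"
    using simple_graphD(6)[OF G] Suc.prems by (simp add: Suc_diff_Suc)
  then show ?case using Suc by auto
qed simp

context alpha_graph
begin

lemma is_path_bound:
  assumes p: "is_path G p K"
  shows "K < card (pverts G)"
proof -
  have "p ` {..K} \<subseteq> pverts G" using is_path_verts[OF p] by (intro image_subsetI) simp
  then have "card (p ` {..K}) \<le> card (pverts G)" using simple_graphD(1)[OF G] by (intro card_mono) auto
  then show ?thesis using p by (simp add: is_path_def card_image)
qed

text \<open>The vertices joined to \<open>v0\<close> by a path form a closed set, hence all of
  \<open>G\<close>. If all paths were short, \<open>G\<close> would lie in a ball of radius B, which
  has at most (d+1)^B vertices.\<close>

lemma long_path_exists:
  assumes conn: "connected_graph G" and d: "\<And>v. card (nbrs G v) \<le> d"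
    and big: "card (pverts G) > Suc d ^ B"
  obtains p K where "is_path G p K" "B \<le> K" "\<And>q. \<not> is_path G q (Suc K)"
proof -
  obtain v0 where v0: "v0 \<in> pverts G" using simple_graphD(2)[OF G] by blast
  define A where "A = {v. \<exists>p K. is_path G p K \<and> p 0 = v \<and> p K = v0}"
  have "A = pverts G"
  proof (rule conn[unfolded connected_graph_def, THEN spec, THEN mp, THEN mp, THEN mp])
    show "A \<subseteq> pverts G" by (auto simp: A_def is_path_def)
    have "is_path G (\<lambda>_. v0) 0" using v0 by (simp add: is_path_def)
    then show "A \<noteq> {}" unfolding A_def by blast
    show "\<forall>v\<in>A. nbrs G v \<subseteq> A"
    proof (intro ballI subsetI)
      fix v y assume "v \<in> A" and y: "y \<in> nbrs G v"
      then obtain p K where p: "is_path G p K" "p 0 = v" "p K = v0" by (auto simp: A_def)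
      show "y \<in> A"
      proof (cases "y \<in> p ` {..K}")
        case True
        then obtain j where j: "j \<le> K" "y = p j" by auto
        have "is_path G (\<lambda>k. p (j + k)) (K - j)" using is_path_shift[OF p(1), of j "K - j"] j by simp
        moreover have "p (j + 0) = y" "p (j + (K - j)) = v0" using j p by auto
        ultimately show ?thesis unfolding A_def by blast
      next
        case False
        have "is_path G (\<lambda>k. if k = 0 then y else p (k - 1)) (Suc K)"
          by (rule extend_front[OF p(1)]) (use y p False in auto)
        then show ?thesis unfolding A_def using p(3) by force
      qed
    qed
  qed
  have "\<exists>p K. is_path G p K \<and> B \<le> K"
  proof (rule ccontr)
    assume no: "\<not> (\<exists>p K. is_path G p K \<and> B \<le> K)"
    have "pverts G \<subseteq> nbhd G v0 B"
    proof
      fix v assume "v \<in> pverts G"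
      then have "v \<in> A" using \<open>A = pverts G\<close> by simp
      then obtain p K where p: "is_path G p K" "p 0 = v" "p K = v0" unfolding A_def by blast
      have "K \<le> B" using no p(1) by (meson nat_le_linear)
      then show "v \<in> nbhd G v0 B"
        using path_start_in_nbhd[OF G p(1), of K] p nbhd_mono[of K B G v0] by auto
    qed
    then have "card (pverts G) \<le> card (nbhd G v0 B)" using nbhd_card[OF G d] by (intro card_mono) auto
    also have "\<dots> \<le> Suc d ^ B" using nbhd_card[OF G d] by blast
    finally show False using big by simp
  qed
  then obtain p0 K0 where p0: "is_path G p0 K0" "B \<le> K0" by blast
  let ?P = "\<lambda>K. \<exists>p. is_path G p K"
  define K where "K = (GREATEST K. ?P K)"
  have bound: "\<And>k. ?P k \<Longrightarrow> k \<le> card (pverts G)" using is_path_bound by (meson less_imp_le)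
  have PK: "?P K" unfolding K_def by (rule GreatestI_nat[of ?P K0, OF _ bound]) (use p0 in auto)
  have gr: "k \<le> K" if "?P k" for k unfolding K_def by (rule Greatest_le_nat[of ?P, OF that bound])
  obtain p where "is_path G p K" using PK by blast
  moreover have "B \<le> K" using gr[of K0] p0 by (meson order_trans)
  moreover have "\<not> is_path G q (Suc K)" for q using gr[of "Suc K"] Suc_n_not_le_n by blast
  ultimately show ?thesis by (rule that)
qed

end

section \<open>Induced subgraphs, and finiteness of the spectral radii in bounded order\<close>

definition induced :: "nat pair_pre_digraph \<Rightarrow> nat set \<Rightarrow> nat pair_pre_digraph" where
  "induced G C = \<lparr> pverts = C, parcs = parcs G \<inter> C \<times> C \<rparr>"

lemma induced_verts [simp]: "pverts (induced G C) = C"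
  by (simp add: induced_def)

lemma induced_nbrs: "nbrs (induced G C) v = (if v \<in> C then nbrs G v \<inter> C else {})"
  by (auto simp: induced_def nbrs_def)

lemma simple_graphI:
  assumes "finite (pverts G)" "pverts G \<noteq> {}" "\<And>v w. (v, w) \<in> parcs G \<Longrightarrow> v \<in> pverts G \<and> v \<noteq> w \<and> (w, v) \<in> parcs G"
  shows "simple_graph G"
proof -
  have "parcs G \<subseteq> pverts G \<times> pverts G" using assms(3) by auto
  then have "finite (parcs G)" using assms(1) by (meson finite_SigmaI finite_subset)
  moreover have "w \<in> pverts G" if "(v, w) \<in> parcs G" for v w using assms(3) that by blast
  ultimately show ?thesis unfolding simple_graph_def using assms
    by (intro conjI) (unfold_locales, auto simp: symmetric_def sym_def)
qed

lemma simple_graph_induced: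
  assumes G: "simple_graph G" and "C \<subseteq> pverts G" "C \<noteq> {}"
  shows "simple_graph (induced G C)"
proof (rule simple_graphI)
  show "finite (pverts (induced G C))" using assms simple_graphD(1)[OF G] finite_subset by auto
  fix v w assume "(v, w) \<in> parcs (induced G C)"
  then have "w \<in> nbrs G v" "v \<in> C" "w \<in> C" by (auto simp: induced_def nbrs_def)
  then show "v \<in> pverts (induced G C) \<and> v \<noteq> w \<and> (w, v) \<in> parcs (induced G C)"
    using simple_graphD(5,6)[OF G] by (auto simp: induced_def nbrs_def)
qed (use assms in simp)

text \<open>
  The subgraph is induced on a set of minimal size that supports a subsolution at the level \<open>\<rho>(G)\<close>:
  restricting to a union of components keeps it a subsolution.
\<close>

lemma connected_subgraph_same_rho:
  assumes G: "simple_graph G" and \<alpha>: "0 \<le> \<alpha>" "\<alpha> < 1"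
  shows "\<exists>H. simple_graph H \<and> connected_graph H \<and> rho \<alpha> H = rho \<alpha> G"
proof -
  define Q where "Q C \<longleftrightarrow> C \<subseteq> pverts G \<and> (\<exists>f::nat \<Rightarrow> real. (\<forall>v. f v \<ge> 0) \<and> (\<exists>v\<in>C. f v > 0)
      \<and> (\<forall>v\<in>C. rho \<alpha> G * f v \<le> act \<alpha> (induced G C) f v))" for C
  have whole: "act \<alpha> (induced G (pverts G)) f v = act \<alpha> G f v" if "v \<in> pverts G" for f :: "nat \<Rightarrow> real" and v
    using that simple_graphD(4)[OF G, of v] by (simp add: act_def induced_nbrs Int_absorb2)
  have "Q (pverts G)"
    using rho_subeigenvector[OF G \<alpha>] whole unfolding Q_def by (metis order_refl)
  then obtain C where C: "Q C" and minimal: "\<And>B. Q B \<Longrightarrow> card C \<le> card B"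
    using ex_has_least_nat[of Q "pverts G" card] by blast
  obtain f :: "nat \<Rightarrow> real" where f: "\<And>v. f v \<ge> 0" "\<exists>v\<in>C. f v > 0"
    "\<And>v. v \<in> C \<Longrightarrow> rho \<alpha> G * f v \<le> act \<alpha> (induced G C) f v" and CV: "C \<subseteq> pverts G"
    using C unfolding Q_def by blast
  have fin: "finite C" using CV simple_graphD(1)[OF G] finite_subset by blast
  let ?H = "induced G C"
  have H: "simple_graph ?H" using simple_graph_induced[OF G CV] f(2) by blast
  have part: "\<not> (\<exists>v\<in>B. f v > 0)" if B: "B \<subset> C" "\<And>v. v \<in> B \<Longrightarrow> nbrs ?H v \<subseteq> B" for B
  proof
    assume pos: "\<exists>v\<in>B. f v > 0"
    have "act \<alpha> (induced G B) f v = act \<alpha> ?H f v" if v: "v \<in> B" for v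
    proof -
      have "nbrs (induced G B) v = nbrs ?H v" using B(1) B(2)[OF v] v by (auto simp: induced_nbrs)
      then show ?thesis by (simp add: act_def)
    qed
    then have "Q B" using pos B(1) CV f unfolding Q_def
      by (intro conjI exI[of _ f]) auto
    then show False using minimal[of B] psubset_card_mono[OF fin B(1)] by simp
  qed
  have "connected_graph ?H"
    unfolding connected_graph_def
  proof (intro allI impI)
    fix A assume A: "A \<subseteq> pverts ?H" "A \<noteq> {}" "\<forall>v\<in>A. nbrs ?H v \<subseteq> A"
    show "A = pverts ?H"
    proof (rule ccontr)
      assume "A \<noteq> pverts ?H"
      then have AC: "A \<subset> C" using A by auto
      have 1: "\<not> (\<exists>v\<in>A. f v > 0)" by (rule part[OF AC]) (use A in auto)
      have "C - A \<subset> C" using A by auto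
      then have "\<not> (\<exists>v\<in>C - A. f v > 0)"
      proof (rule part)
        fix v assume v: "v \<in> C - A"
        show "nbrs ?H v \<subseteq> C - A"
        proof
          fix w assume w: "w \<in> nbrs ?H v"
          then have "w \<in> C" using simple_graphD(4)[OF H] by fastforce
          moreover have "v \<in> nbrs ?H w" using w simple_graphD(6)[OF H] by blast
          then have "w \<notin> A" using A(3) v by blast
          ultimately show "w \<in> C - A" by simp
        qed
      qed
      then show False using 1 f(2) by blast
    qed
  qed
  moreover have "rho \<alpha> ?H = rho \<alpha> G"
  proof (rule antisym)
    show "rho \<alpha> G \<le> rho \<alpha> ?H" by (rule rho_ge[OF H \<alpha>, of f]) (use f in auto)
    obtain g :: "nat \<Rightarrow> real" where g: "\<And>v. g v \<ge> 0" "\<exists>v\<in>pverts ?H. g v > 0"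
      "\<And>v. v \<in> pverts ?H \<Longrightarrow> rho \<alpha> ?H * g v \<le> act \<alpha> ?H g v"
      using rho_subeigenvector[OF H \<alpha>] by metis
    \<comment> \<open>Extension by zero: outside \<open>C\<close> the inequality is trivial, and
      inside degrees can only be larger in \<open>G\<close>.\<close>
    define g' where "g' v = (if v \<in> C then g v else 0)" for v
    show "rho \<alpha> ?H \<le> rho \<alpha> G"
    proof (rule rho_ge[OF G \<alpha>, of g'])
      show "\<exists>v\<in>pverts G. 0 < g' v" using g(2) CV by (auto simp: g'_def)
      show "0 \<le> g' v" for v using g(1) by (simp add: g'_def)
      fix v assume v: "v \<in> pverts G"
      have finv: "finite (nbrs G v)" by (rule simple_graphD(3)[OF G])
      show "rho \<alpha> ?H * g' v \<le> act \<alpha> G g' v"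
      proof (cases "v \<in> C")
        case True
        have "card (nbrs ?H v) \<le> card (nbrs G v)"
          using finv True by (intro card_mono) (auto simp: induced_nbrs)
        then have "\<alpha> * card (nbrs ?H v) * g v \<le> \<alpha> * card (nbrs G v) * g v"
          using \<alpha> g(1) by (intro mult_right_mono mult_left_mono) auto
        moreover have "sum g' (nbrs G v) = sum g (nbrs ?H v)"
          using True finv by (simp add: g'_def induced_nbrs sum.inter_restrict)
        ultimately have "act \<alpha> ?H g v \<le> act \<alpha> G g' v"
          using True by (simp add: act_def g'_def)
        then show ?thesis using g(3)[of v] True by (simp add: g'_def)
      next
        case False
        have "sum g' (nbrs G v) \<ge> 0" using g(1) by (intro sum_nonneg) (simp add: g'_def)
        then show ?thesis using False \<alpha> by (simp add: act_def g'_def)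
      qed
    qed
  qed
  ultimately show ?thesis using H by blast
qed

text \<open>After enumeration of the vertices the matrix depends only on the order and a relation on
  an initial segment.\<close>

lemma finite_rho_values:
  "finite {rho \<alpha> G | G. simple_graph G \<and> card (pverts G) \<le> N}"
proof -
  define mk where "mk n E = complex_of_real \<alpha> \<cdot>\<^sub>m Matrix.mat n n (\<lambda>(i, j). if i = j then of_nat (card {k. k < n \<and> (i, k) \<in> E}) else 0)
     + complex_of_real (1 - \<alpha>) \<cdot>\<^sub>m Matrix.mat n n (\<lambda>(i, j). if (i, j) \<in> E then 1 else 0)" for n and E :: "(nat \<times> nat) set"
  have "{rho \<alpha> G | G. simple_graph G \<and> card (pverts G) \<le> N}
      \<subseteq> (\<lambda>(n, E). spectral_radius (mk n E)) ` ({..N} \<times> Pow ({..<N} \<times> {..<N}))"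
  proof
    fix x assume "x \<in> {rho \<alpha> G | G. simple_graph G \<and> card (pverts G) \<le> N}"
    then obtain G where x: "x = rho \<alpha> G" and G: "simple_graph G" and n: "card (pverts G) \<le> N" by blast
    define n where "n = card (pverts G)"
    define E where "E = {(i, j). i < n \<and> j < n \<and> (vertex G i, vertex G j) \<in> parcs G}"
    have bij: "bij_betw (vertex G) {..<n} (pverts G)" unfolding n_def by (rule bij_betw_vertex[OF G])
    have deg: "card {k. k < n \<and> (i, k) \<in> E} = card (nbrs G (vertex G i))" if i: "i < n" for i
    proof -
      have "bij_betw (vertex G) {k. k < n \<and> (i, k) \<in> E} (nbrs G (vertex G i))"
      proof (rule bij_betw_imageI)
        show "inj_on (vertex G) {k. k < n \<and> (i, k) \<in> E}"
          using bij by (auto simp: bij_betw_def inj_on_def)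
        show "vertex G ` {k. k < n \<and> (i, k) \<in> E} = nbrs G (vertex G i)"
        proof (intro equalityI subsetI)
          fix w assume w: "w \<in> nbrs G (vertex G i)"
          then have "w \<in> vertex G ` {..<n}" using simple_graphD(4)[OF G] bij by (auto simp: bij_betw_def)
          then obtain k where "k < n" "w = vertex G k" by blast
          then show "w \<in> vertex G ` {k. k < n \<and> (i, k) \<in> E}" using w i by (auto simp: E_def nbrs_def)
        qed (auto simp: E_def nbrs_def)
      qed
      then show ?thesis by (rule bij_betw_same_card)
    qed
    have "A_alpha \<alpha> G = mk n E"
      unfolding A_alpha_def mk_def degree_matrix_def adjacency_matrix_def n_def[symmetric]
      by (intro arg_cong2[where f = "(+)"] arg_cong2[where f = "(\<cdot>\<^sub>m)"] eq_matI)
        (auto simp: out_degree_eq_card_nbrs deg[symmetric] E_def)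
    then have "x = (\<lambda>(n, E). spectral_radius (mk n E)) (n, E)" by (simp add: x rho_def)
    moreover have "(n, E) \<in> {..N} \<times> Pow ({..<N} \<times> {..<N})" using n by (auto simp: n_def E_def)
    ultimately show "x \<in> (\<lambda>(n, E). spectral_radius (mk n E)) ` ({..N} \<times> Pow ({..<N} \<times> {..<N}))" by (rule image_eqI)
  qed
  then show ?thesis by (rule finite_subset) auto
qed

section \<open>The trees P2(Pm, Pn) and paths\<close>

text \<open>The tree as a caterpillar: down P_m from its free end m + 1 to 2, through u = 0 at index
  m, and up P_n from m + 2. Vertex 1 is the only pendant.\<close>

definition spine :: "nat \<Rightarrow> nat \<Rightarrow> nat" where
  "spine m k = (if k < m then m + 1 - k else if k = m then 0 else k + 1)"

definition spine_pendant :: "nat \<Rightarrow> nat \<Rightarrow> nat set" where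
  "spine_pendant m k = (if k = m then {1} else {})"

lemma P2_tree_verts: "pverts (P2_tree m n) = {..<m + n + 2}"
  by (auto simp: P2_tree_def path_from_def)

lemma P2_tree_arcs: "(a, b) \<in> parcs (P2_tree m n) \<longleftrightarrow>
    (b = Suc a \<or> a = Suc b) \<and>
      (a < 2 \<and> b < 2 \<or> 2 \<le> a \<and> a < 2 + m \<and> 2 \<le> b \<and> b < 2 + m
       \<or> m + 2 \<le> a \<and> a < m + 2 + n \<and> m + 2 \<le> b \<and> b < m + 2 + n)
    \<or> a = 0 \<and> (b = 2 \<or> b = m + 2) \<or> b = 0 \<and> (a = 2 \<or> a = m + 2)"
proof -
  have *: "(a, b) \<in> parcs (path_from c l) \<longleftrightarrow> c \<le> a \<and> a < c + l \<and> c \<le> b \<and> b < c + l \<and> (b = Suc a \<or> a = Suc b)" for c l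
    by (simp add: path_from_def)
  show ?thesis unfolding P2_tree_def pair_pre_digraph.simps Un_iff * insert_iff empty_iff prod.inject
    by (simp only: add_0 le0 simp_thms) blast
qed

lemma simple_graph_P2_tree:
  assumes "1 \<le> m" "1 \<le> n"
  shows "simple_graph (P2_tree m n)"
proof (rule simple_graphI)
  fix v w assume "(v, w) \<in> parcs (P2_tree m n)"
  then show "v \<in> pverts (P2_tree m n) \<and> v \<noteq> w \<and> (w, v) \<in> parcs (P2_tree m n)"
    unfolding P2_tree_arcs P2_tree_verts lessThan_iff using assms by auto
qed (auto simp: P2_tree_verts)

lemma is_path_P2_tree:
  assumes "1 \<le> m" "1 \<le> n"
  shows "is_path (P2_tree m n) (spine m) (m + n)"
  unfolding is_path_def
proof (intro conjI allI impI)
  show "inj_on (spine m) {..m + n}" by (auto simp: inj_on_def spine_def split: if_splits)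
  show "spine m 0 \<in> pverts (P2_tree m n)" using assms by (simp add: P2_tree_verts spine_def)
  fix k assume k: "k < m + n"
  consider "Suc k < m" | "Suc k = m" | "k = m" | "m < k" by linarith
  then show "spine m (Suc k) \<in> nbrs (P2_tree m n) (spine m k)"
  proof cases
    case 1
    then have "(m + 1 - k, m - k) \<in> parcs (P2_tree m n)" unfolding P2_tree_arcs by auto
    then show ?thesis using 1 by (simp add: nbrs_def spine_def)
  next
    case 2
    then have "(m + 1 - k, 0) \<in> parcs (P2_tree m n)" unfolding P2_tree_arcs by auto
    then show ?thesis using 2 by (auto simp: nbrs_def spine_def)
  next
    case 3
    have "(0, m + 2) \<in> parcs (P2_tree m n)" unfolding P2_tree_arcs by simp
    then show ?thesis using 3 by (simp add: nbrs_def spine_def)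
  next
    case 4
    then have "(k + 1, k + 2) \<in> parcs (P2_tree m n)" unfolding P2_tree_arcs using k by auto
    then show ?thesis using 4 by (simp add: nbrs_def spine_def)
  qed
qed

lemma one_notin_spine: "1 \<notin> spine m ` {..m + n}"
  by (auto simp: spine_def split: if_splits)

lemma one_in_nbrs: "1 \<le> m \<Longrightarrow> 1 \<le> n \<Longrightarrow> 1 \<in> nbrs (P2_tree m n) (spine m m)"
  by (simp add: nbrs_def P2_tree_arcs spine_def)

lemma pendant_P2_tree:
  assumes "1 \<le> m" "1 \<le> n"
  shows "pendants (P2_tree m n) (spine m) (m + n) (spine_pendant m)"
  using one_notin_spine[of m n] one_in_nbrs[OF assms] assms
  by (auto simp: pendants_def spine_pendant_def)

lemma P2_tree_structure:
  assumes "1 \<le> m" "1 \<le> n"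
  shows "pverts (P2_tree m n) \<subseteq> spine m ` {..m + n} \<union> (\<Union>k\<le>m + n. spine_pendant m k)"
    "nbrs (P2_tree m n) (spine m 0) \<subseteq> {spine m 1}"
    "nbrs (P2_tree m n) (spine m (m + n)) \<subseteq> {spine m (m + n - 1)}"
    "\<And>k. 0 < k \<Longrightarrow> k < m + n \<Longrightarrow>
      nbrs (P2_tree m n) (spine m k) \<subseteq> spine_pendant m k \<union> {spine m (k - 1), spine m (k + 1)}"
    "\<And>k w. k \<le> m + n \<Longrightarrow> w \<in> spine_pendant m k \<Longrightarrow> nbrs (P2_tree m n) w \<subseteq> {spine m k}"
proof -
  show "pverts (P2_tree m n) \<subseteq> spine m ` {..m + n} \<union> (\<Union>k\<le>m + n. spine_pendant m k)"
  proof
    fix v assume "v \<in> pverts (P2_tree m n)"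
    then have v: "v < m + n + 2" by (simp add: P2_tree_verts)
    consider "v = 0" | "v = 1" | "2 \<le> v" "v < m + 2" | "m + 2 \<le> v" by linarith
    then show "v \<in> spine m ` {..m + n} \<union> (\<Union>k\<le>m + n. spine_pendant m k)"
    proof cases
      case 1 then have "v = spine m m" by (simp add: spine_def)
      then show ?thesis by auto
    next
      case 2 then have "v \<in> spine_pendant m m" by (simp add: spine_pendant_def)
      then show ?thesis by auto
    next
      case 3
      then have "v = spine m (m + 1 - v)" by (auto simp: spine_def)
      moreover have "m + 1 - v \<in> {..m + n}" using 3 by auto
      ultimately show ?thesis by blast
    next
      case 4 then have "v = spine m (v - 1)" "v - 1 \<in> {..m + n}" using v by (auto simp: spine_def)
      then show ?thesis by blast
    qed
  qed
  show "nbrs (P2_tree m n) (spine m 0) \<subseteq> {spine m 1}"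
  proof
    fix w assume "w \<in> nbrs (P2_tree m n) (spine m 0)"
    then have "(m + 1, w) \<in> parcs (P2_tree m n)" using assms by (simp add: nbrs_def spine_def)
    then have "w = (if m = 1 then 0 else m)" unfolding P2_tree_arcs using assms by auto
    then show "w \<in> {spine m 1}" using assms by (simp add: spine_def)
  qed
  show "nbrs (P2_tree m n) (spine m (m + n)) \<subseteq> {spine m (m + n - 1)}"
  proof
    fix w assume "w \<in> nbrs (P2_tree m n) (spine m (m + n))"
    then have "(m + n + 1, w) \<in> parcs (P2_tree m n)" using assms by (simp add: nbrs_def spine_def)
    then have "w = (if n = 1 then 0 else m + n)" unfolding P2_tree_arcs using assms by auto
    then show "w \<in> {spine m (m + n - 1)}" using assms by (auto simp: spine_def)
  qed
  show "nbrs (P2_tree m n) w \<subseteq> {spine m k}" if "w \<in> spine_pendant m k" for k w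
  proof
    fix x assume x: "x \<in> nbrs (P2_tree m n) w"
    have wk: "w = 1" "k = m" using that by (auto simp: spine_pendant_def split: if_splits)
    have "(1, x) \<in> parcs (P2_tree m n)" using x wk by (simp add: nbrs_def)
    then have "x = 0" unfolding P2_tree_arcs using assms by auto
    then show "x \<in> {spine m k}" using wk by (simp add: spine_def)
  qed
  show "nbrs (P2_tree m n) (spine m k) \<subseteq> spine_pendant m k \<union> {spine m (k - 1), spine m (k + 1)}"
    if k: "0 < k" "k < m + n" for k
  proof
    fix w assume w: "w \<in> nbrs (P2_tree m n) (spine m k)"
    consider "k < m" | "k = m" | "k > m" by linarith
    then show "w \<in> spine_pendant m k \<union> {spine m (k - 1), spine m (k + 1)}"
    proof cases
      case 1
      then have "(m + 1 - k, w) \<in> parcs (P2_tree m n)" using w by (simp add: nbrs_def spine_def)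
      then have "w = m + 2 - k \<or> w = (if k + 1 = m then 0 else m - k)"
        unfolding P2_tree_arcs using assms 1 by auto
      then show ?thesis using 1 k by (auto simp: spine_def Suc_diff_le)
    next
      case 2
      then have "(0, w) \<in> parcs (P2_tree m n)" using w by (simp add: nbrs_def spine_def)
      then have "w = 1 \<or> w = 2 \<or> w = m + 2" unfolding P2_tree_arcs by auto
      then show ?thesis using 2 assms by (auto simp: spine_def spine_pendant_def)
    next
      case 3
      then have "(k + 1, w) \<in> parcs (P2_tree m n)" using w by (simp add: nbrs_def spine_def)
      then have "w = k + 2 \<or> w = (if k = m + 1 then 0 else k)"
        unfolding P2_tree_arcs using assms 3 by auto
      then show ?thesis using 3 by (auto simp: spine_def split: if_splits)
    qed
  qed
qed

text \<open>Values that stay below their limit are overtaken again and again, which yields a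
  subsequence with strictly increasing values.\<close>

lemma limit_point_from_below:
  assumes G: "\<And>m. simple_graph (G m)" and lim: "(\<lambda>m. rho \<alpha> (G m)) \<longlonglongrightarrow> c"
    and less: "\<And>m. rho \<alpha> (G m) < c"
  shows "is_rho_limit_point \<alpha> c"
proof -
  have next_ex: "\<exists>y>x. rho \<alpha> (G x) < rho \<alpha> (G y)" for x
  proof -
    have "\<forall>\<^sub>F y in sequentially. rho \<alpha> (G x) < rho \<alpha> (G y) \<and> x < y"
      using order_tendstoD(1)[OF lim less[of x]] eventually_gt_at_top[of x] by eventually_elim simp
    then show ?thesis using eventually_happens'[OF trivial_limit_sequentially] by blast
  qed
  have "\<exists>f. \<forall>n. True \<and> (f n < f (Suc n) \<and> rho \<alpha> (G (f n)) < rho \<alpha> (G (f (Suc n))))"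
    by (rule dependent_nat_choice) (use next_ex in auto)
  then obtain f where f: "\<And>n. f n < f (Suc n)" "\<And>n. rho \<alpha> (G (f n)) < rho \<alpha> (G (f (Suc n)))" by blast
  have mono: "strict_mono f" "strict_mono (\<lambda>n. rho \<alpha> (G (f n)))"
    using f by (auto simp: strict_mono_Suc_iff)
  have "(\<lambda>n. rho \<alpha> (G (f n))) \<longlonglongrightarrow> c"
    using LIMSEQ_subseq_LIMSEQ[OF lim mono(1)] by (simp add: o_def)
  moreover have "rho \<alpha> (G (f i)) \<noteq> rho \<alpha> (G (f j))" if "i \<noteq> j" for i j
    using strict_mono_eq[OF mono(2)] that by simp
  ultimately show ?thesis unfolding is_rho_limit_point_def using G by (intro exI[of _ "\<lambda>n. G (f n)"]) blast
qed

text \<open>A limit point would put infinitely many distinct values into the window, but connected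
  graphs of bounded order provide only finitely many.\<close>

lemma no_limit_point:
  assumes \<alpha>: "0 \<le> \<alpha>" "\<alpha> < 1" and c: "lo < c" "c < hi"
    and N: "\<And>H. simple_graph H \<Longrightarrow> connected_graph H \<Longrightarrow> lo < rho \<alpha> H \<Longrightarrow> rho \<alpha> H < hi \<Longrightarrow> card (pverts H) \<le> N"
  shows "\<not> is_rho_limit_point \<alpha> c"
proof
  assume "is_rho_limit_point \<alpha> c"
  then obtain G where G: "\<And>k. simple_graph (G k)" "\<And>i j. i \<noteq> j \<Longrightarrow> rho \<alpha> (G i) \<noteq> rho \<alpha> (G j)"
    "(\<lambda>k. rho \<alpha> (G k)) \<longlonglongrightarrow> c" unfolding is_rho_limit_point_def by blast
  have "\<forall>\<^sub>F k in sequentially. lo < rho \<alpha> (G k) \<and> rho \<alpha> (G k) < hi"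
    using order_tendstoD(1)[OF G(3) c(1)] order_tendstoD(2)[OF G(3) c(2)] by eventually_elim simp
  then obtain k0 where k0: "\<And>k. k \<ge> k0 \<Longrightarrow> lo < rho \<alpha> (G k) \<and> rho \<alpha> (G k) < hi"
    unfolding eventually_sequentially by blast
  have "(\<lambda>k. rho \<alpha> (G k)) ` {k0..} \<subseteq> {rho \<alpha> H | H. simple_graph H \<and> card (pverts H) \<le> N}"
  proof (rule image_subsetI)
    fix k assume k: "k \<in> {k0..}"
    obtain H where H: "simple_graph H" "connected_graph H" "rho \<alpha> H = rho \<alpha> (G k)"
      using connected_subgraph_same_rho[OF G(1) \<alpha>] by blast
    then have "card (pverts H) \<le> N" using N[OF H(1,2)] k0[of k] k by simp
    then show "rho \<alpha> (G k) \<in> {rho \<alpha> H | H. simple_graph H \<and> card (pverts H) \<le> N}"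
      using H by (intro CollectI exI[of _ H]) simp
  qed
  then have "finite ((\<lambda>k. rho \<alpha> (G k)) ` {k0..})" using finite_rho_values finite_subset by blast
  moreover have "inj_on (\<lambda>k. rho \<alpha> (G k)) {k0..}" using G(2) by (auto simp: inj_on_def)
  ultimately have "finite {k0..}" by (rule finite_imageD)
  then show False by (simp add: infinite_Ici)
qed

context alpha_param
begin

lemma alpha_graph: "simple_graph G \<Longrightarrow> alpha_graph G \<alpha> kappa"
  using \<alpha> kappa by unfold_locales

text \<open>The arm P_m is cut to j vertices, and the negative \<open>gap\<close> pays for
  truncating P_n. As m is free, the bound serves both the diagonal trees and those with a fixed
  arm.\<close>

lemma P2_tree_ge:
  assumes t: "sqrt_gamma kappa j < t" "t < 1" and j: "1 \<le> j"
  shows "\<exists>M. \<forall>m n. j \<le> m \<longrightarrow> M \<le> n \<longrightarrow> level \<alpha> t \<le> rho \<alpha> (P2_tree m n)"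
proof -
  have t0: "0 < t" using t(1) sqrt_gamma(1)[OF kappa_nonneg, of j] by simp
  have "gap kappa j t < 0" using gap_sign(1)[OF kappa_nonneg t0 t(2) j] t by simp
  then have "t + 1 / t - kappa - leaf kappa t - arm_ratio kappa t j < t" by (simp add: gap_def)
  from eventually_trunc[OF t0 t(2) this] obtain M0 where
    M0: "\<And>M. M \<ge> M0 \<Longrightarrow> t + 1 / t - kappa - leaf kappa t - arm_ratio kappa t j \<le> trunc t M 1" by blast
  define M where "M = max M0 1"
  have "level \<alpha> t \<le> rho \<alpha> (P2_tree m n)" if mn: "j \<le> m" "M \<le> n" for m n
  proof -
    have mn1: "1 \<le> m" "1 \<le> n" "1 \<le> M" using mn j by (auto simp: M_def)
    interpret alpha_graph "P2_tree m n" \<alpha> kappa by (rule alpha_graph[OF simple_graph_P2_tree[OF mn1(1,2)]])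
    show ?thesis
    proof (rule spur_level_le[OF t0 t(2) mn1(3) j mn(1) is_path_P2_tree[OF mn1(1,2)] _ one_in_nbrs[OF mn1(1,2)] one_notin_spine])
      show "m + M \<le> m + n" using mn by simp
      show "t + 1 / t - kappa - leaf kappa t \<le> arm_ratio kappa t j + trunc t M 1"
        using M0[of M] by (simp add: M_def)
    qed
  qed
  then show ?thesis by blast
qed

lemma P2_tree_le:
  assumes t: "0 < t" and mn: "1 \<le> m" "1 \<le> n"
    and h: "\<And>k. k \<le> m + n \<Longrightarrow> h k > 0"
    and h0: "h 1 \<le> (kappa + (t + 1 / t)) * h 0" "h (m + n - 1) \<le> (kappa + (t + 1 / t)) * h (m + n)"
    and hm: "h (m - 1) + h (m + 1) \<le> (t + 1 / t - (kappa + leaf kappa t)) * h m"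
    and hk: "\<And>k. 0 < k \<Longrightarrow> k < m + n \<Longrightarrow> k \<noteq> m \<Longrightarrow> h (k - 1) + h (k + 1) \<le> (t + 1 / t) * h k"
  shows "rho \<alpha> (P2_tree m n) \<le> level \<alpha> t"
proof -
  interpret alpha_graph "P2_tree m n" \<alpha> kappa by (rule alpha_graph[OF simple_graph_P2_tree[OF mn]])
  show ?thesis
  proof (rule rho_le_level[OF t is_path_P2_tree[OF mn] pendant_P2_tree[OF mn] _ P2_tree_structure[OF mn] h h0])
    fix k assume k: "0 < k" "k < m + n"
    show "h (k - 1) + h (k + 1) \<le> (t + 1 / t - card (spine_pendant m k) * (kappa + leaf kappa t)) * h k"
      using hm hk[OF k] by (cases "k = m") (simp_all add: spine_pendant_def)
  qed (use mn in auto)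
qed

text \<open>Powers of t by distance to u: at u the equation of the limit root is exact, and cutting
  the infinite paths leaves slack at the ends.\<close>

lemma rho_P2_tree_diag_le:
  assumes n: "1 \<le> n"
  shows "rho \<alpha> (P2_tree n n) \<le> level \<alpha> (sqrt_gamma_inf kappa)"
proof -
  define t where "t = sqrt_gamma_inf kappa"
  have t: "0 < t" "t < 1" "1 - t\<^sup>2 - (t + kappa)\<^sup>2 * t\<^sup>2 = 0" using sqrt_gamma_inf[OF kappa_nonneg] by (auto simp: t_def)
  have "t * (t * (t + kappa) + 1) > 0" using t kappa_nonneg by (intro mult_pos_pos add_nonneg_pos) auto
  moreover have "(t + 1 / t - (kappa + leaf kappa t + 2 * t)) * (t * (t * (t + kappa) + 1)) = 0"
    unfolding limit_defect[OF kappa_nonneg t(1)] by (rule t(3))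
  ultimately have "t + 1 / t - (kappa + leaf kappa t + 2 * t) = 0"
    by (metis less_irrefl mult_eq_0_iff)
  then have eq: "t + 1 / t - (kappa + leaf kappa t) = 2 * t" by simp
  define h where "h k = t ^ (if k \<le> n then n - k else k - n)" for k
  have step: "t ^ e + t ^ Suc (Suc e) = (t + 1 / t) * t ^ Suc e" for e using t by (simp add: field_simps)
  have pre: "t ^ e \<le> (kappa + (t + 1 / t)) * t ^ Suc e" for e
  proof -
    have "(kappa + (t + 1 / t)) * t ^ Suc e = kappa * t ^ Suc e + (t ^ e + t ^ Suc (Suc e))" unfolding step by (simp add: algebra_simps)
    moreover have "kappa * t ^ Suc e \<ge> 0" "t ^ Suc (Suc e) \<ge> 0" using t kappa_nonneg by auto
    ultimately show ?thesis by linarith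
  qed
  obtain e where e: "n = Suc e" using n by (cases n) auto
  have "rho \<alpha> (P2_tree n n) \<le> level \<alpha> t"
  proof (rule P2_tree_le[OF t(1) n n, of h])
    show "h k > 0" for k using t by (simp add: h_def)
    show "h 1 \<le> (kappa + (t + 1 / t)) * h 0" using pre[of e] by (cases e) (simp_all add: h_def e)
    show "h (n + n - 1) \<le> (kappa + (t + 1 / t)) * h (n + n)" using pre[of e] by (cases e) (simp_all add: h_def e)
    show "h (n - 1) + h (n + 1) \<le> (t + 1 / t - (kappa + leaf kappa t)) * h n"
      unfolding eq by (simp add: h_def e)
    fix k assume k: "0 < k" "k < n + n" "k \<noteq> n"
    show "h (k - 1) + h (k + 1) \<le> (t + 1 / t) * h k"
    proof (cases "k < n")
      case True
      then have "n - k = Suc (n - Suc k)" "n - (k - 1) = Suc (Suc (n - Suc k))" "n - (k + 1) = n - Suc k"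
        "k - 1 \<le> n" "k + 1 \<le> n" "k \<le> n" using k by auto
      then show ?thesis using step[of "n - Suc k"] unfolding h_def by simp
    next
      case False
      define d where "d = k - n - 1"
      have d: "k = n + Suc d" using False k by (simp add: d_def)
      then have "k + 1 - n = Suc (Suc d)" "k - n = Suc d" "\<not> k + 1 \<le> n" "\<not> k \<le> n" by auto
      moreover have "h (k - 1) = t ^ d" by (cases d) (simp_all add: h_def d)
      ultimately show ?thesis using step[of d] unfolding h_def by simp
    qed
  qed
  then show ?thesis by (simp add: t_def)
qed

text \<open>By continuity the parameter can leave a root to the right while its level stays above c;
  there \<open>gap\<close> is strictly negative.\<close>

lemma level_approx_right:
  assumes "0 < s" "s < u" "c < level \<alpha> s"
  shows "\<exists>t. s < t \<and> t < u \<and> c < level \<alpha> t"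
proof -
  have "isCont (level \<alpha>) s" unfolding level_def using assms(1) by (intro continuous_intros) auto
  then have "(level \<alpha> \<longlongrightarrow> level \<alpha> s) (at_right s)" by (simp add: isCont_def filterlim_at_split)
  then have "\<forall>\<^sub>F t in at_right s. c < level \<alpha> t" using assms(3) by (rule order_tendstoD)
  moreover have "\<forall>\<^sub>F t in at_right s. t \<in> {s<..<u}" using assms(2) by (rule eventually_at_right_real)
  ultimately have "\<forall>\<^sub>F t in at_right s. s < t \<and> t < u \<and> c < level \<alpha> t" by eventually_elim auto
  then show ?thesis using eventually_happens'[OF trivial_limit_at_right_real] by blast
qed

lemma level_approx_left:
  assumes "0 < s" "level \<alpha> s < c"
  shows "\<exists>t. 0 < t \<and> t < s \<and> level \<alpha> t < c"
proof -
  have "isCont (level \<alpha>) s" unfolding level_def using assms(1) by (intro continuous_intros) auto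
  then have "(level \<alpha> \<longlongrightarrow> level \<alpha> s) (at_left s)" by (simp add: isCont_def filterlim_at_split)
  then have "\<forall>\<^sub>F t in at_left s. level \<alpha> t < c" using assms(2) by (rule order_tendstoD)
  moreover have "\<forall>\<^sub>F t in at_left s. t \<in> {0<..<s}" using assms(1) by (rule eventually_at_left_real)
  ultimately have "\<forall>\<^sub>F t in at_left s. 0 < t \<and> t < s \<and> level \<alpha> t < c" by eventually_elim auto
  then show ?thesis using eventually_happens'[OF trivial_limit_at_left_real] by blast
qed

lemma rho_P2_tree_diag_tendsto: "(\<lambda>n. rho \<alpha> (P2_tree (Suc n) (Suc n))) \<longlonglongrightarrow> level \<alpha> (sqrt_gamma_inf kappa)"
proof (rule order_tendstoI)
  fix a assume a: "level \<alpha> (sqrt_gamma_inf kappa) < a"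
  have "rho \<alpha> (P2_tree (Suc n) (Suc n)) < a" for n using rho_P2_tree_diag_le[of "Suc n"] a by simp
  then show "\<forall>\<^sub>F n in sequentially. rho \<alpha> (P2_tree (Suc n) (Suc n)) < a" by simp
next
  fix a assume a: "a < level \<alpha> (sqrt_gamma_inf kappa)"
  obtain t where t: "sqrt_gamma_inf kappa < t" "t < 1" "a < level \<alpha> t"
    using level_approx_right[OF sqrt_gamma_inf(1,2)[OF kappa_nonneg] a] by blast
  obtain j where j: "1 \<le> j" "sqrt_gamma kappa j < t"
    using eventually_conj[OF eventually_sqrt_gamma_less[OF kappa_nonneg t(1)] eventually_ge_at_top[of 1]]
    by (auto dest!: eventually_happens)
  obtain M where M: "\<And>m n. j \<le> m \<Longrightarrow> M \<le> n \<Longrightarrow> level \<alpha> t \<le> rho \<alpha> (P2_tree m n)"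
    using P2_tree_ge[OF j(2) t(2) j(1)] by blast
  have "a < rho \<alpha> (P2_tree (Suc n) (Suc n))" if "max j M \<le> n" for n
    using M[of "Suc n" "Suc n"] t(3) that by simp
  then show "\<forall>\<^sub>F n in sequentially. a < rho \<alpha> (P2_tree (Suc n) (Suc n))"
    unfolding eventually_sequentially by blast
qed

text \<open>
  At the root, truncating the infinite path leaves strict slack in the equation at the branching
  vertex; by continuity the supersolution survives at a slightly larger \<open>t\<close>, that is, at a lower level.
\<close>

lemma rho_P2_tree_less:
  assumes n: "1 \<le> n" "sqrt_gamma kappa n < 1" and m: "1 \<le> m"
  shows "rho \<alpha> (P2_tree n m) < level \<alpha> (sqrt_gamma kappa n)"
proof -
  define s where "s = sqrt_gamma kappa n"
  have s: "0 < s" "s < 1" using sqrt_gamma(1)[OF kappa_nonneg, of n] n by (auto simp: s_def)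
  \<comment> \<open>The slack at the branching vertex with the infinite path truncated. The zero is
    placed at distance \<open>Suc m\<close>, one step past the last vertex, so that the recurrence
    yields the end condition.\<close>
  define F where "F t = gap kappa n t + t - trunc t (Suc m) 1" for t
  have ap: "arm kappa s n \<noteq> 0" using arm_pos[OF kappa_nonneg s, of n] by simp
  have lp: "s * (s + kappa) + 1 \<noteq> 0"
    using s kappa_nonneg by (metis add_nonneg_pos less_eq_real_def less_numeral_extra(1,3) mult_nonneg_nonneg add_nonneg_nonneg)
  have tp: "1 - s ^ (2 * Suc m) \<noteq> 0" using s power_less_one_iff[of s "2 * Suc m"] by simp
  have "isCont F s"
    unfolding F_def gap_def arm_ratio_def leaf_def trunc_def arm_def
    using s ap[unfolded arm_def] lp tp by (simp; intro continuous_intros; simp)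
  moreover have "F s > 0"
    using gap_sign(3)[OF kappa_nonneg s n(1)] trunc_1_less[OF s, of "Suc m"] by (simp add: F_def s_def)
  ultimately have "\<forall>\<^sub>F t in at_right s. F t > 0"
    by (intro order_tendstoD(1)[where y = "F s"]) (simp_all add: isCont_def filterlim_at_split)
  moreover have "\<forall>\<^sub>F t in at_right s. t \<in> {s<..<1}" using s(2) by (rule eventually_at_right_real)
  ultimately have "\<forall>\<^sub>F t in at_right s. F t > 0 \<and> s < t \<and> t < 1" by eventually_elim auto
  then obtain t where t: "F t > 0" "s < t" "t < 1"
    using eventually_happens'[OF trivial_limit_at_right_real] by blast
  have t0: "0 < t" using t s by simp
  define h where "h k = (if k \<le> n then arm kappa t k / arm kappa t n else trunc t (Suc m) (k - n))" for k
  have a: "arm kappa t k > 0" for k by (rule arm_pos[OF kappa_nonneg t0 t(3)])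
  have hge: "h k = trunc t (Suc m) (k - n)" if "n \<le> k" for k
    using that a[of n] trunc_0[OF t0 t(3), of "Suc m"] by (cases "k = n") (auto simp: h_def)
  have "rho \<alpha> (P2_tree n m) \<le> level \<alpha> t"
  proof (rule P2_tree_le[OF t0 n(1) m, of h])
    show "h k > 0" if "k \<le> n + m" for k using a[of k] a[of n] trunc_pos[OF t0 t(3), of "k - n" "Suc m"] that by (auto simp: h_def)
    show "h 1 \<le> (kappa + (t + 1 / t)) * h 0" using n arm_1[OF t0, of kappa] by (simp add: h_def)
    have "trunc t (Suc m) (m - 1) + trunc t (Suc m) (m + 1) = (t + 1 / t) * trunc t (Suc m) m"
      using trunc_rec[OF t0 m, of "Suc m"] by simp
    then have "trunc t (Suc m) (m - 1) = (t + 1 / t) * trunc t (Suc m) m" by (simp add: trunc_end)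
    moreover have "kappa * trunc t (Suc m) m \<ge> 0" using kappa_nonneg trunc_nonneg[OF t0 t(3)] by simp
    moreover have "h (n + m - 1) = trunc t (Suc m) (m - 1)" "h (n + m) = trunc t (Suc m) m"
      using hge[of "n + m - 1"] hge[of "n + m"] m by auto
    ultimately show "h (n + m - 1) \<le> (kappa + (t + 1 / t)) * h (n + m)" by (simp add: distrib_right)
    have "h (n - 1) = arm_ratio kappa t n" "h n = 1" "h (n + 1) = trunc t (Suc m) 1"
      using a[of n] by (auto simp: h_def arm_ratio_def)
    then show "h (n - 1) + h (n + 1) \<le> (t + 1 / t - (kappa + leaf kappa t)) * h n"
      using t(1) by (simp add: F_def gap_def)
    fix k assume k: "0 < k" "k < n + m" "k \<noteq> n"
    show "h (k - 1) + h (k + 1) \<le> (t + 1 / t) * h k"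
    proof (cases "k < n")
      case True
      then have "k - Suc 0 \<le> n" by simp
      then show ?thesis using True arm_rec[OF t0, of kappa "k - 1"] k
        by (simp add: h_def add_divide_distrib[symmetric])
    next
      case False
      then have "n \<le> k - 1" "n \<le> k" "n \<le> k + 1" "k - 1 - n = k - n - 1" "k + 1 - n = k - n + 1"
        "1 \<le> k - n" "k - n < Suc m" using k by auto
      then show ?thesis using trunc_rec[OF t0, of "k - n" "Suc m"] hge by simp
    qed
  qed
  also have "\<dots> < level \<alpha> s" using level_strict_antimono[OF \<alpha>(2) s(1) t(2)] t(3) by simp
  finally show ?thesis by (simp add: s_def)
qed

lemma rho_P2_tree_tendsto:
  assumes n: "1 \<le> n" "sqrt_gamma kappa n < 1"
  shows "(\<lambda>m. rho \<alpha> (P2_tree n (Suc m))) \<longlonglongrightarrow> level \<alpha> (sqrt_gamma kappa n)"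
proof (rule order_tendstoI)
  fix a assume a: "level \<alpha> (sqrt_gamma kappa n) < a"
  have "rho \<alpha> (P2_tree n (Suc m)) < a" for m using rho_P2_tree_less[OF n, of "Suc m"] a by simp
  then show "\<forall>\<^sub>F m in sequentially. rho \<alpha> (P2_tree n (Suc m)) < a" by simp
next
  fix a assume a: "a < level \<alpha> (sqrt_gamma kappa n)"
  obtain t where t: "sqrt_gamma kappa n < t" "t < 1" "a < level \<alpha> t"
    using level_approx_right[OF sqrt_gamma(1)[OF kappa_nonneg] n(2) a] by blast
  obtain M where M: "\<And>m' m. n \<le> m' \<Longrightarrow> M \<le> m \<Longrightarrow> level \<alpha> t \<le> rho \<alpha> (P2_tree m' m)"
    using P2_tree_ge[OF t(1,2) n(1)] by blast
  have "a < rho \<alpha> (P2_tree n (Suc m))" if "M \<le> m" for m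
    using M[of n "Suc m"] t(3) that by simp
  then show "\<forall>\<^sub>F m in sequentially. a < rho \<alpha> (P2_tree n (Suc m))"
    unfolding eventually_sequentially by blast
qed

section \<open>Paths and the limit point 2\<close>

lemma simple_graph_path: "simple_graph (path_from a (Suc n))"
  by (rule simple_graphI) (auto simp: path_from_def)

lemma is_path_path: "is_path (path_from 0 (Suc K)) id K"
  by (auto simp: is_path_def path_from_def nbrs_def)

text \<open>The sine has its zeros one step beyond either end of the K + 1 vertices; it is an
  eigenfunction for kappa = 0 and a supersolution for kappa \<ge> 0.\<close>

lemma rho_path_less:
  assumes K: "1 \<le> K"
  shows "rho \<alpha> (path_from 0 (Suc K)) < 2"
proof -
  let ?G = "path_from 0 (Suc K)"
  define \<theta> where "\<theta> = pi / (K + 2)"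
  have "0 < \<theta>" by (simp add: \<theta>_def add_nonneg_pos)
  moreover have "\<theta> \<le> pi / 3" unfolding \<theta>_def using K by (intro divide_left_mono) auto
  ultimately have th: "0 < \<theta>" "\<theta> \<le> pi / 3" .
  have "cos (pi / 3) \<le> cos \<theta>" using th by (intro cos_monotone_0_pi_le) auto
  then have c: "cos \<theta> > 0" by (simp add: cos_60)
  have c1: "cos \<theta> < 1" using cos_monotone_0_pi[of 0 \<theta>] th pi_gt_zero by simp
  define h where "h k = sin ((k + 1) * \<theta>)" for k :: nat
  have pos: "h k > 0" if "k \<le> K" for k
  proof -
    have "(k + 1) * \<theta> < (K + 2) * \<theta>" using that th by (intro mult_strict_right_mono) auto
    also have "\<dots> = pi" by (simp add: \<theta>_def)
    finally show ?thesis unfolding h_def using th by (intro sin_gt_zero) auto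
  qed
  have rec: "h (k - 1) + h (k + 1) = 2 * cos \<theta> * h k" if "0 < k" for k
  proof -
    define x where "x = (real k + 1) * \<theta>"
    have "real (k - 1 + 1) * \<theta> = x - \<theta>" "real (k + 1 + 1) * \<theta> = x + \<theta>" "real (k + 1) * \<theta> = x"
      using that by (auto simp: x_def of_nat_diff algebra_simps)
    then have "h (k - 1) = sin (x - \<theta>)" "h (k + 1) = sin (x + \<theta>)" "h k = sin x" by (simp_all only: h_def)
    then show ?thesis by (simp add: sin_add sin_diff)
  qed
  have h1: "h 1 = 2 * cos \<theta> * h 0" using sin_double[of \<theta>] by (simp add: h_def)
  have "h (K + 1) = sin (pi)" unfolding h_def by (rule arg_cong[where f = sin]) (simp add: \<theta>_def field_simps)
  then have hK: "h (K - 1) = 2 * cos \<theta> * h K" using rec[of K] K by simp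
  interpret alpha_graph ?G \<alpha> kappa by (rule alpha_graph[OF simple_graph_path])
  have "rho \<alpha> ?G \<le> (1 - \<alpha>) * (2 * kappa + 2 * cos \<theta>)"
  proof (rule caterpillar_le[OF is_path_path[of K], of "\<lambda>_. {}" _ h])
    show "pendants ?G id K (\<lambda>_. {})" by (simp add: pendants_def)
    show "0 < K" using K by simp
    show "pverts ?G \<subseteq> id ` {..K} \<union> (\<Union>k\<le>K. {})" by (auto simp: path_from_def)
    show "kappa + 2 * cos \<theta> > 0" using c kappa_nonneg by simp
    show "h 1 \<le> (kappa + 2 * cos \<theta>) * h 0" "h (K - 1) \<le> (kappa + 2 * cos \<theta>) * h K"
      unfolding h1 hK using kappa_nonneg pos[of 0] pos[of K] by (simp_all add: distrib_right)
    show "nbrs ?G (id k) \<subseteq> {} \<union> {id (k - 1), id (k + 1)}" for k by (auto simp: path_from_def nbrs_def)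
    show "nbrs ?G (id 0) \<subseteq> {id 1}" "nbrs ?G (id K) \<subseteq> {id (K - 1)}" by (auto simp: path_from_def nbrs_def)
  qed (use pos rec in auto)
  also have "\<dots> < (1 - \<alpha>) * (2 * kappa + 2)" using c1 \<alpha> by simp
  also have "\<dots> = 2" using \<alpha> by (simp add: kappa field_simps)
  finally show ?thesis .
qed

lemma path_bound_tendsto: "(\<lambda>K. (1 - \<alpha>) * (2 * kappa + 2 * cos (pi / real K))) \<longlonglongrightarrow> 2"
proof -
  have "(\<lambda>K. pi / real K) \<longlonglongrightarrow> 0" by (rule lim_const_over_n)
  then have "(\<lambda>K. (1 - \<alpha>) * (2 * kappa + 2 * cos (pi / real K))) \<longlonglongrightarrow> (1 - \<alpha>) * (2 * kappa + 2 * cos 0)"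
    by (intro tendsto_intros)
  moreover have "(1 - \<alpha>) * (2 * kappa + 2 * cos 0) = 2" using \<alpha> by (simp add: kappa field_simps)
  ultimately show ?thesis by simp
qed

lemma rho_path_tendsto: "(\<lambda>K. rho \<alpha> (path_from 0 (K + 2))) \<longlonglongrightarrow> 2"
proof (rule tendsto_sandwich[OF _ _ LIMSEQ_ignore_initial_segment[OF path_bound_tendsto, of 1] tendsto_const[of 2]])
  have "rho \<alpha> (path_from 0 (K + 2)) \<le> 2" for K using rho_path_less[of "K + 1"] by simp
  then show "\<forall>\<^sub>F K in sequentially. rho \<alpha> (path_from 0 (K + 2)) \<le> 2" by simp
  have "(1 - \<alpha>) * (2 * kappa + 2 * cos (pi / real (K + 1))) \<le> rho \<alpha> (path_from 0 (K + 2))" if "2 \<le> K" for K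
  proof -
    interpret alpha_graph "path_from 0 (Suc (K + 1))" \<alpha> kappa by (rule alpha_graph[OF simple_graph_path])
    show ?thesis using path_cos_le[OF is_path_path] that by simp
  qed
  then show "\<forall>\<^sub>F K in sequentially. (1 - \<alpha>) * (2 * kappa + 2 * cos (pi / real (K + 1))) \<le> rho \<alpha> (path_from 0 (K + 2))"
    unfolding eventually_sequentially by blast
qed

section \<open>Limit points\<close>

text \<open>Choosing t below \<open>sqrt_gamma kappa 1\<close> yields the last condition, since
  \<open>spectral_sum kappa 1 t\<close> is (t(t + kappa))^2.\<close>

lemma exists_above_limit:
  assumes c: "c < level \<alpha> (sqrt_gamma_inf kappa)"
  obtains t where "above_limit kappa t" "c < level \<alpha> t"
proof -
  obtain t where t: "sqrt_gamma_inf kappa < t" "t < sqrt_gamma kappa 1" "c < level \<alpha> t"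
    using level_approx_right[OF sqrt_gamma_inf(1)[OF kappa_nonneg] sqrt_gamma_inf_less_sqrt_gamma[OF kappa_nonneg] c] by blast
  have t0: "0 < t" "t < 1" using t sqrt_gamma_inf(1)[OF kappa_nonneg] sqrt_gamma(2)[OF kappa_nonneg, of 1] by auto
  have "spectral_sum kappa 1 t < 1" using spectral_sum_less_1_iff(1)[OF kappa_nonneg t0(1), of 1] t by simp
  then have "(t * (t + kappa))\<^sup>2 < 1" by (simp add: spectral_sum_def power_mult_distrib mult.commute)
  then have "t * (t + kappa) \<le> 1" by (simp add: abs_square_less_1 abs_less_iff)
  then have "above_limit kappa t" using above_sqrt_gamma_inf[OF kappa_nonneg t(1)] t0 by (simp add: above_limit_def)
  then show ?thesis using t(3) by (rule that)
qed

lemma long_path_in_large_graph: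
  assumes H: "simple_graph H" "connected_graph H" and t: "above_limit kappa t" and low: "rho \<alpha> H < level \<alpha> t"
    and big: "5 ^ B < card (pverts H)"
  obtains p K where "is_path H p K" "B \<le> K" "\<And>q. \<not> is_path H q (Suc K)"
proof -
  interpret alpha_graph H \<alpha> kappa by (rule alpha_graph[OF H(1)])
  have "card (nbrs H v) \<le> 4" for v
    using degree_level_le[OF t, of v] low by (cases "5 \<le> card (nbrs H v)") auto
  then show ?thesis using long_path_exists[OF H(2), of 4 B] big that by auto
qed

text \<open>Below \<Psi>(\<alpha>) degrees are at most 4, so a large connected graph contains a long
  path and its spectral radius is nearly 2 or more. The lower end of the window is
  arbitrary.\<close>

lemma limit_point_ge_2:
  assumes c: "c < level \<alpha> (sqrt_gamma_inf kappa)" "c < 2"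
  shows "\<not> is_rho_limit_point \<alpha> c"
proof -
  obtain t where t: "above_limit kappa t" "c < level \<alpha> t" using exists_above_limit[OF c(1)] .
  define hi where "hi = min (level \<alpha> t) ((c + 2) / 2)"
  have hi: "c < hi" "hi < 2" "hi \<le> level \<alpha> t" using c(2) t(2) by (auto simp: hi_def min_less_iff_disj)
  obtain B where B: "\<And>K. B \<le> K \<Longrightarrow> hi < (1 - \<alpha>) * (2 * kappa + 2 * cos (pi / real K))"
    using order_tendstoD(1)[OF path_bound_tendsto hi(2)] unfolding eventually_sequentially by blast
  show ?thesis
  proof (rule no_limit_point[OF \<alpha> _ hi(1), of "c - 1" "5 ^ (max B 3)"])
    fix H assume H: "simple_graph H" "connected_graph H" "rho \<alpha> H < hi"
    interpret alpha_graph H \<alpha> kappa by (rule alpha_graph[OF H(1)])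
    show "card (pverts H) \<le> 5 ^ (max B 3)"
    proof (rule ccontr)
      assume "\<not> card (pverts H) \<le> 5 ^ (max B 3)"
      then have "5 ^ (max B 3) < card (pverts H)" by simp
      from long_path_in_large_graph[OF H(1,2) t(1) _ this] obtain p K
        where p: "is_path H p K" "max B 3 \<le> K" using H(3) hi(3) by (metis less_le_trans)
      then show False using path_cos_le[OF p(1)] B[of K] H(3) by simp
    qed
  qed simp
qed

text \<open>The window has the level of s as its lower end and the smaller of the levels of t and t'
  as its upper end. A large connected graph inside would contradict \<open>rho_bound\<close>; the
  maximum with 2 there is harmless, as s < 1 has level above 2.\<close>

lemma limit_point_between:
  assumes c: "2 \<le> c" "c < level \<alpha> (sqrt_gamma_inf kappa)"
    and n: "level \<alpha> (sqrt_gamma kappa n) < c" "c < level \<alpha> (sqrt_gamma kappa (Suc n))"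
  shows "\<not> is_rho_limit_point \<alpha> c"
proof -
  obtain t where t: "above_limit kappa t" "c < level \<alpha> t" using exists_above_limit[OF c(2)] .
  have r1: "sqrt_gamma kappa (Suc n) < 1"
    using sqrt_gamma(2)[OF kappa_nonneg, of "Suc n"] n(2) c(1) level_1[of \<alpha>]
    by (cases "sqrt_gamma kappa (Suc n) = 1") auto
  obtain t' where t': "sqrt_gamma kappa (Suc n) < t'" "t' < 1" "c < level \<alpha> t'"
    using level_approx_right[OF sqrt_gamma(1)[OF kappa_nonneg] r1 n(2)] by blast
  have t'0: "0 < t'" using t'(1) sqrt_gamma(1)[OF kappa_nonneg, of "Suc n"] by simp
  obtain s where s: "0 < s" "s < sqrt_gamma kappa n" "level \<alpha> s < c"
    using level_approx_left[OF sqrt_gamma(1)[OF kappa_nonneg] n(1)] by blast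
  have s1: "s < 1" using s(2) sqrt_gamma(2)[OF kappa_nonneg, of n] by simp
  have ls: "2 < level \<alpha> s" using level_strict_antimono[OF \<alpha>(2) s(1) s1] level_1 by simp
  have "gap kappa (Suc n) t' < 0" using gap_sign(1)[OF kappa_nonneg t'0 t'(2), of "Suc n"] t'(1) by simp
  then have "t' + 1 / t' - kappa - leaf kappa t' - arm_ratio kappa t' (Suc n) < t'" by (simp add: gap_def)
  from eventually_trunc[OF t'0 t'(2) this] obtain M1 where
    M1: "\<And>M. M1 \<le> M \<Longrightarrow> t' + 1 / t' - kappa - leaf kappa t' - arm_ratio kappa t' (Suc n) \<le> trunc t' M 1" by blast
  obtain M2 where M2: "\<And>M. M2 \<le> M \<Longrightarrow> long_arm kappa t M" using exists_long_arm[OF kappa_nonneg t(1)] by blast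
  define M where "M = max M1 M2"
  have arms: "long_arm kappa t M" "t' + 1 / t' - kappa - leaf kappa t' \<le> arm_ratio kappa t' (Suc n) + trunc t' M 1"
    using M1[of M] M2[of M] by (auto simp: M_def)
  obtain L0 where L0: "\<And>L. 1 \<le> n \<Longrightarrow> L0 \<le> L \<Longrightarrow>
      arm_ratio kappa s n + (s + s ^ (L - 1)) / (1 + s ^ L) \<le> s + 1 / s - kappa - leaf kappa s"
  proof (cases "1 \<le> n")
    case True
    show ?thesis using exists_profile_length[OF kappa_nonneg s(1) True s(2)] that by blast
  next
    case False
    \<comment> \<open>For n = 0 the condition on s is vacuous, so any L0 will do.\<close>
    then show ?thesis using that[of 0] by simp
  qed
  define B where "B = 2 * M + 2 * n + L0 + 1"
  show ?thesis
  proof (rule no_limit_point[OF \<alpha> s(3), of "min (level \<alpha> t) (level \<alpha> t')" "5 ^ B"])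
    show "c < min (level \<alpha> t) (level \<alpha> t')" using t t' by simp
    fix H assume H: "simple_graph H" "connected_graph H" "level \<alpha> s < rho \<alpha> H" "rho \<alpha> H < min (level \<alpha> t) (level \<alpha> t')"
    have upper: "rho \<alpha> H < level \<alpha> t" "rho \<alpha> H < level \<alpha> t'" using H(4) by auto
    interpret alpha_graph H \<alpha> kappa by (rule alpha_graph[OF H(1)])
    show "card (pverts H) \<le> 5 ^ B"
    proof (rule ccontr)
      assume "\<not> card (pverts H) \<le> 5 ^ B"
      then have "5 ^ B < card (pverts H)" by simp
      from long_path_in_large_graph[OF H(1,2) t(1) upper(1) this] obtain p K
        where path: "is_path H p K" "B \<le> K" "\<And>q. \<not> is_path H q (Suc K)" by blast
      interpret longest_path H \<alpha> kappa t M p K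
        using t(1) arms(1) upper(1) path by unfold_locales auto
      have "rho \<alpha> H \<le> max 2 (level \<alpha> s)"
        by (rule rho_bound[OF H(2) t'0 t'(2) upper(2) arms(2) s(1) s1 L0 path(2)[unfolded B_def]])
      then show False using H(3) ls by simp
    qed
  qed
qed

lemma level_sqrt_gamma_tendsto: "(\<lambda>n. level \<alpha> (sqrt_gamma kappa n)) \<longlonglongrightarrow> level \<alpha> (sqrt_gamma_inf kappa)"
  unfolding level_def using sqrt_gamma_inf(1)[OF kappa_nonneg]
  by (intro tendsto_intros sqrt_gamma_tendsto[OF kappa_nonneg]) auto

lemma level_sqrt_gamma_Suc_less:
  assumes "n \<ge> 1 \<or> kappa > 0"
  shows "level \<alpha> (sqrt_gamma kappa n) < level \<alpha> (sqrt_gamma kappa (Suc n))"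
  using level_strict_antimono[OF \<alpha>(2) sqrt_gamma(1)[OF kappa_nonneg] sqrt_gamma_Suc_less[OF kappa_nonneg assms] sqrt_gamma(2)[OF kappa_nonneg]] .

lemma level_sqrt_gamma_0: "level \<alpha> (sqrt_gamma kappa 0) = 2"
  by (simp add: sqrt_gamma_def level_1)

text \<open>When the root is 1, that is for n = 0, or n = 1 with kappa = 0, paths take over from the
  trees P_2(P_n, P_m).\<close>

lemma level_sqrt_gamma_infit_point: "is_rho_limit_point \<alpha> (level \<alpha> (sqrt_gamma kappa n))"
proof (cases "n \<ge> 1 \<and> sqrt_gamma kappa n < 1")
  case True
  show ?thesis
  proof (rule limit_point_from_below)
    show "simple_graph (P2_tree n (Suc m))" for m using True by (intro simple_graph_P2_tree) auto
    show "(\<lambda>m. rho \<alpha> (P2_tree n (Suc m))) \<longlonglongrightarrow> level \<alpha> (sqrt_gamma kappa n)"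
      using True by (intro rho_P2_tree_tendsto) auto
    show "rho \<alpha> (P2_tree n (Suc m)) < level \<alpha> (sqrt_gamma kappa n)" for m
      using True by (intro rho_P2_tree_less) auto
  qed
next
  case False
  then have "sqrt_gamma kappa n = 1" using sqrt_gamma(2)[OF kappa_nonneg, of n] by (cases n) (auto simp: sqrt_gamma_def)
  moreover have "is_rho_limit_point \<alpha> 2"
  proof (rule limit_point_from_below[OF _ rho_path_tendsto])
    show "simple_graph (path_from 0 (m + 2))" for m using simple_graph_path[of 0 "Suc m"] by simp
    show "rho \<alpha> (path_from 0 (m + 2)) < 2" for m using rho_path_less[of "Suc m"] by simp
  qed
  ultimately show ?thesis by (simp add: level_1)
qed

lemma level_sqrt_gamma_less_limit: "level \<alpha> (sqrt_gamma kappa n) < level \<alpha> (sqrt_gamma_inf kappa)"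
  by (rule level_strict_antimono[OF \<alpha>(2) sqrt_gamma_inf(1)[OF kappa_nonneg] sqrt_gamma_inf_less_sqrt_gamma[OF kappa_nonneg] sqrt_gamma(2)[OF kappa_nonneg]])

lemma limit_points_below:
  "{c. is_rho_limit_point \<alpha> c \<and> c < level \<alpha> (sqrt_gamma_inf kappa)} = range (\<lambda>n. level \<alpha> (sqrt_gamma kappa n))"
proof (intro equalityI subsetI)
  fix c assume "c \<in> range (\<lambda>n. level \<alpha> (sqrt_gamma kappa n))"
  then show "c \<in> {c. is_rho_limit_point \<alpha> c \<and> c < level \<alpha> (sqrt_gamma_inf kappa)}"
    using level_sqrt_gamma_infit_point level_sqrt_gamma_less_limit by auto
next
  fix c assume "c \<in> {c. is_rho_limit_point \<alpha> c \<and> c < level \<alpha> (sqrt_gamma_inf kappa)}"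
  then have c: "is_rho_limit_point \<alpha> c" "c < level \<alpha> (sqrt_gamma_inf kappa)" by auto
  show "c \<in> range (\<lambda>n. level \<alpha> (sqrt_gamma kappa n))"
  proof (rule ccontr)
    assume no: "c \<notin> range (\<lambda>n. level \<alpha> (sqrt_gamma kappa n))"
    have c2: "2 \<le> c" using limit_point_ge_2[OF c(2)] c(1) by fastforce
    obtain m where "c < level \<alpha> (sqrt_gamma kappa m)"
      using eventually_happens'[OF trivial_limit_sequentially order_tendstoD(1)[OF level_sqrt_gamma_tendsto c(2)]] by blast
    \<comment> \<open>The least index whose level exceeds c is not 0, because that level is 2 \<le>
      c; with its predecessor it brackets c strictly.\<close>
    then have least: "c < level \<alpha> (sqrt_gamma kappa (LEAST m. c < level \<alpha> (sqrt_gamma kappa m)))" by (rule LeastI)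
    obtain n where n: "(LEAST m. c < level \<alpha> (sqrt_gamma kappa m)) = Suc n"
      using least c2 level_sqrt_gamma_0 by (cases "LEAST m. c < level \<alpha> (sqrt_gamma kappa m)") auto
    have "\<not> c < level \<alpha> (sqrt_gamma kappa n)" using not_less_Least[of n "\<lambda>m. c < level \<alpha> (sqrt_gamma kappa m)"] n by simp
    moreover have "c \<noteq> level \<alpha> (sqrt_gamma kappa n)" using no by auto
    ultimately show False using limit_point_between[OF c2 c(2), of n] least n c(1) by simp
  qed
qed

end

theorem theorem2p1:
  fixes \<alpha> :: real
  assumes "0 \<le> \<alpha>" and "\<alpha> < 1"
  shows "(\<forall>n\<ge>1. \<exists>!x. x > 0 \<and> Phi n \<alpha> x = 0)
    \<and> gamma_root 1 \<alpha> \<in> {0<..1} \<and> (\<forall>n\<ge>2. gamma_root n \<alpha> \<in> {0<..<1})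
    \<and> (\<alpha> = 0 \<longrightarrow> eta 0 \<alpha> = 2 \<and> eta 1 \<alpha> = 2 \<and> (\<forall>n\<ge>1. eta n \<alpha> < eta (Suc n) \<alpha>))
    \<and> (\<alpha> > 0 \<longrightarrow> eta 0 \<alpha> = 2 \<and> (\<forall>n. eta n \<alpha> < eta (Suc n) \<alpha>))
    \<and> convergent (\<lambda>n. rho \<alpha> (P2_tree (Suc n) (Suc n)))
    \<and> (\<lambda>n. eta n \<alpha>) \<longlonglongrightarrow> Psi \<alpha>
    \<and> {c. is_rho_limit_point \<alpha> c \<and> c < Psi \<alpha>} = range (\<lambda>n. eta n \<alpha>)"
proof -
  define kappa where "kappa = \<alpha> / (1 - \<alpha>)"
  interpret alpha_param \<alpha> kappa using assms by unfold_locales (simp_all add: kappa_def)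
  note eta = eta_eq[OF assms, folded kappa_def]
  note gamma = gamma_root_eq[OF assms, folded kappa_def]
  have Psi: "Psi \<alpha> = level \<alpha> (sqrt_gamma_inf kappa)"
    unfolding Psi_def by (rule limI[OF rho_P2_tree_diag_tendsto])
  have "\<exists>!x. x > 0 \<and> Phi n \<alpha> x = 0" if "n \<ge> 1" for n
    using Phi_root_iff[OF assms that, folded kappa_def] sqrt_gamma(1)[OF kappa_nonneg, of n]
    by (intro ex1I[of _ "(sqrt_gamma kappa n)\<^sup>2"]) auto
  moreover have "gamma_root 1 \<alpha> \<in> {0<..1}"
    using sqrt_gamma(1,2)[OF kappa_nonneg, of 1] by (simp add: gamma power_le_one)
  moreover have "gamma_root n \<alpha> \<in> {0<..<1}" if n: "n \<ge> 2" for n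
  proof -
    have "sqrt_gamma kappa (Suc (n - 1)) < sqrt_gamma kappa (n - 1)" using n by (intro sqrt_gamma_Suc_less[OF kappa_nonneg]) auto
    then have "sqrt_gamma kappa n < 1" using sqrt_gamma(2)[OF kappa_nonneg, of "n - 1"] n by simp
    then show ?thesis using sqrt_gamma(1)[OF kappa_nonneg, of n] by (simp add: gamma power_less_one_iff)
  qed
  moreover have "eta 0 \<alpha> = 2" by (simp add: eta level_sqrt_gamma_0)
  moreover have "eta 1 \<alpha> = 2" if "\<alpha> = 0"
  proof -
    have "kappa = 0" using that by (simp add: kappa_def)
    then show ?thesis unfolding eta by (simp only: sqrt_gamma_1_zero level_1)
  qed
  moreover have "eta n \<alpha> < eta (Suc n) \<alpha>" if "n \<ge> 1 \<or> \<alpha> > 0" for n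
    using that assms unfolding eta by (intro level_sqrt_gamma_Suc_less) (auto simp: kappa_def)
  moreover have "convergent (\<lambda>n. rho \<alpha> (P2_tree (Suc n) (Suc n)))"
    using rho_P2_tree_diag_tendsto by (rule convergentI)
  moreover have "(\<lambda>n. eta n \<alpha>) \<longlonglongrightarrow> Psi \<alpha>"
    unfolding Psi eta by (rule level_sqrt_gamma_tendsto)
  moreover have "{c. is_rho_limit_point \<alpha> c \<and> c < Psi \<alpha>} = range (\<lambda>n. eta n \<alpha>)"
    unfolding Psi eta by (rule limit_points_below)
  ultimately show ?thesis by blast
qed

end
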